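(* Let $k$ be an algebraically closed field of characteristic $0$ and let $a,b\in k$ satisfy $$(4a^3+27-18ab-a^2b^2+4b^3)(b^3-27)\neq 0 .$$ Put $F(X)=X^3+aX^2+bX+1$ and $G(X)=4X^3+b^2X^2+2bX+1$. Then the equation $Y^2=G(X)F(X)$ defines a genus $2$ field $K=k(X,Y)$. It has elliptic subfields of degree $3$, $E_i=k(U_i,V_i)$, $i=1,2$, where $$U_1=\frac{X^2}{F(X)},\qquad V_1=Y\,\frac{X^3-bX-2}{F(X)^2},$$ and $U_2,V_2$ are as follows. (1) If $b(b^3-4ab+9)\ne 0$, then $$U_2=\frac{(X-s)^2(X-t)}{G(X)},\qquad s=-\frac3b,\quad t=\frac{3a-b^2}{b^3-4ab+9},$$ $$V_2=\frac{\sqrt{27-b^3}\;Y}{G(X)^2}\Big((4ab-8-b^3)X^3-(b^2-4a)X^2+bX+1\Big).$$ (2) If $b=0$, then $$U_2=\frac{3X-a}{3(4X^3+1)},\qquad V_2=Y\,\frac{8X^3-4aX^2-1}{(4X^3+1)^2}.$$ (3) If $b^3-4ab+9=0$, then $$U_2=\frac{(bX+3)^2}{b^2G(X)},\qquad V_2=\frac{8}{b}\sqrt b\,\frac{Y}{G(X)^2}\,(bX^3+9X^2+b^2X+b).$$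
   Context: An elliptic subfield of $K$ of degree $3$ is an intermediate field $k\subset E\subset K$ of genus $1$ with $[K:E]=3$. Square roots of elements of $k$ denote any fixed choice. *)

theory Defs
  imports "HOL-Algebra.Algebraic_Closure_Type" "HOL-Algebra.Generated_Fields"
begin

text \<open>
  All fields are subfields of an ambient field given by a type \<open>'a :: field\<close>, so that formulas
  are written in class arithmetic; subfields, generated fields and degrees are those of
  HOL-Algebra, applied to the following structure on the whole type.
\<close>

abbreviation Amb :: "'a::field ring" where
  "Amb \<equiv> ring_of_type_algebra"

abbreviation sub_ring :: "'a::field set \<Rightarrow> 'a ring" where
  "sub_ring V \<equiv> Amb\<lparr>carrier := V\<rparr>"

definition adjoin :: "'a::field set \<Rightarrow> 'a set \<Rightarrow> 'a set" where
  "adjoin k S = generate_field Amb (k \<union> S)"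

definition function_field :: "'a::field set \<Rightarrow> 'a set \<Rightarrow> bool" where
  "function_field k E \<longleftrightarrow> subfield k Amb \<and> subfield E Amb \<and> k \<subseteq> E \<and>
     (\<exists>x\<in>E. ring.transcendental Amb k x \<and> ring.finite_dimension Amb (adjoin k {x}) E)"

text \<open>Places of \<open>E / k\<close> are represented by their valuation rings.\<close>

definition valuation_ring :: "'a::field set \<Rightarrow> 'a set \<Rightarrow> 'a set \<Rightarrow> bool" where
  "valuation_ring k E V \<longleftrightarrow> subring V Amb \<and> k \<subset> V \<and> V \<subset> E \<and> (\<forall>z\<in>E. z \<in> V \<or> inverse z \<in> V)"

definition max_ideal :: "'a::field set \<Rightarrow> 'a set" where
  "max_ideal V = V - Units (sub_ring V)"

definition residue_field :: "'a::field set \<Rightarrow> 'a set ring" where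
  "residue_field V = sub_ring V Quot max_ideal V"

definition place_degree :: "'a::field set \<Rightarrow> 'a set \<Rightarrow> nat" where
  "place_degree k V = ring.dim (residue_field V)
     ((\<lambda>c. max_ideal V +>\<^bsub>sub_ring V\<^esub> c) ` k) (carrier (residue_field V))"

text \<open>
  The normalized discrete valuation of a place: \<open>z = t\<^sup>n u\<close> with \<open>t\<close> a generator of the maximal
  ideal and \<open>u\<close> a unit.  It is only meaningful for \<open>z \<noteq> 0\<close>.
\<close>

definition place_ord :: "'a::field set \<Rightarrow> 'a \<Rightarrow> int" where
  "place_ord V z = (THE n. \<exists>t u. max_ideal V = {t * w |w. w \<in> V} \<and> u \<in> Units (sub_ring V) \<and>
     z = t powi n * u)"

definition divisor :: "'a::field set \<Rightarrow> 'a set \<Rightarrow> ('a set \<Rightarrow> int) \<Rightarrow> bool" where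
  "divisor k E D \<longleftrightarrow> finite {V. D V \<noteq> 0} \<and> (\<forall>V. D V \<noteq> 0 \<longrightarrow> valuation_ring k E V)"

definition divisor_degree :: "'a::field set \<Rightarrow> ('a set \<Rightarrow> int) \<Rightarrow> int" where
  "divisor_degree k D = (\<Sum>V | D V \<noteq> 0. D V * int (place_degree k V))"

definition riemann_roch_space :: "'a::field set \<Rightarrow> 'a set \<Rightarrow> ('a set \<Rightarrow> int) \<Rightarrow> 'a set" where
  "riemann_roch_space k E D =
     {z \<in> E. z = 0 \<or> (\<forall>V. valuation_ring k E V \<longrightarrow> place_ord V z \<ge> - D V)}"

text \<open>
  The genus is the maximum of \<open>deg D - l(D) + 1\<close> over all divisors \<open>D\<close>
  (for \<open>k\<close> algebraically closed in \<open>E\<close>, which is automatic for algebraically closed \<open>k\<close>).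
\<close>

definition has_genus :: "'a::field set \<Rightarrow> 'a set \<Rightarrow> nat \<Rightarrow> bool" where
  "has_genus k E g \<longleftrightarrow> function_field k E \<and>
     (\<forall>D. divisor k E D \<longrightarrow>
        divisor_degree k D - int (ring.dim Amb k (riemann_roch_space k E D)) + 1 \<le> int g) \<and>
     (\<exists>D. divisor k E D \<and>
        divisor_degree k D - int (ring.dim Amb k (riemann_roch_space k E D)) + 1 = int g)"

definition elliptic_subfield :: "'a::field set \<Rightarrow> 'a set \<Rightarrow> nat \<Rightarrow> 'a set \<Rightarrow> bool" where
  "elliptic_subfield k K n E \<longleftrightarrow> subfield E Amb \<and> k \<subseteq> E \<and> E \<subseteq> K \<and>
     has_genus k E 1 \<and> ring.dimension Amb n E K"

end

theory Submission
  imports Defs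
begin

text \<open>
  For \<open>y\<^sup>2 = f(x)\<close> with \<open>f\<close> squarefree of degree \<open>2g + 1\<close>, every place of \<open>k(x, y)\<close> is the local ring
  of a point of the affine curve or of the single point at infinity; in particular it is discrete
  with residue field \<open>k\<close>, so that \<open>l(D + P) \<le> l(D) + 1\<close>.  Every divisor lies below one of the form
  \<open>D' = 2M P\<^sub>\<infinity> + div h\<close> with \<open>h \<in> k[x]\<close>, and \<open>h L(D')\<close> consists of the \<open>p(x) + q(x) y\<close> with
  \<open>deg p \<le> M\<close> and \<open>deg q < M - g\<close>.  This gives \<open>deg D - l(D) + 1 \<le> g\<close>, with equality for
  \<open>D = 2g P\<^sub>\<infinity>\<close>.  Even degree reduces to odd degree by moving a branch point to infinity.

  Each \<open>V\<^sub>i\<^sup>2\<close> is a cubic polynomial in \<open>U\<^sub>i\<close> with nonzero discriminant, so \<open>k(U\<^sub>i, V\<^sub>i)\<close> has genus 1.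
  Over it \<open>1, x, x\<^sup>2\<close> form a basis of \<open>K\<close>, because \<open>U\<^sub>i\<close> is a quotient of coprime polynomials
  in \<open>x\<close> of maximal degree 3, \<open>V\<^sub>i \<in> y k(x)\<close>, and \<open>y \<notin> k(x)\<close>.
\<close>

section \<open>Subfields and polynomials over them\<close>

text \<open>Odd degree makes the spaces computable: at the single point at infinity
  \<open>p(x)\<close> has even and \<open>q(x) y\<close> odd order, so poles never cancel and the
  order of a sum is read off the two degrees. Divisors above \<open>D\<close> suffice because
  \<open>deg D - l(D)\<close> cannot decrease when \<open>D\<close> grows. The valuation rings in
  the definition are not assumed discrete, so they have to be classified before any order can be
  computed. The shape of the formulas: up to a constant, the numerator of \<open>V_i\<close> is that
  of the derivative of \<open>U_i\<close> with the linear factor of its double zero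
  (\<open>x\<close> for i = 1, \<open>x - s\<close> for i = 2) removed. So \<open>dU_i / V_i\<close>
  is a constant multiple of \<open>x dx / y\<close> or \<open>(x - s) dx / y\<close>, or of
  \<open>dx / y\<close> when \<open>s\<close> is infinite. The special cases \<open>b = 0\<close>
  and \<open>b^3 - 4ab + 9 = 0\<close> are those in which the zero \<open>s\<close> or
  \<open>t\<close> of \<open>U_2\<close> moves to infinity. The hypothesis provides the six branch
  points: its two factors are, up to nonzero constants, the discriminants of \<open>F\<close> and
  \<open>G\<close>, and the first one also lies in the ideal generated by \<open>F\<close> and
  \<open>G\<close>.\<close>

lemmas field_Amb = field_from_type_algebra

interpretation Amb: domain "Amb :: 'a::field ring"
  by (rule field.axioms(1)[OF field_Amb])

lemma Amb_simps [simp]: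
  "carrier (Amb :: 'a::field ring) = UNIV"
  "monoid.mult (Amb :: 'a ring) = (*)"
  "one (Amb :: 'a ring) = 1"
  "ring.zero (Amb :: 'a ring) = 0"
  "ring.add (Amb :: 'a ring) = (+)"
  by (simp_all add: ring_of_type_algebra_def)

lemma Amb_a_inv [simp]: "\<ominus>\<^bsub>Amb\<^esub> x = - (x :: 'a::field)"
  using Amb.minus_equality[of "- x" x] by simp

lemma Amb_m_inv [simp]: "x \<noteq> 0 \<Longrightarrow> inv\<^bsub>Amb\<^esub> x = inverse (x :: 'a::field)"
  using Amb.comm_inv_char[of x "inverse x"] by simp

lemma Amb_nat_pow [simp]: "x [^]\<^bsub>Amb\<^esub> (n::nat) = (x :: 'a::field) ^ n"
  by (induction n) (simp_all add: Amb.nat_pow_Suc)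

lemma subfieldD:
  assumes "subfield (k :: 'a::field set) Amb"
  shows "0 \<in> k" "1 \<in> k"
    and "a \<in> k \<Longrightarrow> b \<in> k \<Longrightarrow> a + b \<in> k"
    and "a \<in> k \<Longrightarrow> b \<in> k \<Longrightarrow> a * b \<in> k"
    and "a \<in> k \<Longrightarrow> - a \<in> k"
    and "a \<in> k \<Longrightarrow> b \<in> k \<Longrightarrow> a - b \<in> k"
    and "a \<in> k \<Longrightarrow> inverse a \<in> k"
    and "a \<in> k \<Longrightarrow> b \<in> k \<Longrightarrow> a / b \<in> k"
    and "a \<in> k \<Longrightarrow> a ^ n \<in> k"
    and "a \<in> k \<Longrightarrow> a powi i \<in> k"
    and "numeral m \<in> k"
proof -
  note sr = subringE[OF subfieldE(1)[OF assms]]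
  show 0: "0 \<in> k" and 1: "1 \<in> k" using sr(2,3) by simp_all
  show add: "a + b \<in> k" if "a \<in> k" "b \<in> k" for a b using sr(7)[OF that] by simp
  show mult: "a * b \<in> k" if "a \<in> k" "b \<in> k" for a b using sr(6)[OF that] by simp
  show uminus: "- a \<in> k" if "a \<in> k" for a using sr(5)[OF that] by simp
  show "a - b \<in> k" if "a \<in> k" "b \<in> k" for a b
    using add[OF that(1) uminus[OF that(2)]] by simp
  show inv: "inverse a \<in> k" if "a \<in> k" for a
    using Amb.subfield_m_inv(1)[OF assms, of a] that 0 by (cases "a = 0") auto
  show "a / b \<in> k" if "a \<in> k" "b \<in> k" for a b
    using mult[OF that(1) inv[OF that(2)]] by (simp add: divide_inverse)
  show pow: "a ^ n \<in> k" if "a \<in> k" for a n using that by (induction n) (auto intro: 1 mult)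
  show "a powi i \<in> k" if "a \<in> k" for a i
    using that by (auto simp: power_int_def intro: pow inv)
  have "of_nat n \<in> k" for n by (induction n) (auto intro: 0 1 add)
  from this[of "numeral m"] show "numeral m \<in> k" by simp
qed

lemma subfield_AmbI:
  assumes "1 \<in> k" "\<And>a b. a \<in> k \<Longrightarrow> b \<in> k \<Longrightarrow> a + b \<in> k" "\<And>a. a \<in> k \<Longrightarrow> - a \<in> k"
    "\<And>a b. a \<in> k \<Longrightarrow> b \<in> k \<Longrightarrow> a * b \<in> k" "\<And>a. a \<in> k \<Longrightarrow> a \<noteq> 0 \<Longrightarrow> inverse a \<in> k"
  shows "subfield (k :: 'a::field set) Amb"
proof (rule field.subfieldI'[OF field_Amb])
  show "subring k Amb" by (rule Amb.subringI) (use assms in auto)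
qed (use assms in auto)

lemma subfield_adjoin: "subfield (adjoin k S) (Amb :: 'a::field ring)"
  unfolding adjoin_def by (rule field.generate_field_is_subfield[OF field_Amb]) simp

lemma adjoin_incl: "k \<subseteq> adjoin k S" "S \<subseteq> adjoin k S" for k :: "'a::field set"
  unfolding adjoin_def by (auto intro: generate_field.incl)

lemma adjoin_least:
  assumes "subfield E Amb" "k \<subseteq> E" "S \<subseteq> (E :: 'a::field set)" shows "adjoin k S \<subseteq> E"
  unfolding adjoin_def by (rule field.generate_field_min_subfield1[OF field_Amb]) (use assms in auto)

text \<open>Polynomials over \<open>k\<close> are polynomials over the whole type with coefficients
  in \<open>k\<close>, so that degree and \<open>poly\<close> of the class-based library apply. The
  coefficient lists of HOL-Algebra are met only where a notion of the statement is
  translated.\<close>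

definition polys :: "'a::field set \<Rightarrow> 'a poly set"
  where "polys k = {p. \<forall>i. Polynomial.coeff p i \<in> k}"

definition transc :: "'a::field set \<Rightarrow> 'a \<Rightarrow> bool"
  where "transc k x \<longleftrightarrow> (\<forall>p\<in>polys k. poly p x = 0 \<longrightarrow> p = 0)"

text \<open>HOL-Algebra lists coefficients from the leading one down, \<open>Poly\<close> from the
  constant term up.\<close>

lemma eval_Amb: "Amb.eval ps x = poly (Poly (rev ps)) (x :: 'a::field)"
  by (induction ps) (auto simp: Poly_append poly_monom)

lemma carrier_univ_poly_Amb:
  "ps \<in> carrier (univ_poly Amb k) \<longleftrightarrow> ps = [] \<or> (set ps \<subseteq> k \<and> hd ps \<noteq> (0 :: 'a::field))"
  by (auto simp: univ_poly_def polynomial_def)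

locale base_field =
  fixes k :: "'a::field set"
  assumes subfield: "subfield k Amb"
begin

lemmas closed [simp, intro] = subfieldD[OF subfield]

lemma sum_closed [intro]: "(\<And>i. i \<in> A \<Longrightarrow> h i \<in> k) \<Longrightarrow> sum h A \<in> k"
  by (induction A rule: infinite_finite_induct) auto

lemma prod_closed [intro]: "(\<And>i. i \<in> A \<Longrightarrow> h i \<in> k) \<Longrightarrow> prod h A \<in> k"
  by (induction A rule: infinite_finite_induct) auto

lemma polys_pCons [simp]: "pCons c p \<in> polys k \<longleftrightarrow> c \<in> k \<and> p \<in> polys k"
  by (auto simp: polys_def coeff_pCons split: nat.splits)

lemma polys_0 [simp]: "0 \<in> polys k"
  by (simp add: polys_def)

lemma polys_1 [simp]: "1 \<in> polys k"
  by (simp add: one_pCons)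

lemma polys_add [intro]: "p \<in> polys k \<Longrightarrow> q \<in> polys k \<Longrightarrow> p + q \<in> polys k"
  and polys_diff [intro]: "p \<in> polys k \<Longrightarrow> q \<in> polys k \<Longrightarrow> p - q \<in> polys k"
  and polys_uminus [intro]: "p \<in> polys k \<Longrightarrow> - p \<in> polys k"
  and polys_smult [intro]: "c \<in> k \<Longrightarrow> p \<in> polys k \<Longrightarrow> Polynomial.smult c p \<in> polys k"
  and polys_monom [intro]: "c \<in> k \<Longrightarrow> Polynomial.monom c n \<in> polys k"
  and polys_mult [intro]: "p \<in> polys k \<Longrightarrow> q \<in> polys k \<Longrightarrow> p * q \<in> polys k"
  by (auto simp: polys_def coeff_mult)

lemma polys_power [intro]: "p \<in> polys k \<Longrightarrow> p ^ n \<in> polys k"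
  by (induction n) auto

lemma polys_prod [intro]: "(\<And>i. i \<in> A \<Longrightarrow> h i \<in> polys k) \<Longrightarrow> prod h A \<in> polys k"
  by (induction A rule: infinite_finite_induct) auto

lemma polys_coeff [intro]: "p \<in> polys k \<Longrightarrow> Polynomial.coeff p i \<in> k"
  by (auto simp: polys_def)

lemma poly_closed [intro]: "p \<in> polys k \<Longrightarrow> c \<in> k \<Longrightarrow> poly p c \<in> k"
  by (induction p) auto

lemma poly_closed_over: "subfield F Amb \<Longrightarrow> k \<subseteq> F \<Longrightarrow> p \<in> polys k \<Longrightarrow> c \<in> F \<Longrightarrow> poly p c \<in> F"
  by (induction p) (auto intro!: subfieldD)

lemma polys_root_factor:
  assumes "p \<in> polys k" "c \<in> k" "poly p c = 0"
  obtains q where "q \<in> polys k" "p = [:- c, 1:] * q"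
proof
  have "synthetic_div p c \<in> polys k" using assms(1,2)
    by (induction p) auto
  then show "synthetic_div p c \<in> polys k" .
  show "p = [:- c, 1:] * synthetic_div p c"
    using synthetic_div_correct'[of c p] assms(3) by simp
qed

lemma transcendental_iff: "Amb.transcendental k x \<longleftrightarrow> transc k x"
proof
  assume x: "Amb.transcendental k x"
  show "transc k x" unfolding transc_def
  proof (intro ballI impI)
    fix p assume p: "p \<in> polys k" "poly p x = 0"
    have "rev (coeffs p) \<in> carrier (univ_poly Amb k)"
      unfolding carrier_univ_poly_Amb using p(1)
      by (cases "p = 0") (auto simp: hd_rev last_coeffs_eq_coeff_degree coeffs_def)
    moreover have "Amb.eval (rev (coeffs p)) x = 0"
      using p(2) by (simp add: eval_Amb)
    ultimately have "rev (coeffs p) = []"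
      using Amb.eval_transcendental[of k x "rev (coeffs p)"] x by (simp add: over_def)
    then show "p = 0" by simp
  qed
next
  assume x: "transc k x"
  have "a_kernel (univ_poly Amb k) Amb (\<lambda>p. Amb.eval p x) \<subseteq> {[]}"
  proof
    fix ps assume ps: "ps \<in> a_kernel (univ_poly Amb k) Amb (\<lambda>p. Amb.eval p x)"
    then have ps: "ps \<in> carrier (univ_poly Amb k)" "poly (Poly (rev ps)) x = 0"
      by (auto simp: a_kernel_def' eval_Amb)
    have "Poly (rev ps) \<in> polys k"
      using ps(1) unfolding carrier_univ_poly_Amb
      by (auto simp: polys_def nth_default_def rev_nth)
    then have "Poly (rev ps) = 0" using x ps(2) by (auto simp: transc_def)
    \<comment> \<open>This coefficient is the head of \<open>ps\<close>, and a normalised nonempty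
      list has a nonzero head.\<close>
    then have "Polynomial.coeff (Poly (rev ps)) (length ps - 1) = 0" by simp
    then show "ps \<in> {[]}" using ps(1) unfolding carrier_univ_poly_Amb
      by (cases ps) (auto simp: nth_default_def rev_nth nth_append)
  qed
  then have "a_kernel (univ_poly Amb k) Amb (\<lambda>p. Amb.eval p x) = {[]}"
    by (auto simp: a_kernel_def' univ_poly_def)
  then show "Amb.transcendental k x"
    using Amb.trivial_ker_imp_transcendental[of k x] subfieldE(1)[OF subfield] by (simp add: over_def)
qed

end

locale alg_closed_base_field = base_field +
  assumes alg_closed: "algebraically_closed (sub_ring k)"
begin

text \<open>Algebraic closedness is given as splitting: the multiset of roots is as large as the
  degree, hence nonempty here.\<close>

lemma root_exists:
  assumes "p \<in> polys k" "Polynomial.degree p > 0"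
  shows "\<exists>c\<in>k. poly p c = 0"
proof -
  interpret L: algebraically_closed "sub_ring k" by (rule alg_closed)
  have consist: "L.eval = Amb.eval"
    using Amb.eval_consistent[OF subfieldE(1)[OF subfield]] by simp
  have P: "rev (coeffs p) \<in> carrier (poly_ring (sub_ring k))"
    using assms by (auto simp: univ_poly_def polynomial_def hd_rev last_coeffs_eq_coeff_degree coeffs_def)
  have "length (rev (coeffs p)) - 1 > 0" using assms(2) by (cases "p = 0") (simp_all add: length_coeffs_degree)
  then have "L.roots (rev (coeffs p)) \<noteq> {#}"
    using L.roots_over_carrier[OF P] by (metis L.splitted_def less_irrefl size_empty)
  then obtain c where "c \<in># L.roots (rev (coeffs p))" by blast
  then have "L.is_root (rev (coeffs p)) c"
    using L.roots_mem_iff_is_root[OF P] by auto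
  then show ?thesis by (auto simp: L.is_root_def consist eval_Amb)
qed

lemma split_linear:
  assumes "p \<in> polys k" "p \<noteq> 0"
  shows "\<exists>cs. set cs \<subseteq> k \<and> length cs = Polynomial.degree p \<and>
    p = Polynomial.smult (Polynomial.lead_coeff p) (\<Prod>c\<leftarrow>cs. [:- c, 1:])"
  using assms
proof (induction "Polynomial.degree p" arbitrary: p)
  case 0
  then show ?case by (intro exI[of _ "[]"]) (auto elim: degree_eq_zeroE)
next
  case (Suc n)
  from root_exists[of p] Suc obtain c where c: "c \<in> k" "poly p c = 0" by auto
  obtain q where q: "q \<in> polys k" "p = [:- c, 1:] * q" using polys_root_factor[OF Suc.prems(1) c] .
  have "q \<noteq> 0" using q Suc.prems by auto
  then have "Polynomial.degree p = Suc (Polynomial.degree q)"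
    unfolding q(2) by (subst degree_mult_eq) auto
  with Suc.hyps(1)[of q] Suc.hyps(2) q(1) \<open>q \<noteq> 0\<close> obtain cs where
    cs: "set cs \<subseteq> k" "length cs = Polynomial.degree q"
      "q = Polynomial.smult (Polynomial.lead_coeff q) (\<Prod>c\<leftarrow>cs. [:- c, 1:])" by auto
  have "p = Polynomial.smult (Polynomial.lead_coeff p) (\<Prod>c\<leftarrow>c # cs. [:- c, 1:])"
    unfolding q(2) lead_coeff_mult by (subst cs(3)) (simp add: mult_smult_right)
  then show ?case using cs c(1) \<open>Polynomial.degree p = _\<close>
    by (intro exI[of _ "c # cs"]) auto
qed

end

section \<open>Quadratic extensions and fields generated by adjunction\<close>

lemma quadratic_extension_unique:
  assumes F: "subfield F Amb" and "v \<notin> F" "a \<in> F" "b \<in> F" "a + b * v = (0 :: 'a::field)"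
  shows "a = 0 \<and> b = 0"
proof -
  have "b = 0"
  proof (rule ccontr)
    assume "b \<noteq> 0"
    then have "v = - a / b" using assms(5) by (simp add: field_simps eq_neg_iff_add_eq_0 add.commute)
    then show False using assms subfieldD[OF F] by metis
  qed
  then show ?thesis using assms(5) by simp
qed

lemma quadratic_extension_subfield:
  assumes F: "subfield F Amb" and v: "v ^ 2 \<in> F" "v \<notin> (F :: 'a::field set)"
  shows "subfield {a + b * v | a b. a \<in> F \<and> b \<in> F} Amb"
proof -
  note F' [simp, intro] = subfieldD[OF F]
  define E where "E = {a + b * v | a b. a \<in> F \<and> b \<in> F}"
  have EI: "a + b * v \<in> E" if "a \<in> F" "b \<in> F" for a b using that by (auto simp: E_def)
  have EE: "\<exists>a\<in>F. \<exists>b\<in>F. z = a + b * v" if "z \<in> E" for z using that by (auto simp: E_def)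
  have "subfield E Amb"
  proof (rule subfield_AmbI)
    show "1 \<in> E" using EI[of 1 0] by simp
  next
    fix z assume "z \<in> E"
    with EE obtain a b where ab: "a \<in> F" "b \<in> F" "z = a + b * v" by blast
    show "- z \<in> E" using EI[of "- a" "- b"] ab by (simp add: algebra_simps)
    assume nz: "z \<noteq> 0"
    have nz': "a + (- b) * v \<noteq> 0"
      using quadratic_extension_unique[OF F v(2), of a "- b"] ab nz by auto
    \<comment> \<open>\<open>N\<close> is the norm of \<open>z\<close> and lies in \<open>F\<close>,
      so the conjugate divided by \<open>N\<close> is the inverse.\<close>
    define N where "N = a ^ 2 - b ^ 2 * v ^ 2"
    have N: "N \<in> F" "N = z * (a + (- b) * v)"
      using ab v(1) by (auto simp: N_def algebra_simps power2_eq_square)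
    have "inverse z = (a + (- b) * v) / N"
      using nz nz' unfolding N(2) by (simp add: divide_simps)
    also have "\<dots> = a / N + (- b / N) * v" by (simp add: add_divide_distrib diff_divide_distrib)
    finally show "inverse z \<in> E" using EI[of "a / N" "- b / N"] ab N(1) by simp
  next
    fix z w assume "z \<in> E" "w \<in> E"
    from EE[OF \<open>z \<in> E\<close>] obtain a b where ab: "a \<in> F" "b \<in> F" "z = a + b * v" by blast
    from EE[OF \<open>w \<in> E\<close>] obtain c d where cd: "c \<in> F" "d \<in> F" "w = c + d * v" by blast
    show "z + w \<in> E" using EI[of "a + c" "b + d"] ab cd by (simp add: algebra_simps)
    show "z * w \<in> E" using EI[of "a * c + b * d * v ^ 2" "a * d + b * c"] ab cd v(1)
      by (simp add: algebra_simps power2_eq_square)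
  qed
  then show ?thesis by (simp add: E_def)
qed

lemma adjoin_pair:
  assumes v: "v ^ 2 \<in> adjoin k {u}" "v \<notin> adjoin k {u :: 'a::field}"
  shows "adjoin k {u, v} = {a + b * v | a b. a \<in> adjoin k {u} \<and> b \<in> adjoin k {u}}" (is "_ = ?E")
proof
  note F [simp, intro] = subfieldD[OF subfield_adjoin[of k "{u}"]]
  have sub: "adjoin k {u} \<subseteq> ?E"
  proof
    fix a assume "a \<in> adjoin k {u}"
    then have "a = a + 0 * v \<and> a \<in> adjoin k {u} \<and> 0 \<in> adjoin k {u}" by simp
    then show "a \<in> ?E" by blast
  qed
  have "v = 0 + 1 * v \<and> 0 \<in> adjoin k {u} \<and> 1 \<in> adjoin k {u}" by simp
  then have "v \<in> ?E" by blast
  then show "adjoin k {u, v} \<subseteq> ?E"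
    using sub adjoin_incl(1)[of k "{u}"] adjoin_incl(2)[of "{u}" k] quadratic_extension_subfield[OF subfield_adjoin v]
    by (intro adjoin_least) auto
  have "adjoin k {u} \<subseteq> adjoin k {u, v}"
    using adjoin_incl(1)[of k "{u, v}"] adjoin_incl(2)[of "{u, v}" k] by (intro adjoin_least subfield_adjoin) auto
  then show "?E \<subseteq> adjoin k {u, v}"
    using adjoin_incl(2)[of "{u, v}" k] by (auto intro!: subfieldD[OF subfield_adjoin])
qed

lemma adjoin_eqI:
  assumes "S \<subseteq> adjoin k T" "T \<subseteq> adjoin k (S :: 'a::field set)"
  shows "adjoin k S = adjoin k T"
  using assms adjoin_incl(1) by (intro equalityI adjoin_least subfield_adjoin)

context base_field
begin

lemma adjoin_eq_fractions:
  "adjoin k {x} = {poly p x / poly q x | p q. p \<in> polys k \<and> q \<in> polys k \<and> poly q x \<noteq> 0}"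
  (is "_ = ?F")
proof
  define L where "L = ?F"
  have FI: "poly p x / poly q x \<in> L" if "p \<in> polys k" "q \<in> polys k" "poly q x \<noteq> 0" for p q
    using that unfolding L_def by blast
  have FE: "\<exists>p q. z = poly p x / poly q x \<and> p \<in> polys k \<and> q \<in> polys k \<and> poly q x \<noteq> 0"
    if "z \<in> L" for z using that unfolding L_def by blast
  have "subfield L Amb"
  proof (rule subfield_AmbI)
    show "1 \<in> L" using FI[of 1 1] by simp
  next
    fix z assume "z \<in> L"
    with FE obtain p q where pq: "z = poly p x / poly q x" "p \<in> polys k" "q \<in> polys k" "poly q x \<noteq> 0"
      by blast
    show "- z \<in> L" using FI[of "- p" q] pq by auto
    show "inverse z \<in> L" if "z \<noteq> 0" using FI[of q p] pq that by auto
  next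
    fix z w assume "z \<in> L" "w \<in> L"
    from FE[OF \<open>z \<in> L\<close>] obtain p q
      where pq: "z = poly p x / poly q x" "p \<in> polys k" "q \<in> polys k" "poly q x \<noteq> 0" by blast
    from FE[OF \<open>w \<in> L\<close>] obtain r s
      where rs: "w = poly r x / poly s x" "r \<in> polys k" "s \<in> polys k" "poly s x \<noteq> 0" by blast
    have "z + w = poly (p * s + r * q) x / poly (q * s) x" 
      unfolding pq(1) rs(1) using pq(4) rs(4) by (simp add: add_frac_eq)
    then show "z + w \<in> L" using FI[of "p * s + r * q" "q * s"] pq rs by auto
    have "z * w = poly (p * r) x / poly (q * s) x" using pq rs by simp
    then show "z * w \<in> L" using FI[of "p * r" "q * s"] pq rs by auto
  qed
  moreover have "k \<subseteq> L"
  proof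
    fix c assume "c \<in> k"
    then show "c \<in> L" using FI[of "[:c:]" 1] by simp
  qed
  moreover have "x \<in> L" using FI[of "[:0, 1:]" 1] by simp
  ultimately show "adjoin k {x} \<subseteq> ?F" unfolding L_def[symmetric] by (intro adjoin_least) auto
  show "?F \<subseteq> adjoin k {x}"
    using poly_closed_over[OF subfield_adjoin adjoin_incl(1)] adjoin_incl(2)[of "{x}" k]
    by (auto intro!: subfieldD[OF subfield_adjoin])
qed

lemma adjoinE:
  assumes "z \<in> adjoin k {x}"
  obtains p q where "p \<in> polys k" "q \<in> polys k" "poly q x \<noteq> 0" "z = poly p x / poly q x"
  using assms unfolding adjoin_eq_fractions by auto

lemma poly_in_adjoin [intro]: "p \<in> polys k \<Longrightarrow> poly p x \<in> adjoin k {x}"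
  using poly_closed_over[OF subfield_adjoin adjoin_incl(1)] adjoin_incl(2)[of "{x}" k] by auto

lemma line_extension_eq: "Amb.line_extension k v S = {c * v + s | c s. c \<in> k \<and> s \<in> S}"
  using Amb.line_extension_mem_iff[of _ k v S] by auto

lemma dimension_Suc:
  assumes "Amb.dimension n k S" "v \<notin> S"
  shows "Amb.dimension (Suc n) k {c * v + s | c s. c \<in> k \<and> s \<in> S}"
  using Amb.Suc_dim[of v S n k] assms by (simp add: line_extension_eq)

text \<open>For \<open>c\<close> the inverse of a function this compares the Riemann-Roch spaces of
  two linearly equivalent divisors.\<close>

lemma dimension_scale:
  assumes "Amb.dimension n k S" "c \<noteq> 0"
  shows "Amb.dimension n k ((*) c ` S)"
  using assms(1)
proof (induction n arbitrary: S)
  case 0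
  then show ?case using Amb.dimension_zero[OF subfield 0] Amb.zero_dim[of k] by simp
next
  case (Suc n)
  then obtain v T where T: "Amb.dimension n k T" "v \<notin> T" "S = Amb.line_extension k v T"
    using Amb.dimension_backwards[OF subfield Suc.prems] by auto
  have "c * v \<notin> (*) c ` T" using T(2) assms(2) by auto
  from dimension_Suc[OF Suc.IH[OF T(1)] this]
  have "Amb.dimension (Suc n) k {d * (c * v) + s | d s. d \<in> k \<and> s \<in> (*) c ` T}" .
  also have "{d * (c * v) + s | d s. d \<in> k \<and> s \<in> (*) c ` T} = (*) c ` S"
    by (force simp: T(3) line_extension_eq algebra_simps)
  finally show ?case .
qed

lemma dim_eq: "Amb.dimension n k S \<Longrightarrow> Amb.dim k S = n"
  using Amb.dimI[OF subfield, of n S] by (simp add: over_def)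

lemma dimension_unique: "Amb.dimension n k S \<Longrightarrow> Amb.dimension m k S \<Longrightarrow> n = m"
  using dim_eq by blast

lemma dimension_subspace:
  assumes "Amb.dimension n k S" "T \<subseteq> S" "0 \<in> T"
    and "\<And>u v. u \<in> T \<Longrightarrow> v \<in> T \<Longrightarrow> u + v \<in> T" "\<And>c u. c \<in> k \<Longrightarrow> u \<in> T \<Longrightarrow> c * u \<in> T"
  obtains m where "Amb.dimension m k T"
proof -
  have "- u \<in> T" if "u \<in> T" for u using assms(5)[of "-1" u] that by simp
  then have "subgroup T (add_monoid Amb)"
    using Amb.add.subgroupI[of T] assms by (auto simp: a_inv_def[symmetric])
  then have "subalgebra k T Amb" using assms(5) by (simp add: subalgebra_def subalgebra_axioms_def)
  then show ?thesis
    using Amb.subalbegra_incl_imp_finite_dimension[OF subfield _ _ assms(2)]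
      Amb.finite_dimensionI[OF assms(1)] that by (auto simp: Amb.finite_dimension_def)
qed

end

text \<open>Nothing is asked of the degree or the roots of \<open>f\<close>, so that one locale
  serves both the affine curve and the chart around the point at infinity.\<close>

locale quadratic_field = base_field k for k :: "'a::field set" +
  fixes x y :: 'a and f :: "'a poly"
  assumes f: "f \<in> polys k" and y_sq: "y ^ 2 = poly f x"
    and x_transc: "transc k x" and y_notin: "y \<notin> adjoin k {x}"
begin

lemma poly_x_eq_0_iff: "p \<in> polys k \<Longrightarrow> poly p x = 0 \<longleftrightarrow> p = 0"
  using x_transc by (auto simp: transc_def)

lemma pair_eq_0_iff:
  assumes "p \<in> polys k" "q \<in> polys k"
  shows "poly p x + poly q x * y = 0 \<longleftrightarrow> p = 0 \<and> q = 0"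
  using quadratic_extension_unique[OF subfield_adjoin y_notin, of "poly p x" "poly q x"] assms
  by (auto simp: poly_x_eq_0_iff)

lemma pair_inj:
  assumes "p \<in> polys k" "q \<in> polys k" "p' \<in> polys k" "q' \<in> polys k"
    and "poly p x + poly q x * y = poly p' x + poly q' x * y"
  shows "p = p' \<and> q = q'"
  using pair_eq_0_iff[of "p - p'" "q - q'"] assms by (auto simp: algebra_simps)

lemma field_eq: "adjoin k {x, y} = {a + b * y | a b. a \<in> adjoin k {x} \<and> b \<in> adjoin k {x}}"
  using y_sq y_notin f by (intro adjoin_pair) auto

lemma field_elem:
  assumes "z \<in> adjoin k {x, y}"
  obtains p q r where "p \<in> polys k" "q \<in> polys k" "r \<in> polys k" "r \<noteq> 0"
    "z = (poly p x + poly q x * y) / poly r x"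
proof -
  obtain a b where ab: "z = a + b * y" "a \<in> adjoin k {x}" "b \<in> adjoin k {x}"
    using assms field_eq by auto
  obtain p q where pq: "p \<in> polys k" "q \<in> polys k" "poly q x \<noteq> 0" "a = poly p x / poly q x"
    using ab(2) by (rule adjoinE)
  obtain r s where rs: "r \<in> polys k" "s \<in> polys k" "poly s x \<noteq> 0" "b = poly r x / poly s x"
    using ab(3) by (rule adjoinE)
  show ?thesis
    using pq rs ab(1)
    by (intro that[of "p * s" "q * r" "q * s"]) (auto simp: add_divide_distrib)
qed

lemma x_in: "x \<in> adjoin k {x, y}" and y_in: "y \<in> adjoin k {x, y}" and k_in: "k \<subseteq> adjoin k {x, y}"
  using adjoin_incl(1)[of k "{x, y}"] adjoin_incl(2)[of "{x, y}" k] by auto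

lemma pair_in: "p \<in> polys k \<Longrightarrow> q \<in> polys k \<Longrightarrow> poly p x + poly q x * y \<in> adjoin k {x, y}"
  using poly_closed_over[OF subfield_adjoin k_in _ x_in] y_in
  by (intro subfieldD(3,4)[OF subfield_adjoin])

lemma x_notin_k: "x \<notin> k"
  using poly_x_eq_0_iff[of "[:-x, 1:]"] by auto

lemma function_field: "function_field k (adjoin k {x, y})"
  unfolding function_field_def
proof (intro conjI bexI[of _ x] subfield subfield_adjoin k_in x_in)
  show "Amb.transcendental k x" using x_transc by (simp add: transcendental_iff)
  interpret L: base_field "adjoin k {x}" by (rule base_field.intro[OF subfield_adjoin])
  have "Amb.dimension (Suc 1) (adjoin k {x}) {c * y + s | c s. c \<in> adjoin k {x} \<and> s \<in> adjoin k {x}}"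
    using Amb.dimension_one[OF subfield_adjoin] y_notin by (rule L.dimension_Suc)
  also have "{c * y + s | c s. c \<in> adjoin k {x} \<and> s \<in> adjoin k {x}} = adjoin k {x, y}"
    unfolding field_eq by (auto simp: add.commute)
  finally show "Amb.finite_dimension (adjoin k {x}) (adjoin k {x, y})"
    by (rule Amb.finite_dimensionI)
qed

definition poly_space :: "nat \<Rightarrow> nat \<Rightarrow> 'a set"
  where "poly_space m n = {poly p x + poly q x * y | p q. p \<in> polys k \<and> q \<in> polys k \<and>
    (\<forall>i\<ge>m. Polynomial.coeff p i = 0) \<and> (\<forall>i\<ge>n. Polynomial.coeff q i = 0)}"

lemma poly_spaceI:
  assumes "p \<in> polys k" "q \<in> polys k" "\<And>i. i \<ge> m \<Longrightarrow> Polynomial.coeff p i = 0"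
    "\<And>i. i \<ge> n \<Longrightarrow> Polynomial.coeff q i = 0" "z = poly p x + poly q x * y"
  shows "z \<in> poly_space m n"
  using assms by (auto simp: poly_space_def)

lemma coeff_bound_Suc:
  assumes "p \<in> polys k" "\<forall>i\<ge>Suc m. Polynomial.coeff p i = 0"
  obtains p' where "p' \<in> polys k" "\<forall>i\<ge>m. Polynomial.coeff p' i = 0"
    "p = p' + Polynomial.monom (Polynomial.coeff p m) m"
proof (rule that[of "p - Polynomial.monom (Polynomial.coeff p m) m"])
  show "\<forall>i\<ge>m. Polynomial.coeff (p - Polynomial.monom (Polynomial.coeff p m) m) i = 0"
    using assms(2) by (auto simp: Suc_le_eq)
qed (use assms in auto)

text \<open>A basis is \<open>x ^ i\<close> for \<open>i < m\<close> together with
  \<open>x ^ j * y\<close> for \<open>j < n\<close>. The inductions append one basis element at a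
  time; \<open>pair_inj\<close> keeps it outside the span of the earlier ones.\<close>

lemma dimension_poly_space: "Amb.dimension (m + n) k (poly_space m n)"
proof (induction m)
  case 0
  show ?case
  proof (induction n)
    case 0
    have "(\<forall>i. Polynomial.coeff p i = 0) \<longleftrightarrow> p = 0" for p :: "'a poly"
      by (simp add: poly_eq_iff)
    then have "poly_space 0 0 = {0}" by (auto simp: poly_space_def)
    then show ?case using Amb.zero_dim[of k] by simp
  next
    case (Suc n)
    have "x ^ n * y \<notin> poly_space 0 n"
    proof
      assume "x ^ n * y \<in> poly_space 0 n"
      then obtain p q where pq: "p \<in> polys k" "q \<in> polys k" "x ^ n * y = poly p x + poly q x * y"
        "\<forall>i\<ge>n. Polynomial.coeff q i = 0" by (auto simp: poly_space_def)
      then have "Polynomial.monom 1 n = q"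
        using pair_inj[of 0 "Polynomial.monom 1 n" p q] by (auto simp: poly_monom)
      then show False using pq(4) by auto
    qed
    from dimension_Suc[OF Suc this]
    have "Amb.dimension (0 + Suc n) k {c * (x ^ n * y) + s | c s. c \<in> k \<and> s \<in> poly_space 0 n}" by simp
    also have "{c * (x ^ n * y) + s | c s. c \<in> k \<and> s \<in> poly_space 0 n} = poly_space 0 (Suc n)"
    proof (intro equalityI subsetI)
      fix z assume "z \<in> {c * (x ^ n * y) + s | c s. c \<in> k \<and> s \<in> poly_space 0 n}"
      then obtain c p q where "z = c * (x ^ n * y) + (poly p x + poly q x * y)" "c \<in> k"
        "p \<in> polys k" "q \<in> polys k" "\<forall>i. Polynomial.coeff p i = 0" "\<forall>i\<ge>n. Polynomial.coeff q i = 0"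
        by (auto simp: poly_space_def)
      then show "z \<in> poly_space 0 (Suc n)"
        by (intro poly_spaceI[of p "q + Polynomial.monom c n"])
           (auto simp: poly_monom algebra_simps)
    next
      fix z assume "z \<in> poly_space 0 (Suc n)"
      then obtain p q where pq: "z = poly p x + poly q x * y"
        "p \<in> polys k" "q \<in> polys k" "\<forall>i. Polynomial.coeff p i = 0" "\<forall>i\<ge>Suc n. Polynomial.coeff q i = 0"
        by (auto simp: poly_space_def)
      obtain q' where q': "q' \<in> polys k" "\<forall>i\<ge>n. Polynomial.coeff q' i = 0"
        "q = q' + Polynomial.monom (Polynomial.coeff q n) n" using coeff_bound_Suc[OF pq(3,5)] .
      have "z = Polynomial.coeff q n * (x ^ n * y) + (poly p x + poly q' x * y)"
        unfolding pq(1) by (subst q'(3)) (simp add: poly_monom algebra_simps)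
      moreover have "Polynomial.coeff q n \<in> k" "poly p x + poly q' x * y \<in> poly_space 0 n"
        using pq q' by (auto simp: poly_space_def)
      ultimately show "z \<in> {c * (x ^ n * y) + s | c s. c \<in> k \<and> s \<in> poly_space 0 n}" by blast
    qed
    finally show ?case .
  qed
next
  case (Suc m)
  have "x ^ m \<notin> poly_space m n"
  proof
    assume "x ^ m \<in> poly_space m n"
    then obtain p q where pq: "p \<in> polys k" "q \<in> polys k" "x ^ m = poly p x + poly q x * y"
      "\<forall>i\<ge>m. Polynomial.coeff p i = 0" by (auto simp: poly_space_def)
    then have "Polynomial.monom 1 m = p"
      using pair_inj[of "Polynomial.monom 1 m" 0 p q] by (auto simp: poly_monom)
    then show False using pq(4) by auto
  qed
  from dimension_Suc[OF Suc this]
  have "Amb.dimension (Suc m + n) k {c * x ^ m + s | c s. c \<in> k \<and> s \<in> poly_space m n}" by simp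
  also have "{c * x ^ m + s | c s. c \<in> k \<and> s \<in> poly_space m n} = poly_space (Suc m) n"
  proof (intro equalityI subsetI)
    fix z assume "z \<in> {c * x ^ m + s | c s. c \<in> k \<and> s \<in> poly_space m n}"
    then obtain c p q where "z = c * x ^ m + (poly p x + poly q x * y)" "c \<in> k"
      "p \<in> polys k" "q \<in> polys k" "\<forall>i\<ge>m. Polynomial.coeff p i = 0" "\<forall>i\<ge>n. Polynomial.coeff q i = 0"
      by (auto simp: poly_space_def)
    then show "z \<in> poly_space (Suc m) n"
      by (intro poly_spaceI[of "p + Polynomial.monom c m" q])
         (auto simp: poly_monom algebra_simps)
  next
    fix z assume "z \<in> poly_space (Suc m) n"
    then obtain p q where pq: "z = poly p x + poly q x * y"
      "p \<in> polys k" "q \<in> polys k" "\<forall>i\<ge>Suc m. Polynomial.coeff p i = 0" "\<forall>i\<ge>n. Polynomial.coeff q i = 0"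
      by (auto simp: poly_space_def)
    obtain p' where p': "p' \<in> polys k" "\<forall>i\<ge>m. Polynomial.coeff p' i = 0"
      "p = p' + Polynomial.monom (Polynomial.coeff p m) m" using coeff_bound_Suc[OF pq(2,4)] .
    have "z = Polynomial.coeff p m * x ^ m + (poly p' x + poly q x * y)"
      unfolding pq(1) by (subst p'(3)) (simp add: poly_monom algebra_simps)
    moreover have "Polynomial.coeff p m \<in> k" "poly p' x + poly q x * y \<in> poly_space m n"
      using pq p' by (auto simp: poly_space_def)
    ultimately show "z \<in> {c * x ^ m + s | c s. c \<in> k \<and> s \<in> poly_space m n}" by blast
  qed
  finally show ?case .
qed

end

section \<open>Rational places and the genus\<close>

text \<open>A discrete valuation ring with parameter \<open>t\<close> and residue field
  \<open>k\<close>, phrased without ideals. \<open>residue\<close> says that \<open>v - c\<close>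
  lies in the maximal ideal; \<open>v = c\<close> is listed separately because
  \<open>inverse 0 = 0\<close> belongs to \<open>V\<close>.\<close>

locale place = base_field k for k :: "'a::field set" +
  fixes E V :: "'a set" and t :: 'a
  assumes E: "subfield E Amb" and val: "valuation_ring k E V"
    and t: "t \<in> V" "t \<noteq> 0" "inverse t \<notin> V"
    and factor: "\<And>z. z \<in> E \<Longrightarrow> z \<noteq> 0 \<Longrightarrow>
      \<exists>n u. u \<noteq> 0 \<and> u \<in> V \<and> inverse u \<in> V \<and> z = t powi n * u"
    and residue: "\<And>v. v \<in> V \<Longrightarrow> \<exists>c\<in>k. v = c \<or> inverse (v - c) \<notin> V"
begin

lemma subring: "subring V Amb" and k_sub: "k \<subseteq> V" and V_sub: "V \<subseteq> E"
  using val by (auto simp: valuation_ring_def)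

lemma V_closed [simp, intro]:
  "0 \<in> V" "1 \<in> V" "a \<in> V \<Longrightarrow> b \<in> V \<Longrightarrow> a + b \<in> V" "a \<in> V \<Longrightarrow> b \<in> V \<Longrightarrow> a * b \<in> V"
  "a \<in> V \<Longrightarrow> - a \<in> V" "a \<in> V \<Longrightarrow> b \<in> V \<Longrightarrow> a - b \<in> V"
proof -
  note sr = subringE[OF subring]
  show "0 \<in> V" "1 \<in> V" using sr(2,3) by simp_all
  show add: "a + b \<in> V" if "a \<in> V" "b \<in> V" for a b using sr(7)[OF that] by simp
  show "a * b \<in> V" if "a \<in> V" "b \<in> V" using sr(6)[OF that] by simp
  show u: "- a \<in> V" if "a \<in> V" for a using sr(5)[OF that] by simp
  show "a - b \<in> V" if "a \<in> V" "b \<in> V" using add[OF that(1) u[OF that(2)]] by simp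
qed

lemma V_power [intro]: "a \<in> V \<Longrightarrow> a ^ n \<in> V"
  by (induction n) auto

definition U where "U = {u \<in> V. u \<noteq> 0 \<and> inverse u \<in> V}"

lemma U_I: "u \<in> V \<Longrightarrow> u \<noteq> 0 \<Longrightarrow> inverse u \<in> V \<Longrightarrow> u \<in> U"
  by (simp add: U_def)

lemma U_mult: "u \<in> U \<Longrightarrow> v \<in> U \<Longrightarrow> u * v \<in> U"
  and U_inverse: "u \<in> U \<Longrightarrow> inverse u \<in> U"
  and U_nz: "u \<in> U \<Longrightarrow> u \<noteq> 0" and U_V: "u \<in> U \<Longrightarrow> u \<in> V"
  by (auto simp: U_def)

lemma U_power: "u \<in> U \<Longrightarrow> u ^ n \<in> U"
  by (induction n) (auto intro: U_mult simp: U_def)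

lemma U_power_int: "u \<in> U \<Longrightarrow> u powi n \<in> U"
  by (auto simp: power_int_def intro: U_power U_inverse)

lemma Units_eq: "Units (sub_ring V) = U"
proof -
  have "u \<in> V \<and> (\<exists>v\<in>V. v * u = 1 \<and> u * v = 1) \<longleftrightarrow> u \<in> U" for u
  proof
    assume "u \<in> V \<and> (\<exists>v\<in>V. v * u = 1 \<and> u * v = 1)"
    then obtain v where v: "u \<in> V" "v \<in> V" "u * v = 1" by auto
    then have "u \<noteq> 0" by auto
    moreover have "inverse u = v" using v by (metis inverse_unique)
    ultimately show "u \<in> U" using v by (auto simp: U_def)
  qed (auto simp: U_def intro!: bexI[of _ "inverse u"])
  then show ?thesis by (auto simp: Units_def)
qed

lemma max_ideal_eq: "max_ideal V = {v \<in> V. v = 0 \<or> inverse v \<notin> V}"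
  unfolding max_ideal_def Units_eq by (auto simp: U_def)

lemma power_int_t_U: "t powi n \<in> U \<longleftrightarrow> n = 0"
proof
  assume U: "t powi n \<in> U"
  have inv_notin: "inverse (t ^ Suc m) \<notin> V" for m
  proof
    assume "inverse (t ^ Suc m) \<in> V"
    then have "t ^ m * inverse (t ^ Suc m) \<in> V" using t by auto
    then show False using t by (auto simp: field_simps)
  qed
  show "n = 0"
  proof (rule ccontr)
    assume "n \<noteq> 0"
    then consider m where "n = int (Suc m)" | m where "n = - int (Suc m)"
      by (metis int_cases not0_implies_Suc of_nat_0 int_cases2 minus_zero)
    then show False
    proof cases
      case 1
      have "t powi n = t ^ Suc m" unfolding 1 by (rule power_int_of_nat)
      then have "inverse (t ^ Suc m) \<in> V" using U by (simp only: U_def mem_Collect_eq)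
      with inv_notin show False by blast
    next
      case 2
      have "t powi n = inverse (t ^ Suc m)" unfolding 2 power_int_minus power_int_of_nat ..
      then have "inverse (t ^ Suc m) \<in> V" using U by (simp only: U_def mem_Collect_eq)
      with inv_notin show False by blast
    qed
  qed
qed (auto simp: U_def)

lemma power_int_t_V: "n \<ge> 0 \<Longrightarrow> t powi n \<in> V"
  using t by (auto simp: power_int_def)

lemma factor_U: "z \<in> E \<Longrightarrow> z \<noteq> 0 \<Longrightarrow> \<exists>n. \<exists>u\<in>U. z = t powi n * u"
  using factor[of z] by (auto simp: U_def)

lemma factor_unique: "u \<in> U \<Longrightarrow> v \<in> U \<Longrightarrow> t powi n * u = t powi m * v \<Longrightarrow> n = m"
proof -
  assume *: "u \<in> U" "v \<in> U" "t powi n * u = t powi m * v"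
  have "t powi (n - m) = v * inverse u"
    using * t(2) U_nz[OF *(1)] by (simp add: power_int_diff field_simps)
  then have "t powi (n - m) \<in> U" using * by (auto intro: U_mult U_inverse)
  then show "n = m" by (simp add: power_int_t_U)
qed

lemma factor_V: "u \<in> U \<Longrightarrow> t powi n * u \<in> V \<longleftrightarrow> n \<ge> 0"
proof
  assume u: "u \<in> U" and "t powi n * u \<in> V"
  then have *: "t powi n * u * inverse u \<in> V" by (auto dest: U_inverse U_V)
  show "n \<ge> 0"
  proof (rule ccontr)
    assume "\<not> n \<ge> 0"
    have "t powi n \<in> V" using * U_nz[OF u] by (simp add: mult.assoc)
    moreover have "inverse (t powi n) \<in> V"
      using power_int_t_V[of "- n"] \<open>\<not> n \<ge> 0\<close> by (simp add: power_int_minus)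
    ultimately have "t powi n \<in> U" using t by (auto simp: U_def)
    with \<open>\<not> n \<ge> 0\<close> show False by (simp add: power_int_t_U)
  qed
qed (auto intro: power_int_t_V U_V)

lemma max_ideal_generated: "max_ideal V = {t * w | w. w \<in> V}"
proof (intro equalityI subsetI)
  fix v assume v: "v \<in> max_ideal V"
  show "v \<in> {t * w | w. w \<in> V}"
  proof (cases "v = 0")
    case False
    moreover from v have "v \<in> E" using V_sub by (auto simp: max_ideal_eq)
    ultimately obtain n u where u: "u \<in> U" "v = t powi n * u" using factor_U by blast
    have "n \<ge> 0" using v u factor_V by (auto simp: max_ideal_eq)
    moreover have "n \<noteq> 0"
    proof
      assume "n = 0"
      then show False using v u by (auto simp: max_ideal_eq U_def)
    qed
    ultimately have "t powi (n - 1) * u \<in> V" using u(1) by (subst factor_V) auto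
    moreover have "v = t * (t powi (n - 1) * u)" using u t by (simp add: power_int_diff)
    ultimately show ?thesis by blast
  qed (auto intro!: exI[of _ 0])
next
  fix v assume "v \<in> {t * w | w. w \<in> V}"
  then obtain w where w: "w \<in> V" "v = t * w" by auto
  have "inverse v \<notin> V" if "v \<noteq> 0"
  proof
    assume "inverse v \<in> V"
    then have "w * inverse v \<in> V" using w by auto
    then show False using w t that by (auto simp: field_simps)
  qed
  then show "v \<in> max_ideal V" using w t by (auto simp: max_ideal_eq)
qed

text \<open>The description in \<open>place_ord\<close> ranges over all generators of the maximal
  ideal. Any other generator is \<open>t * w\<close> with \<open>w\<close> a unit, and
  \<open>w powi m\<close> is absorbed by the unit factor.\<close>

lemma place_ord_eq:
  assumes "u \<in> U" shows "place_ord V (t powi n * u) = n"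
  unfolding place_ord_def
proof (rule the_equality)
  show "\<exists>t' u'. max_ideal V = {t' * w |w. w \<in> V} \<and> u' \<in> Units (sub_ring V) \<and> t powi n * u = t' powi n * u'"
    using max_ideal_generated assms Units_eq by blast
next
  fix m assume "\<exists>t' u'. max_ideal V = {t' * w |w. w \<in> V} \<and> u' \<in> Units (sub_ring V) \<and> t powi n * u = t' powi m * u'"
  then obtain t' u' where *: "max_ideal V = {t' * w |w. w \<in> V}" "u' \<in> U" "t powi n * u = t' powi m * u'"
    by (auto simp: Units_eq)
  have "t' \<in> max_ideal V" unfolding *(1) by (auto intro!: exI[of _ 1])
  then obtain w where w: "w \<in> V" "t' = t * w" using max_ideal_generated by auto
  have "t \<in> max_ideal V" unfolding max_ideal_generated by (auto intro!: exI[of _ 1])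
  then obtain w' where w': "w' \<in> V" "t = t' * w'" using *(1) by auto
  have "t * w * w' = t" using w'(2) unfolding w(2) by (rule sym)
  then have "t * (w * w') = t * 1" by (simp add: mult.assoc)
  then have "w * w' = 1" using mult_left_cancel[OF t(2)] by blast
  then have "w \<noteq> 0" "inverse w = w'" by (auto simp: inverse_unique)
  then have "w \<in> U" using w w' by (auto simp: U_def)
  moreover have "t powi n * u = t powi m * (w powi m * u')"
    using *(3) w(2) by (simp add: power_int_mult_distrib)
  ultimately show "m = n"
    using factor_unique[of u "w powi m * u'" n m] assms *(2) by (auto intro: U_mult U_power_int)
qed

lemma place_ord_factor:
  assumes "z \<in> E" "z \<noteq> 0"
  obtains u where "u \<in> U" "z = t powi place_ord V z * u"
  using factor_U[OF assms] place_ord_eq by auto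

lemma place_ord_U: "u \<in> U \<Longrightarrow> place_ord V u = 0"
  using place_ord_eq[of u 0] by simp

lemma place_ord_t: "place_ord V t = 1"
  using place_ord_eq[of 1 1] by (simp add: U_def)

lemma place_ord_mult:
  assumes "z \<in> E" "z \<noteq> 0" "w \<in> E" "w \<noteq> 0"
  shows "place_ord V (z * w) = place_ord V z + place_ord V w"
proof -
  obtain u where u: "u \<in> U" "z = t powi place_ord V z * u" using place_ord_factor[OF assms(1,2)] .
  obtain v where v: "v \<in> U" "w = t powi place_ord V w * v" using place_ord_factor[OF assms(3,4)] .
  have "z * w = t powi (place_ord V z + place_ord V w) * (u * v)"
    using t by (subst u(2), subst v(2)) (simp add: power_int_add)
  then show ?thesis using place_ord_eq[OF U_mult[OF u(1) v(1)]] by metis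
qed

lemma place_ord_1 [simp]: "place_ord V 1 = 0"
  using place_ord_U[of 1] by (simp add: U_def)

lemma place_ord_power:
  assumes "z \<in> E" "z \<noteq> 0"
  shows "place_ord V (z ^ n) = int n * place_ord V z"
proof (induction n)
  case (Suc n)
  then show ?case
    using assms place_ord_mult[of z "z ^ n"] subfieldD(9)[OF E] by (simp add: algebra_simps)
qed simp

lemma place_ord_nonneg_iff: "z \<in> E \<Longrightarrow> z \<noteq> 0 \<Longrightarrow> place_ord V z \<ge> 0 \<longleftrightarrow> z \<in> V"
  using factor_V by (metis place_ord_factor)

lemma place_ord_inverse: "z \<in> E \<Longrightarrow> z \<noteq> 0 \<Longrightarrow> place_ord V (inverse z) = - place_ord V z"
  using place_ord_mult[of z "inverse z"] subfieldD(7)[OF E, of z] by simp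

lemma place_ord_pos_iff: "z \<in> E \<Longrightarrow> z \<noteq> 0 \<Longrightarrow> place_ord V z > 0 \<longleftrightarrow> inverse z \<notin> V"
  using place_ord_nonneg_iff[of "inverse z"] place_ord_inverse[of z] subfieldD(7)[OF E, of z] by auto

lemma place_ord_const: "c \<in> k \<Longrightarrow> c \<noteq> 0 \<Longrightarrow> place_ord V c = 0"
  using k_sub closed(7)[of c] by (intro place_ord_U U_I) auto

lemma place_ord_add:
  assumes "z \<in> E" "z \<noteq> 0" "w \<in> E" "w \<noteq> 0" "z + w \<noteq> 0" "place_ord V z \<ge> n" "place_ord V w \<ge> n"
  shows "place_ord V (z + w) \<ge> n"
proof -
  note [simp, intro] = subfieldD[OF E]
  \<comment> \<open>Scaling by \<open>s\<close> turns the bound on orders into membership in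
    \<open>V\<close>, which is closed under addition.\<close>
  define s where "s = t powi (- n)"
  have s: "s \<in> E" "s \<noteq> 0" "place_ord V s = - n"
    using t V_sub place_ord_eq[of 1 "- n"] by (auto simp: s_def U_def)
  have "s * z \<in> V" "s * w \<in> V"
    using assms s by (auto simp: place_ord_nonneg_iff[symmetric] place_ord_mult)
  then have "s * (z + w) \<in> V" by (auto simp: distrib_left)
  then show ?thesis
    using assms s by (subst (asm) place_ord_nonneg_iff[symmetric]) (auto simp: place_ord_mult)
qed

lemma place_ord_uminus: "z \<in> E \<Longrightarrow> z \<noteq> 0 \<Longrightarrow> place_ord V (- z) = place_ord V z"
  using place_ord_mult[of "- 1" z] place_ord_const[of "- 1"] subfieldD[OF E] by simp

lemma place_ord_add_less:
  assumes "z \<in> E" "z \<noteq> 0" "w \<in> E" "w \<noteq> 0" "place_ord V z < place_ord V w"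
  shows "z + w \<noteq> 0 \<and> place_ord V (z + w) = place_ord V z"
proof
  note [simp, intro] = subfieldD[OF E]
  show nz: "z + w \<noteq> 0"
    using assms place_ord_uminus[of w] by (auto simp: eq_neg_iff_add_eq_0[symmetric])
  have "place_ord V (z + w) \<ge> place_ord V z"
    using assms nz by (intro place_ord_add) auto
  moreover have "\<not> place_ord V (z + w) > place_ord V z"
  proof
    assume *: "place_ord V (z + w) > place_ord V z"
    \<comment> \<open>\<open>z = (z + w) - w\<close> would have an order larger than its
      own.\<close>
    have "place_ord V ((z + w) + - w) \<ge> place_ord V z + 1"
      by (rule place_ord_add) (use assms nz * in \<open>auto simp: place_ord_uminus\<close>)
    then show False by simp
  qed
  ultimately show "place_ord V (z + w) = place_ord V z" by linarith
qed

text \<open>By \<open>residue\<close> the cosets of elements of \<open>k\<close> exhaust the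
  quotient, and a field has dimension 1 over itself. The bulk of the proof shows that the non-units
  form a maximal ideal in the sense of HOL-Algebra, so that the quotient is a field.\<close>

lemma place_degree: "place_degree k V = 1"
proof -
  define R where "R = sub_ring V"
  interpret R: cring R
    unfolding R_def using Amb.subcring_iff[of V] Amb.subcringI[OF subring] by (auto simp: mult.commute)
  have R_simps [simp]: "carrier R = V" "monoid.mult R = (*)" "one R = 1" "ring.zero R = 0" "ring.add R = (+)"
    by (simp_all add: R_def)
  have R_inv [simp]: "\<ominus>\<^bsub>R\<^esub> v = - v" if "v \<in> V" for v
    using R.minus_equality[of "- v" v] that by auto
  define I where "I = max_ideal V"
  have I_eq: "I = {t * w | w. w \<in> V}" by (simp add: I_def max_ideal_generated)
  have I_mem: "v \<in> I \<longleftrightarrow> v \<in> V \<and> (v = 0 \<or> inverse v \<notin> V)" for v by (auto simp: I_def max_ideal_eq)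
  have tI: "t * w \<in> I" if "w \<in> V" for w using that unfolding I_eq by blast
  have I_V: "I \<subseteq> V" using t by (auto simp: I_eq)
  have I_uminus: "- a \<in> I" if a: "a \<in> I" for a
  proof -
    obtain w where "w \<in> V" "a = t * w" using a by (auto simp: I_eq)
    then show ?thesis using tI[of "- w"] by auto
  qed
  have I_add: "a + b \<in> I" if ab: "a \<in> I" "b \<in> I" for a b
  proof -
    obtain w w' where "w \<in> V" "a = t * w" "w' \<in> V" "b = t * w'" using ab by (auto simp: I_eq)
    then show ?thesis using tI[of "w + w'"] by (auto simp: distrib_left)
  qed
  have I_mult: "a * b \<in> I" "b * a \<in> I" if ab: "a \<in> I" "b \<in> V" for a b
  proof -
    obtain w where "w \<in> V" "a = t * w" using ab by (auto simp: I_eq)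
    then show "a * b \<in> I" "b * a \<in> I" using tI[of "w * b"] ab by (auto simp: mult_ac)
  qed
  have "I \<noteq> {}" using I_mem[of 0] by auto
  then have "subgroup I (add_monoid R)"
    using R.add.subgroupI[of I] I_V I_uminus I_add R_inv
    by (auto simp: a_inv_def[symmetric] subset_iff)
  then have ideal: "ideal I R"
    by (rule idealI[OF R.ring_axioms]) (simp_all add: I_mult)
  have "maximalideal I R"
  proof (rule maximalidealI[OF ideal])
    show "carrier R \<noteq> I" using I_mem[of 1] by auto
    fix J assume J: "ideal J R" "I \<subseteq> J" "J \<subseteq> carrier R"
    show "J = I \<or> J = carrier R"
    proof (cases "J = I")
      case False
      then obtain j where j: "j \<in> J" "j \<notin> I" using J by auto
      then have "j \<noteq> 0" "inverse j \<in> V" using J by (auto simp: I_mem)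
      then have "1 \<in> J" using ideal.I_l_closed[OF J(1) j(1), of "inverse j"] by auto
      then show ?thesis using ideal.one_imp_carrier[OF J(1)] by auto
    qed auto
  qed
  then interpret Q: Ring.field "R Quot I"
    using maximalideal.quotient_is_field R.is_cring by blast
  have "(\<lambda>c. I +>\<^bsub>R\<^esub> c) ` k = carrier (R Quot I)"
  proof -
    have "\<exists>c\<in>k. I +>\<^bsub>R\<^esub> v = I +>\<^bsub>R\<^esub> c" if v: "v \<in> V" for v
    proof -
      obtain c where c: "c \<in> k" "v = c \<or> inverse (v - c) \<notin> V" using residue v by auto
      then have "c \<in> V" using k_sub by auto
      then have "v \<ominus>\<^bsub>R\<^esub> c = v - c" using v by (simp add: a_minus_def)
      then have "v \<ominus>\<^bsub>R\<^esub> c \<in> I" using c \<open>c \<in> V\<close> v by (auto simp: I_mem)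
      then show ?thesis
        using R.quotient_eq_iff_same_a_r_cos[OF ideal, of v c] c(1) v \<open>c \<in> V\<close> by auto
    qed
    then show ?thesis
      using k_sub by (fastforce simp: FactRing_def A_RCOSETS_def')
  qed
  moreover have "Q.dim (carrier (R Quot I)) (carrier (R Quot I)) = 1"
    using Q.dimI[OF Q.carrier_is_subfield Q.dimension_one[OF Q.carrier_is_subfield]] by (simp add: over_def)
  ultimately show ?thesis
    unfolding place_degree_def residue_field_def R_def[symmetric] I_def[symmetric] by simp
qed

end

locale rational_places = base_field k for k :: "'a::field set" +
  fixes E :: "'a set"
  assumes function_field: "function_field k E"
    and places: "\<And>V. valuation_ring k E V \<Longrightarrow> \<exists>t. place k E V t"
begin

lemma E: "subfield E Amb" and k_sub: "k \<subseteq> E"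
  using function_field by (auto simp: function_field_def)

lemmas E_closed [simp, intro] = subfieldD[OF E]

abbreviation "L \<equiv> riemann_roch_space k E"
abbreviation "dvdeg \<equiv> divisor_degree k"

lemma L_mem: "z \<in> L D \<longleftrightarrow> z \<in> E \<and> (z = 0 \<or> (\<forall>V. valuation_ring k E V \<longrightarrow> place_ord V z \<ge> - D V))"
  by (auto simp: riemann_roch_space_def)

lemma L_0 [simp]: "0 \<in> L D"
  by (simp add: L_mem)

lemma L_add:
  assumes "z \<in> L D" "w \<in> L D" shows "z + w \<in> L D"
proof (cases "z = 0 \<or> w = 0 \<or> z + w = 0")
  case False
  have "place_ord V (z + w) \<ge> - D V" if V: "valuation_ring k E V" for V
  proof -
    from places[OF V] obtain t where "place k E V t" ..
    then show ?thesis
      using place.place_ord_add[of k E V t z w "- D V"] assms False V by (auto simp: L_mem)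
  qed
  then show ?thesis using assms by (auto simp: L_mem)
qed (use assms in auto)

lemma L_smult:
  assumes "c \<in> k" "z \<in> L D" shows "c * z \<in> L D"
proof (cases "c = 0 \<or> z = 0")
  case False
  have "place_ord V (c * z) = place_ord V z" if V: "valuation_ring k E V" for V
  proof -
    from places[OF V] obtain t where "place k E V t" ..
    then interpret place k E V t .
    have "c \<in> E" using assms(1) k_sub V_sub by blast
    then show ?thesis using place_ord_mult[of c z] place_ord_const[of c] assms False
      by (auto simp: L_mem)
  qed
  moreover have "c \<in> E" using assms(1) k_sub by blast
  ultimately show ?thesis using assms by (auto simp: L_mem)
qed auto

lemma L_mono: "(\<And>V. D V \<le> D' V) \<Longrightarrow> L D \<subseteq> L D'"
  unfolding riemann_roch_space_def by (auto intro: order_trans[OF le_imp_neg_le])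

text \<open>If the space grows at all, take a new element \<open>v\<close>; its order at
  \<open>V\<close> is exactly \<open>- (D V + 1)\<close>. For every other \<open>z\<close> the
  quotient \<open>z / v\<close> lies in \<open>V\<close>, and with \<open>c\<close> its residue
  \<open>z - c * v\<close> has larger order at \<open>V\<close> and is back in \<open>L D\<close>:
  one extra basis vector suffices.\<close>

lemma dimension_L_step:
  assumes V: "valuation_ring k E V" and D: "Amb.dimension n k (L D)"
  shows "\<exists>m\<le>Suc n. Amb.dimension m k (L (D(V := D V + 1)))"
proof (cases "L (D(V := D V + 1)) \<subseteq> L D")
  case True
  moreover have "L D \<subseteq> L (D(V := D V + 1))" by (rule L_mono) auto
  ultimately show ?thesis using D by (intro exI[of _ n]) auto
next
  case False
  define D' where "D' = D(V := D V + 1)"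
  from places[OF V] obtain t where "place k E V t" ..
  then interpret place k E V t .
  obtain v where v: "v \<in> L D'" "v \<notin> L D" using False by (auto simp: D'_def)
  then have v0: "v \<noteq> 0" "v \<in> E" by (auto simp: L_mem)
  have v_ord: "place_ord V v = - (D V + 1)"
  proof (rule ccontr)
    assume "place_ord V v \<noteq> - (D V + 1)"
    moreover have "place_ord V v \<ge> - (D V + 1)" using v(1) v0 V by (auto simp: L_mem D'_def)
    ultimately have "place_ord V v \<ge> - D V" by auto
    then have "v \<in> L D" using v(1) v0 by (auto simp: L_mem D'_def split: if_splits)
    then show False using v by simp
  qed
  have "Amb.dimension (Suc n) k {c * v + s | c s. c \<in> k \<and> s \<in> L D}"
    using D v(2) by (rule dimension_Suc)
  also have "{c * v + s | c s. c \<in> k \<and> s \<in> L D} = L D'"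
  proof (intro equalityI subsetI)
    fix z assume "z \<in> {c * v + s | c s. c \<in> k \<and> s \<in> L D}"
    moreover have "L D \<subseteq> L D'" unfolding D'_def by (rule L_mono) auto
    ultimately show "z \<in> L D'" using v by (auto intro!: L_add L_smult)
  next
    fix z assume z: "z \<in> L D'"
    have "\<exists>c\<in>k. z - c * v \<in> L D"
    proof (cases "z = 0")
      case False
      have zE: "z \<in> E" and z_ord: "place_ord V z \<ge> - (D V + 1)"
        using z False V by (auto simp: L_mem D'_def)
      have "z / v \<in> V"
        using place_ord_mult[of z "inverse v"] place_ord_inverse[of v] v0 zE z_ord v_ord False
          place_ord_nonneg_iff[of "z / v"] by (simp add: divide_inverse)
      then obtain c where c: "c \<in> k" "z / v = c \<or> inverse (z / v - c) \<notin> V" using residue by blast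
      have cv: "z - c * v \<in> L D'" using L_add[OF z L_smult[of "- c" v D']] c(1) v by simp
      have "z - c * v \<in> L D"
      proof (cases "z - c * v = 0")
        case nz: False
        have "z / v - c \<noteq> 0" "z - c * v = (z / v - c) * v" using nz v0 by (auto simp: field_simps)
        moreover have "z / v - c \<in> E" using zE v0(2) c(1) k_sub V_sub by blast
        ultimately have "place_ord V (z - c * v) > place_ord V v"
          using place_ord_mult[of "z / v - c" v] place_ord_pos_iff[of "z / v - c"] c(2) v0 by auto
        then have "place_ord V (z - c * v) \<ge> - D V" using v_ord by auto
        then show ?thesis using cv nz by (auto simp: L_mem D'_def split: if_splits)
      qed simp
      then show ?thesis using c by blast
    qed (auto intro!: bexI[of _ 0])
    then obtain c where "c \<in> k" "z - c * v \<in> L D" by auto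
    moreover have "z = c * v + (z - c * v)" by simp
    ultimately show "z \<in> {c * v + s | c s. c \<in> k \<and> s \<in> L D}" by blast
  qed
  finally show ?thesis unfolding D'_def by blast
qed

text \<open>All places have degree 1. Summing over any finite superset of the support lets the
  degrees of different divisors be compared term by term.\<close>

lemma deg_eq:
  assumes "divisor k E D" "finite A" "\<And>V. D V \<noteq> 0 \<Longrightarrow> V \<in> A"
  shows "dvdeg D = (\<Sum>V\<in>A. D V)"
proof -
  have "place_degree k V = 1" if "D V \<noteq> 0" for V
    using assms(1) that places[of V] place.place_degree by (auto simp: divisor_def)
  then have "dvdeg D = (\<Sum>V | D V \<noteq> 0. D V)"
    unfolding divisor_degree_def by (intro sum.cong) auto
  also have "\<dots> = (\<Sum>V\<in>A. D V)"
    using assms by (intro sum.mono_neutral_left) auto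
  finally show ?thesis .
qed

lemma deg_add:
  assumes "divisor k E D" "divisor k E D'"
  shows "divisor k E (\<lambda>V. D V + D' V)" "dvdeg (\<lambda>V. D V + D' V) = dvdeg D + dvdeg D'"
proof -
  define A where "A = {V. D V \<noteq> 0} \<union> {V. D' V \<noteq> 0}"
  have A: "finite A" using assms by (auto simp: A_def divisor_def)
  show d: "divisor k E (\<lambda>V. D V + D' V)"
    unfolding divisor_def
  proof (intro conjI allI impI)
    show "finite {V. D V + D' V \<noteq> 0}" by (rule finite_subset[OF _ A]) (auto simp: A_def)
    fix V assume "D V + D' V \<noteq> 0"
    then have "D V \<noteq> 0 \<or> D' V \<noteq> 0" by auto
    then show "valuation_ring k E V" using assms by (auto simp: divisor_def)
  qed
  show "dvdeg (\<lambda>V. D V + D' V) = dvdeg D + dvdeg D'"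
    using assms A d by (subst (1 2 3) deg_eq[of _ A]) (auto simp: A_def sum.distrib)
qed

text \<open>From \<open>D\<close> to \<open>D'\<close> one place is added at a time, and each step
  adds at most one dimension while the degree grows by one. So the degree minus the dimension does
  not decrease.\<close>

lemma dimension_L_mono:
  assumes "divisor k E D" "divisor k E D'" "\<And>V. D V \<le> D' V" "Amb.dimension n k (L D)"
  shows "\<exists>m. Amb.dimension m k (L D') \<and> int m \<le> int n + dvdeg D' - dvdeg D"
  using assms
proof (induction "nat (dvdeg D' - dvdeg D)" arbitrary: D n rule: less_induct)
  case less
  show ?case
  proof (cases "\<exists>V. D V < D' V")
    case False
    then have "D = D'" using less.prems(3) by (auto simp: fun_eq_iff not_less intro!: antisym)
    then show ?thesis using less.prems by auto
  next
    case True
    then obtain V where V: "D V < D' V" by auto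
    then have "D V \<noteq> 0 \<or> D' V \<noteq> 0" by auto
    then have val: "valuation_ring k E V" using less.prems(1,2) by (auto simp: divisor_def)
    define D1 where "D1 = D(V := D V + 1)"
    define A where "A = insert V ({V. D V \<noteq> 0} \<union> {V. D' V \<noteq> 0})"
    have A: "finite A" using less.prems by (auto simp: A_def divisor_def)
    have D1: "divisor k E D1"
      using less.prems val unfolding divisor_def D1_def
      by (auto split: if_splits intro!: finite_subset[OF _ A] simp: A_def)
    have "dvdeg D1 = dvdeg D + 1"
    proof -
      have "dvdeg D1 = (\<Sum>W\<in>A. D W + (if W = V then 1 else 0))"
        using D1 A by (subst deg_eq[of _ A]) (auto simp: D1_def A_def intro!: sum.cong split: if_splits)
      also have "\<dots> = dvdeg D + 1"
        using less.prems A by (subst deg_eq[of _ A]) (auto simp: A_def sum.distrib)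
      finally show ?thesis .
    qed
    have le: "D1 W \<le> D' W" for W using less.prems V by (auto simp: D1_def)
    have "dvdeg D1 \<le> dvdeg D'"
      using D1 less.prems A le by (subst (1 2) deg_eq[of _ A]) (auto simp: D1_def A_def intro!: sum_mono split: if_splits)
    obtain m where m: "m \<le> Suc n" "Amb.dimension m k (L D1)"
      using dimension_L_step[OF val less.prems(4)] by (auto simp: D1_def)
    obtain m' where "Amb.dimension m' k (L D')" "int m' \<le> int m + dvdeg D' - dvdeg D1"
      using less.hyps[OF _ D1 less.prems(2) le m(2)] \<open>dvdeg D1 = _\<close> \<open>dvdeg D1 \<le> _\<close> by auto
    then show ?thesis using m(1) \<open>dvdeg D1 = _\<close> by (intro exI[of _ m']) auto
  qed
qed

text \<open>By \<open>dimension_L_mono\<close> a bound for some divisor above \<open>D\<close> is a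
  bound for \<open>D\<close>, so a cofinal family of divisors with known spaces suffices.\<close>

lemma has_genusI:
  assumes dom: "\<And>D. divisor k E D \<Longrightarrow> \<exists>D' n. divisor k E D' \<and> (\<forall>V. D V \<le> D' V) \<and>
      Amb.dimension n k (L D') \<and> dvdeg D' - int n + 1 \<le> int g"
    and D0: "divisor k E D0" "Amb.dimension n0 k (L D0)" "dvdeg D0 - int n0 + 1 = int g"
  shows "has_genus k E g"
  unfolding has_genus_def
proof (intro conjI allI impI function_field)
  fix D assume D: "divisor k E D"
  then obtain D' n where D': "divisor k E D'" "\<And>V. D V \<le> D' V"
    "Amb.dimension n k (L D')" "dvdeg D' - int n + 1 \<le> int g" using dom by blast
  \<comment> \<open>\<open>dim\<close> is informative only for finite-dimensional spaces;
    \<open>L D\<close> is one, being a subspace of \<open>L D'\<close>.\<close>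
  obtain l where l: "Amb.dimension l k (L D)"
    using dimension_subspace[OF D'(3) L_mono[OF D'(2)]] L_add L_smult by auto
  obtain m where "Amb.dimension m k (L D')" "int m \<le> int l + dvdeg D' - dvdeg D"
    using dimension_L_mono[OF D D'(1,2) l] by auto
  then show "dvdeg D - int (Amb.dim k (L D)) + 1 \<le> int g"
    using dimension_unique[OF D'(3)] D'(4) dim_eq[OF l] by auto
next
  show "\<exists>D. divisor k E D \<and> dvdeg D - int (Amb.dim k (L D)) + 1 = int g"
    using D0 dim_eq by auto
qed

text \<open>The divisor of the function \<open>c\<close>. The value 0 elsewhere is what
  \<open>divisor\<close> demands of sets that are not valuation rings of \<open>E\<close>.\<close>

definition principal :: "'a \<Rightarrow> 'a set \<Rightarrow> int"
  where "principal c V = (if valuation_ring k E V then place_ord V c else 0)"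

text \<open>Multiplication by \<open>c\<close> maps this space bijectively onto \<open>L D\<close>,
  because orders add.\<close>

lemma dimension_L_principal:
  assumes "c \<in> E" "c \<noteq> 0" "Amb.dimension n k (L D)"
  shows "Amb.dimension n k (L (\<lambda>V. D V + principal c V))"
proof -
  have "L (\<lambda>V. D V + principal c V) = (*) (inverse c) ` L D"
  proof -
    have *: "z \<in> L (\<lambda>V. D V + principal c V) \<longleftrightarrow> c * z \<in> L D" for z
    proof (cases "z = 0")
      case False
      have ord: "place_ord V (c * z) = place_ord V c + place_ord V z"
        if V: "valuation_ring k E V" and "z \<in> E" for V
      proof -
        from places[OF V] obtain t where "place k E V t" ..
        then show ?thesis using place.place_ord_mult assms False \<open>z \<in> E\<close> by blast
      qed
      have "c * z \<in> E \<longleftrightarrow> z \<in> E"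
      proof
        assume "c * z \<in> E"
        then have "inverse c * (c * z) \<in> E" using assms by auto
        then show "z \<in> E" using assms by (simp add: field_simps)
      qed (use assms in auto)
      then show ?thesis using False assms(2) ord by (auto simp: L_mem principal_def)
    qed simp
    show ?thesis
    proof (intro equalityI subsetI)
      fix z assume "z \<in> L (\<lambda>V. D V + principal c V)"
      then have "c * z \<in> L D" "z = inverse c * (c * z)" using * assms(2) by auto
      then show "z \<in> (*) (inverse c) ` L D" by (rule rev_image_eqI)
    next
      fix z assume "z \<in> (*) (inverse c) ` L D"
      then obtain w where "w \<in> L D" "z = inverse c * w" by blast
      moreover from this have "c * z = w" using assms(2) by simp
      ultimately show "z \<in> L (\<lambda>V. D V + principal c V)" by (simp only: *)
    qed
  qed
  then show ?thesis using dimension_scale[OF assms(3), of "inverse c"] assms(2) by simp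
qed

end

section \<open>Places of a quadratic extension of a rational function field\<close>

text \<open>A valuation ring not yet known to be discrete; the facts below serve to identify it with
  the local ring of a point.\<close>

locale valring = base_field k for k :: "'a::field set" +
  fixes E V :: "'a set"
  assumes E: "subfield E Amb" and val: "valuation_ring k E V"
begin

lemma subring: "subring V Amb" and k_sub: "k \<subseteq> V" and V_sub: "V \<subseteq> E" and V_neq: "V \<noteq> E"
  using val by (auto simp: valuation_ring_def)

lemma V_cases: "z \<in> E \<Longrightarrow> z \<in> V \<or> inverse z \<in> V"
  using val by (auto simp: valuation_ring_def)

lemma V_closed [simp, intro]:
  "0 \<in> V" "1 \<in> V" "a \<in> V \<Longrightarrow> b \<in> V \<Longrightarrow> a + b \<in> V" "a \<in> V \<Longrightarrow> b \<in> V \<Longrightarrow> a * b \<in> V"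
  "a \<in> V \<Longrightarrow> - a \<in> V" "a \<in> V \<Longrightarrow> b \<in> V \<Longrightarrow> a - b \<in> V" "c \<in> k \<Longrightarrow> c \<in> V"
proof -
  note sr = subringE[OF subring]
  show "0 \<in> V" "1 \<in> V" using sr(2,3) by simp_all
  show add: "a + b \<in> V" if "a \<in> V" "b \<in> V" for a b using sr(7)[OF that] by simp
  show "a * b \<in> V" if "a \<in> V" "b \<in> V" using sr(6)[OF that] by simp
  show u: "- a \<in> V" if "a \<in> V" for a using sr(5)[OF that] by simp
  show "a - b \<in> V" if "a \<in> V" "b \<in> V" using add[OF that(1) u[OF that(2)]] by simp
  show "c \<in> V" if "c \<in> k" using that k_sub by auto
qed

lemma poly_V [intro]: "p \<in> polys k \<Longrightarrow> z \<in> V \<Longrightarrow> poly p z \<in> V"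
  by (induction p) auto

definition M where "M = {v \<in> V. v = 0 \<or> inverse v \<notin> V}"

lemma M_V: "a \<in> M \<Longrightarrow> a \<in> V"
  by (simp add: M_def)

lemma M_0 [simp]: "0 \<in> M"
  by (simp add: M_def)

lemma M_mult: "a \<in> M \<Longrightarrow> b \<in> V \<Longrightarrow> a * b \<in> M" and M_mult': "a \<in> M \<Longrightarrow> b \<in> V \<Longrightarrow> b * a \<in> M"
proof -
  assume ab: "a \<in> M" "b \<in> V"
  have "inverse (a * b) \<notin> V" if "a * b \<noteq> 0"
  proof
    assume "inverse (a * b) \<in> V"
    then have "b * inverse (a * b) \<in> V" using ab by auto
    then show False using ab that by (auto simp: M_def field_simps)
  qed
  then show "a * b \<in> M" "b * a \<in> M" using ab by (auto simp: M_def mult.commute)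
qed

text \<open>\<open>a + b = b * (1 + a / b)\<close>; of \<open>a / b\<close> and \<open>b / a\<close>
  at least one lies in \<open>V\<close>, which then gives \<open>M_add\<close>.\<close>

lemma M_add_aux: "a \<in> M \<Longrightarrow> b \<in> M \<Longrightarrow> b \<noteq> 0 \<Longrightarrow> a / b \<in> V \<Longrightarrow> a + b \<in> M"
  using M_mult[of b "1 + a / b"] by (auto simp: distrib_left add.commute)

lemma M_add: "a \<in> M \<Longrightarrow> b \<in> M \<Longrightarrow> a + b \<in> M"
proof -
  assume ab: "a \<in> M" "b \<in> M"
  show "a + b \<in> M"
  proof (cases "a = 0 \<or> b = 0")
    case False
    have "a / b \<in> E" using ab V_sub by (auto simp: M_def intro!: subfieldD[OF E])
    from V_cases[OF this] show ?thesis
      using M_add_aux[of a b] M_add_aux[of b a] ab False by (auto simp: add.commute)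
  qed (use ab in auto)
qed

lemma M_diff: "a \<in> M \<Longrightarrow> b \<in> M \<Longrightarrow> a - b \<in> M"
  using M_add[of a "- b"] M_mult[of b "- 1"] by auto

lemma M_prime: "a \<in> V \<Longrightarrow> b \<in> V \<Longrightarrow> a * b \<in> M \<Longrightarrow> a \<in> M \<or> b \<in> M"
  by (auto simp: M_def)

lemma M_k: "c \<in> k \<Longrightarrow> c \<in> M \<Longrightarrow> c = 0"
  using k_sub by (auto simp: M_def)

text \<open>Valuation rings are integrally closed; here \<open>z = z ^ 2 * inverse z\<close> if
  \<open>inverse z\<close> lies in \<open>V\<close>.\<close>

lemma integral_V:
  assumes "z \<in> E" "z ^ 2 \<in> V" shows "z \<in> V"
proof (cases "z = 0")
  case False
  have "z \<in> V" if "inverse z \<in> V"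
    using V_closed(4)[OF assms(2) that] False by (simp add: power2_eq_square mult.assoc)
  then show ?thesis using V_cases[OF assms(1)] by blast
qed simp

lemma poly_diff_M:
  assumes "p \<in> polys k" "z \<in> V" "c \<in> k" "z - c \<in> M"
  shows "poly p z - poly p c \<in> M"
  using assms(1)
proof (induction p)
  case (pCons a p)
  have "poly (pCons a p) z - poly (pCons a p) c = z * (poly p z - poly p c) + (z - c) * poly p c"
    by (simp add: algebra_simps)
  also have "\<dots> \<in> M" using pCons assms by (intro M_add M_mult M_mult') auto
  finally show ?case .
qed simp

end

text \<open>\<open>nonsingular\<close> is the Jacobian criterion for \<open>y^2 - f(x)\<close>: the
  partial derivatives at the point are \<open>2 * \<beta>\<close> and minus the derivative of
  \<open>f\<close> at \<alpha>.\<close>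

locale curve_point = quadratic_field k x y f
  for k :: "'a::field_char_0 set" and x y f +
  fixes \<alpha> \<beta> :: 'a
  assumes \<alpha>: "\<alpha> \<in> k" and \<beta>: "\<beta> \<in> k" and on_curve: "\<beta> ^ 2 = poly f \<alpha>"
    and nonsingular: "\<beta> \<noteq> 0 \<or> poly (pderiv f) \<alpha> \<noteq> 0"
begin

abbreviation "E \<equiv> adjoin k {x, y}"

lemmas E_closed [simp, intro] = subfieldD[OF subfield_adjoin[of k "{x, y}"]]

text \<open>Evaluation of the coordinate ring \<open>k[x, y]\<close> at the point, as a relation; it
  is single-valued because the pair \<open>p\<close>, \<open>q\<close> is unique.\<close>

definition value0 :: "'a \<Rightarrow> 'a \<Rightarrow> bool"
  where "value0 z v \<longleftrightarrow> (\<exists>p\<in>polys k. \<exists>q\<in>polys k. z = poly p x + poly q x * y \<and>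
    v = poly p \<alpha> + poly q \<alpha> * \<beta>)"

lemma value0_pair:
  "p \<in> polys k \<Longrightarrow> q \<in> polys k \<Longrightarrow> value0 (poly p x + poly q x * y) (poly p \<alpha> + poly q \<alpha> * \<beta>)"
  unfolding value0_def by blast

lemma value0_poly: "p \<in> polys k \<Longrightarrow> value0 (poly p x) (poly p \<alpha>)"
  using value0_pair[of p 0] by simp

lemma value0_y: "value0 y \<beta>"
  using value0_pair[of 0 1] by simp

lemma value0_unique: "value0 z v \<Longrightarrow> value0 z w \<Longrightarrow> v = w"
  using pair_inj unfolding value0_def by metis

lemma value0_k: "value0 z v \<Longrightarrow> v \<in> k"
  using \<alpha> \<beta> unfolding value0_def by auto

lemma value0_E: "value0 z v \<Longrightarrow> z \<in> E"
  using pair_in unfolding value0_def by auto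

lemma value0_add: "value0 z v \<Longrightarrow> value0 w u \<Longrightarrow> value0 (z + w) (v + u)"
proof -
  assume "value0 z v" "value0 w u"
  then obtain p q r s where *: "p \<in> polys k" "q \<in> polys k" "r \<in> polys k" "s \<in> polys k"
    "z = poly p x + poly q x * y" "v = poly p \<alpha> + poly q \<alpha> * \<beta>"
    "w = poly r x + poly s x * y" "u = poly r \<alpha> + poly s \<alpha> * \<beta>"
    unfolding value0_def by blast
  then show ?thesis using value0_pair[of "p + r" "q + s"] by (simp add: algebra_simps polys_add)
qed

lemma value0_mult: "value0 z v \<Longrightarrow> value0 w u \<Longrightarrow> value0 (z * w) (v * u)"
proof -
  assume "value0 z v" "value0 w u"
  then obtain p q r s where *: "p \<in> polys k" "q \<in> polys k" "r \<in> polys k" "s \<in> polys k"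
    "z = poly p x + poly q x * y" "v = poly p \<alpha> + poly q \<alpha> * \<beta>"
    "w = poly r x + poly s x * y" "u = poly r \<alpha> + poly s \<alpha> * \<beta>"
    unfolding value0_def by blast
  have "z * w = poly (p * r + q * s * f) x + poly (p * s + q * r) x * y"
    using y_sq * by (simp add: algebra_simps power2_eq_square)
  moreover have "v * u = poly (p * r + q * s * f) \<alpha> + poly (p * s + q * r) \<alpha> * \<beta>"
    using on_curve * by (simp add: algebra_simps power2_eq_square)
  moreover have "p * r + q * s * f \<in> polys k" "p * s + q * r \<in> polys k" using * f by auto
  ultimately show ?thesis using value0_pair by metis
qed

lemma value0_nz: "value0 z v \<Longrightarrow> v \<noteq> 0 \<Longrightarrow> z \<noteq> 0"
  using value0_unique[of 0 v 0] value0_poly[of 0] by auto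

text \<open>Extends \<open>value0\<close> to fractions whose denominator does not vanish at the
  point; the local ring is the domain of this relation.\<close>

definition local_value :: "'a \<Rightarrow> 'a \<Rightarrow> bool"
  where "local_value z v \<longleftrightarrow> (\<exists>a b u w. value0 a u \<and> value0 b w \<and> w \<noteq> 0 \<and> z = a / b \<and> v = u / w)"

lemma local_valueI: "value0 a u \<Longrightarrow> value0 b w \<Longrightarrow> w \<noteq> 0 \<Longrightarrow> local_value (a / b) (u / w)"
  unfolding local_value_def by blast

lemma local_value_value0: "value0 a u \<Longrightarrow> local_value a u"
  using local_valueI[of a u 1 1] value0_poly[of 1] by simp

lemma local_value_unique: "local_value z v \<Longrightarrow> local_value z v' \<Longrightarrow> v = v'"
proof -
  assume "local_value z v" "local_value z v'"
  then obtain a b u w a' b' u' w' where *: "value0 a u" "value0 b w" "w \<noteq> 0" "z = a / b" "v = u / w"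
    "value0 a' u'" "value0 b' w'" "w' \<noteq> 0" "z = a' / b'" "v' = u' / w'"
    unfolding local_value_def by blast
  have "a * b' = a' * b" using * value0_nz[of b w] value0_nz[of b' w'] by (simp add: field_simps)
  then have "u * w' = u' * w"
    using value0_unique value0_mult[OF *(1,7)] value0_mult[OF *(6,2)] by metis
  then show "v = v'" unfolding *(5,10) using *(3,8) by (simp add: frac_eq_eq)
qed

lemma local_value_add: "local_value z v \<Longrightarrow> local_value z' v' \<Longrightarrow> local_value (z + z') (v + v')"
  and local_value_mult: "local_value z v \<Longrightarrow> local_value z' v' \<Longrightarrow> local_value (z * z') (v * v')"
proof -
  assume "local_value z v" "local_value z' v'"
  then obtain a b u w a' b' u' w' where *: "value0 a u" "value0 b w" "w \<noteq> 0" "z = a / b" "v = u / w"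
    "value0 a' u'" "value0 b' w'" "w' \<noteq> 0" "z' = a' / b'" "v' = u' / w'"
    unfolding local_value_def by blast
  have nz: "b \<noteq> 0" "b' \<noteq> 0" using * value0_nz by auto
  have "local_value ((a * b' + a' * b) / (b * b')) ((u * w' + u' * w) / (w * w'))"
    using * by (intro local_valueI value0_add value0_mult) auto
  then show "local_value (z + z') (v + v')" using * nz by (simp add: add_frac_eq)
  have "local_value ((a * a') / (b * b')) ((u * u') / (w * w'))"
    using * by (intro local_valueI value0_mult) auto
  then show "local_value (z * z') (v * v')" using * by simp
qed

lemma local_value_inverse: "local_value z v \<Longrightarrow> v \<noteq> 0 \<Longrightarrow> local_value (inverse z) (inverse v)"
  unfolding local_value_def by (metis divide_eq_0_iff inverse_divide)

lemma local_value_nz: "local_value z v \<Longrightarrow> v \<noteq> 0 \<Longrightarrow> z \<noteq> 0"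
  using local_value_unique[of 0 v 0] local_value_value0[OF value0_poly[of 0]] by auto

lemma local_value_const: "c \<in> k \<Longrightarrow> local_value c c"
  using local_value_value0[OF value0_poly[of "[:c:]"]] by simp

lemma local_value_diff: "local_value z v \<Longrightarrow> local_value z' v' \<Longrightarrow> local_value (z - z') (v - v')"
  using local_value_add[OF _ local_value_mult[OF local_value_const[of "- 1"]], of z v z' v'] by auto

lemma local_value_power: "local_value z v \<Longrightarrow> local_value (z ^ n) (v ^ n)"
  by (induction n) (auto intro: local_value_mult local_value_const)

lemma local_value_E: "local_value z v \<Longrightarrow> z \<in> E" and local_value_k: "local_value z v \<Longrightarrow> v \<in> k"
  using value0_E value0_k by (auto simp: local_value_def)

definition local_ring where "local_ring = {z. \<exists>v. local_value z v}"
text \<open>At a branch point (\<open>\<beta> = 0\<close>) the function \<open>x - \<alpha>\<close>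
  has a double zero, so \<open>y\<close> takes over as parameter.\<close>

definition uniformizer where "uniformizer = (if \<beta> \<noteq> 0 then x - \<alpha> else y)"

definition is_unit where "is_unit z \<longleftrightarrow> (\<exists>v. local_value z v \<and> v \<noteq> 0)"

lemma is_unit_nz: "is_unit z \<Longrightarrow> z \<noteq> 0"
  using local_value_nz by (auto simp: is_unit_def)

lemma is_unit_mult: "is_unit z \<Longrightarrow> is_unit w \<Longrightarrow> is_unit (z * w)"
  unfolding is_unit_def using local_value_mult by (metis mult_eq_0_iff)

lemma is_unit_inverse: "is_unit z \<Longrightarrow> is_unit (inverse z)"
  unfolding is_unit_def using local_value_inverse by (metis inverse_nonzero_iff_nonzero)

lemma is_unit_divide: "is_unit z \<Longrightarrow> is_unit w \<Longrightarrow> is_unit (z / w)"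
  using is_unit_mult is_unit_inverse by (simp add: divide_inverse)

lemma is_unit_power: "is_unit z \<Longrightarrow> is_unit (z ^ n)"
  unfolding is_unit_def using local_value_power by (metis power_not_zero)

lemma is_unit_poly: "p \<in> polys k \<Longrightarrow> poly p \<alpha> \<noteq> 0 \<Longrightarrow> is_unit (poly p x)"
  unfolding is_unit_def using local_value_value0[OF value0_poly] by blast

lemma value_x: "local_value (x - \<alpha>) 0"
  using local_value_value0[OF value0_poly[of "[:- \<alpha>, 1:]"]] \<alpha> by simp

lemma value_uniformizer: "local_value uniformizer 0"
  using value_x local_value_value0[OF value0_y] by (metis uniformizer_def)

lemma x_neq: "x \<noteq> \<alpha>"
  using x_notin_k \<alpha> by auto

lemma y_nz: "y \<noteq> 0"
  using y_notin subfieldD(1)[OF subfield_adjoin] by auto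

lemma uniformizer_nz: "uniformizer \<noteq> 0"
  using x_neq y_nz by (simp add: uniformizer_def)

lemma poly_order_factor:
  assumes "p \<in> polys k" "p \<noteq> 0"
  shows "\<exists>n q. q \<in> polys k \<and> poly q \<alpha> \<noteq> 0 \<and> p = [:- \<alpha>, 1:] ^ n * q"
  using assms
proof (induction "Polynomial.degree p" arbitrary: p rule: less_induct)
  case less
  show ?case
  proof (cases "poly p \<alpha> = 0")
    case True
    then obtain q where q: "q \<in> polys k" "p = [:- \<alpha>, 1:] * q"
      using polys_root_factor[OF less.prems(1) \<alpha>] by blast
    then have "q \<noteq> 0" using less.prems by auto
    then have "Polynomial.degree q < Polynomial.degree p" unfolding q(2) by (subst degree_mult_eq) auto
    then obtain n r where "r \<in> polys k" "poly r \<alpha> \<noteq> 0" "q = [:- \<alpha>, 1:] ^ n * r"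
      using less.hyps q \<open>q \<noteq> 0\<close> by blast
    then show ?thesis using q(2) by (intro exI[of _ "Suc n"] exI[of _ r]) (simp_all only: power_Suc mult.assoc simp_thms)
  next
    case False
    then show ?thesis using less.prems by (intro exI[of _ 0] exI[of _ p]) auto
  qed
qed

text \<open>\<open>f = (X - \<alpha>) g\<close>, where \<open>g(\<alpha>)\<close> is the derivative
  of \<open>f\<close> at \<alpha> and hence nonzero. So \<open>y^2 = (x - \<alpha>) g(x)\<close>
  with \<open>g(x)\<close> a unit.\<close>

lemma x_factor_ramified:
  assumes "\<beta> = 0"
  obtains u where "is_unit u" "x - \<alpha> = y ^ 2 * u"
proof -
  have "poly f \<alpha> = 0" using on_curve assms by simp
  then obtain g where g: "g \<in> polys k" "f = [:- \<alpha>, 1:] * g" using polys_root_factor[OF f \<alpha>] by blast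
  have "poly (pderiv f) \<alpha> = poly g \<alpha>" unfolding g(2) pderiv_mult by (simp add: pderiv_pCons)
  then have "poly g \<alpha> \<noteq> 0" using nonsingular assms by simp
  then have u: "is_unit (poly g x)" using g by (intro is_unit_poly)
  have "y ^ 2 = (x - \<alpha>) * poly g x" unfolding y_sq g(2) by (simp add: algebra_simps)
  then show ?thesis using that[of "inverse (poly g x)"] is_unit_inverse[OF u] is_unit_nz[OF u]
    by (simp add: field_simps)
qed

text \<open>If the conjugate \<open>z' = p(x) - q(x) y\<close> does not vanish at the point, then
  \<open>z\<close> is the norm \<open>z z'\<close>, a polynomial in \<open>x\<close>, divided by a
  unit. If both \<open>z\<close> and \<open>z'\<close> vanish, adding and subtracting gives
  \<open>p(\<alpha>) = q(\<alpha>) = 0\<close>, as \<open>\<beta> \<noteq> 0\<close> and the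
  characteristic is 0; then \<open>x - \<alpha>\<close> can be divided out.\<close>

lemma factor_unramified:
  assumes "\<beta> \<noteq> 0" "p \<in> polys k" "q \<in> polys k" "p \<noteq> 0 \<or> q \<noteq> 0"
  shows "\<exists>n u. is_unit u \<and> poly p x + poly q x * y = (x - \<alpha>) ^ n * u"
  using assms(2-)
proof (induction "Polynomial.degree p + Polynomial.degree q" arbitrary: p q rule: less_induct)
  case less
  define z where "z = poly p x + poly q x * y"
  define z' where "z' = poly p x + poly (- q) x * y"
  have val: "value0 z (poly p \<alpha> + poly q \<alpha> * \<beta>)" "value0 z' (poly p \<alpha> + poly (- q) \<alpha> * \<beta>)"
    unfolding z_def z'_def using less.prems by (intro value0_pair; auto)+
  consider "poly p \<alpha> + poly q \<alpha> * \<beta> \<noteq> 0" | "poly p \<alpha> + poly (- q) \<alpha> * \<beta> \<noteq> 0"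
    | "poly p \<alpha> + poly q \<alpha> * \<beta> = 0" "poly p \<alpha> + poly (- q) \<alpha> * \<beta> = 0" by blast
  then show ?case
  proof cases
    case 1
    then have "is_unit z" using val local_value_value0 by (auto simp: is_unit_def)
    then show ?thesis unfolding z_def by (intro exI[of _ 0] exI) auto
  next
    case 2
    then have u: "is_unit z'" using local_value_value0[OF val(2)] unfolding is_unit_def by blast
    define h where "h = p * p - q * q * f"
    have h: "h \<in> polys k" "z * z' = poly h x"
      using less.prems f y_sq by (auto simp: h_def z_def z'_def algebra_simps power2_eq_square)
    have "z \<noteq> 0" unfolding z_def using less.prems by (simp add: pair_eq_0_iff)
    then have "h \<noteq> 0" using h(2) is_unit_nz[OF u] by auto
    then obtain n r where r: "r \<in> polys k" "poly r \<alpha> \<noteq> 0" "h = [:- \<alpha>, 1:] ^ n * r"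
      using poly_order_factor h(1) by blast
    have "z = (x - \<alpha>) ^ n * (poly r x / z')"
      using h(2) is_unit_nz[OF u] unfolding r(3) by (simp add: field_simps)
    then show ?thesis using is_unit_divide[OF is_unit_poly[OF r(1,2)] u] unfolding z_def
      by (intro exI[of _ n] exI[of _ "poly r x / z'"] conjI) (simp_all add: z_def)
  next
    case 3
    then have "2 * poly p \<alpha> = 0" "2 * (poly q \<alpha> * \<beta>) = 0" by (simp_all add: algebra_simps)
    then have 0: "poly p \<alpha> = 0" "poly q \<alpha> = 0" using assms(1) by simp_all
    obtain p' where p': "p' \<in> polys k" "p = [:- \<alpha>, 1:] * p'"
      using polys_root_factor[OF less.prems(1) \<alpha> 0(1)] .
    obtain q' where q': "q' \<in> polys k" "q = [:- \<alpha>, 1:] * q'"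
      using polys_root_factor[OF less.prems(2) \<alpha> 0(2)] .
    have deg: "Polynomial.degree ([:- \<alpha>, 1:] * r) = (if r = 0 then 0 else Suc (Polynomial.degree r))" for r
      by (simp add: degree_mult_eq del: mult_pCons_left)
    have nz: "p' \<noteq> 0 \<or> q' \<noteq> 0" using less.prems p' q' by auto
    then have "Polynomial.degree p' + Polynomial.degree q' < Polynomial.degree p + Polynomial.degree q"
      unfolding p'(2) q'(2) deg by auto
    then obtain n u where "is_unit u" "poly p' x + poly q' x * y = (x - \<alpha>) ^ n * u"
      using less.hyps p'(1) q'(1) nz by blast
    moreover have "poly p x + poly q x * y = (x - \<alpha>) * (poly p' x + poly q' x * y)"
      unfolding p'(2) q'(2) by (simp add: algebra_simps)
    ultimately show ?thesis by (intro exI[of _ "Suc n"] exI[of _ u]) auto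
  qed
qed

text \<open>\<open>p(x)\<close> has even order in \<open>y\<close> and \<open>q(x) y\<close> odd
  order. After the lower power of \<open>y\<close> is factored out, a unit plus a positive power of
  \<open>y\<close> times a unit remains, which is a unit.\<close>

lemma factor_ramified:
  assumes "\<beta> = 0" "p \<in> polys k" "q \<in> polys k" "p \<noteq> 0 \<or> q \<noteq> 0"
  shows "\<exists>n u. is_unit u \<and> poly p x + poly q x * y = y ^ n * u"
proof -
  obtain u where u: "is_unit u" "x - \<alpha> = y ^ 2 * u" using x_factor_ramified[OF assms(1)] .
  have fac: "\<exists>n u. is_unit u \<and> poly r x = y ^ (2 * n) * u" if "r \<in> polys k" "r \<noteq> 0" for r
  proof -
    obtain n s where s: "s \<in> polys k" "poly s \<alpha> \<noteq> 0" "r = [:- \<alpha>, 1:] ^ n * s"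
      using poly_order_factor \<open>r \<in> polys k\<close> \<open>r \<noteq> 0\<close> by blast
    have "poly r x = (x - \<alpha>) ^ n * poly s x" unfolding s(3) by simp
    also have "\<dots> = y ^ (2 * n) * (u ^ n * poly s x)" unfolding u(2)
      by (simp add: power_mult_distrib power_mult)
    finally show ?thesis
      using is_unit_mult[OF is_unit_power[OF u(1)] is_unit_poly[OF s(1,2)]] by blast
  qed
  have y0: "local_value (y ^ n) 0" if "n > 0" for n
  proof -
    have "\<beta> ^ n = 0" using assms(1) that by simp
    then show ?thesis using local_value_power[OF local_value_value0[OF value0_y], of n] by metis
  qed
  have sum: "is_unit (v + y ^ n * w)" if "is_unit v" "is_unit w" "n > 0" for v w n
  proof -
    obtain a b where "local_value v a" "a \<noteq> 0" "local_value w b" using \<open>is_unit v\<close> \<open>is_unit w\<close>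
      by (auto simp: is_unit_def)
    then have "local_value (v + y ^ n * w) (a + 0 * b)"
      using y0[OF \<open>n > 0\<close>] by (intro local_value_add local_value_mult)
    then show ?thesis using \<open>a \<noteq> 0\<close> by (auto simp: is_unit_def)
  qed
  consider "p = 0" "q \<noteq> 0" | "p \<noteq> 0" "q = 0" | "p \<noteq> 0" "q \<noteq> 0" using assms by blast
  then show ?thesis
  proof cases
    case 1
    then obtain n u where "is_unit u" "poly q x = y ^ (2 * n) * u" using fac assms by blast
    then show ?thesis using 1 by (intro exI[of _ "Suc (2 * n)"] exI[of _ u]) auto
  next
    case 2
    then show ?thesis using fac[of p] assms by auto
  next
    case 3
    then obtain i v j w where v: "is_unit v" "poly p x = y ^ (2 * i) * v"
      and w: "is_unit w" "poly q x = y ^ (2 * j) * w" using fac assms by metis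
    show ?thesis
    proof (cases "i \<le> j")
      case True
      then have "2 * j + 1 = 2 * i + (2 * (j - i) + 1)" by simp
      then have "y ^ (2 * j + 1) = y ^ (2 * i) * y ^ (2 * (j - i) + 1)" by (metis power_add)
      then have "poly p x + poly q x * y = y ^ (2 * i) * (v + y ^ (2 * (j - i) + 1) * w)"
        unfolding v w by (simp add: algebra_simps)
      then show ?thesis using sum[OF v(1) w(1), of "2 * (j - i) + 1"] by auto
    next
      case False
      then have "2 * i = (2 * j + 1) + (2 * (i - j) - 1)" by simp
      then have "y ^ (2 * i) = y ^ (2 * j + 1) * y ^ (2 * (i - j) - 1)" by (metis power_add)
      then have "poly p x + poly q x * y = y ^ (2 * j + 1) * (w + y ^ (2 * (i - j) - 1) * v)"
        unfolding v w by (simp add: algebra_simps)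
      moreover have "2 * (i - j) - 1 > 0" using False by linarith
      ultimately show ?thesis using sum[OF w(1) v(1)] by blast
    qed
  qed
qed

lemma factor:
  assumes "z \<in> E" "z \<noteq> 0"
  shows "\<exists>n u. is_unit u \<and> z = uniformizer powi n * u"
proof -
  obtain p q r where *: "p \<in> polys k" "q \<in> polys k" "r \<in> polys k" "r \<noteq> 0"
    "z = (poly p x + poly q x * y) / poly r x" using field_elem[OF assms(1)] .
  have fac: "\<exists>n u. is_unit u \<and> poly p x + poly q x * y = uniformizer ^ n * u"
    if "p \<in> polys k" "q \<in> polys k" "p \<noteq> 0 \<or> q \<noteq> 0" for p q
  proof (cases "\<beta> = 0")
    case True
    have "uniformizer = y" unfolding uniformizer_def using True by simp
    then show ?thesis using factor_ramified[OF True that] by simp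
  next
    case False
    have "uniformizer = x - \<alpha>" unfolding uniformizer_def using False by simp
    then show ?thesis using factor_unramified[OF False that] by simp
  qed
  have "p \<noteq> 0 \<or> q \<noteq> 0" using * assms by auto
  then obtain n u where u: "is_unit u" "poly p x + poly q x * y = uniformizer ^ n * u" using fac * by blast
  obtain m w where w: "is_unit w" "poly r x = uniformizer ^ m * w" using fac[of r 0] * by auto
  have "z = uniformizer powi (int n - int m) * (u / w)"
    unfolding *(5) u(2) w(2) using uniformizer_nz by (simp add: power_int_diff)
  then show ?thesis using is_unit_divide[OF u(1) w(1)] by blast
qed

lemma is_unit_local_ring: "is_unit u \<Longrightarrow> u \<in> local_ring"
  by (auto simp: is_unit_def local_ring_def)

lemma local_ring_closed:
  "a \<in> local_ring \<Longrightarrow> b \<in> local_ring \<Longrightarrow> a + b \<in> local_ring"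
  "a \<in> local_ring \<Longrightarrow> b \<in> local_ring \<Longrightarrow> a * b \<in> local_ring"
  "a \<in> local_ring \<Longrightarrow> b \<in> local_ring \<Longrightarrow> a - b \<in> local_ring"
  "c \<in> k \<Longrightarrow> c \<in> local_ring"
proof -
  show "a + b \<in> local_ring" "a * b \<in> local_ring" "a - b \<in> local_ring"
    if "a \<in> local_ring" "b \<in> local_ring"
  proof -
    from that obtain u v where *: "local_value a u" "local_value b v" by (auto simp: local_ring_def)
    show "a + b \<in> local_ring" "a * b \<in> local_ring" "a - b \<in> local_ring"
      using local_value_add[OF *] local_value_mult[OF *] local_value_diff[OF *]
      unfolding local_ring_def by simp_all metis+
  qed
  show "c \<in> k \<Longrightarrow> c \<in> local_ring"
    unfolding local_ring_def using local_value_const by blast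
qed

lemma value_0_inverse: "local_value z 0 \<Longrightarrow> z = 0 \<or> inverse z \<notin> local_ring"
proof (rule disjCI)
  assume z: "local_value z 0" and "\<not> inverse z \<notin> local_ring"
  then obtain v where v: "local_value (inverse z) v" by (auto simp: local_ring_def)
  show "z = 0"
  proof (rule ccontr)
    assume "z \<noteq> 0"
    then have "local_value 1 0" using local_value_mult[OF z v] by simp
    then show False using local_value_unique local_value_const[of 1] by force
  qed
qed

lemma uniformizer_power_local_ring: "uniformizer ^ n \<in> local_ring"
  using local_value_power[OF value_uniformizer] by (auto simp: local_ring_def)

lemma valuation_ring_local_ring: "valuation_ring k E local_ring"
  unfolding valuation_ring_def
proof (intro conjI ballI)
  show "subring local_ring Amb"
    using local_ring_closed local_ring_closed(3)[of 0] by (intro Amb.subringI) auto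
  have "x \<in> local_ring" using local_value_value0[OF value0_poly[of "[:0, 1:]"]] by (auto simp: local_ring_def)
  then show "k \<subset> local_ring" using local_ring_closed(4) x_notin_k by auto
  have "inverse uniformizer \<notin> local_ring" using value_0_inverse[OF value_uniformizer] uniformizer_nz by auto
  moreover have "inverse uniformizer \<in> E" using local_value_E[OF value_uniformizer] by auto
  moreover have "local_ring \<subseteq> E" using local_value_E by (auto simp: local_ring_def)
  ultimately show "local_ring \<subset> E" by auto
  fix z assume z: "z \<in> E"
  show "z \<in> local_ring \<or> inverse z \<in> local_ring"
  proof (cases "z = 0")
    case False
    then obtain n u where u: "is_unit u" "z = uniformizer powi n * u" using factor z by blast
    show ?thesis
    proof (cases "n \<ge> 0")
      case True
      then have "z = uniformizer ^ nat n * u" unfolding u by (simp add: power_int_def)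
      then show ?thesis
        using uniformizer_power_local_ring is_unit_local_ring[OF u(1)] by (auto intro: local_ring_closed)
    next
      case False
      then have "inverse z = uniformizer ^ nat (- n) * inverse u" unfolding u
        by (simp add: power_int_def power_inverse)
      then show ?thesis
        using uniformizer_power_local_ring is_unit_local_ring[OF is_unit_inverse[OF u(1)]]
        by (auto intro: local_ring_closed)
    qed
  qed (auto intro: local_ring_closed)
qed

lemma place_local_ring: "place k E local_ring uniformizer"
proof (rule place.intro[OF base_field_axioms place_axioms.intro])
  show "subfield E Amb" by (rule subfield_adjoin)
  show "valuation_ring k E local_ring" by (rule valuation_ring_local_ring)
  show "uniformizer \<in> local_ring" using value_uniformizer by (auto simp: local_ring_def)
  show "uniformizer \<noteq> 0" by (rule uniformizer_nz)
  show "inverse uniformizer \<notin> local_ring" using value_0_inverse[OF value_uniformizer] uniformizer_nz by auto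
  show "\<exists>n u. u \<noteq> 0 \<and> u \<in> local_ring \<and> inverse u \<in> local_ring \<and> z = uniformizer powi n * u"
    if "z \<in> E" "z \<noteq> 0" for z
    using factor[OF that] is_unit_nz is_unit_local_ring is_unit_inverse by blast
  show "\<exists>c\<in>k. v = c \<or> inverse (v - c) \<notin> local_ring" if v: "v \<in> local_ring" for v
  proof -
    obtain c where c: "local_value v c" using v by (auto simp: local_ring_def)
    then have "local_value (v - c) 0" using local_value_diff[OF c local_value_const[of c]] local_value_k by auto
    then show ?thesis using value_0_inverse local_value_k[OF c] by force
  qed
qed

text \<open>Modulo the maximal ideal of \<open>V\<close> a polynomial function is congruent to its
  value at the point, so denominators not vanishing there are units and the local ring lies in
  \<open>V\<close>. A further element of \<open>V\<close> would have negative order and put the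
  inverse of the uniformizer into \<open>V\<close>.\<close>

lemma local_ring_unique:
  assumes "valuation_ring k E V" "x \<in> V" "y \<in> V" "inverse (x - \<alpha>) \<notin> V" "y = \<beta> \<or> inverse (y - \<beta>) \<notin> V"
  shows "V = local_ring"
proof -
  interpret V: valring k E V
    by (rule valring.intro[OF base_field_axioms valring_axioms.intro[OF subfield_adjoin assms(1)]])
  have xM: "x - \<alpha> \<in> V.M" and yM: "y - \<beta> \<in> V.M" using assms \<alpha> \<beta> by (auto simp: V.M_def)
  have diff: "z \<in> V \<and> z - v \<in> V.M" if zv: "value0 z v" for z v
  proof -
    obtain p q where pq: "p \<in> polys k" "q \<in> polys k" "z = poly p x + poly q x * y"
      "v = poly p \<alpha> + poly q \<alpha> * \<beta>" using zv unfolding value0_def by blast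
    have "z - v = (poly p x - poly p \<alpha>) + ((poly q x - poly q \<alpha>) * y + (y - \<beta>) * poly q \<alpha>)"
      unfolding pq by (simp add: algebra_simps)
    also have "\<dots> \<in> V.M"
      using pq assms xM yM \<alpha> by (intro V.M_add V.M_mult V.poly_diff_M) auto
    finally show ?thesis using pq assms by auto
  qed
  have unit: "inverse z \<in> V" if zv: "value0 z v" "v \<noteq> 0" for z v
  proof (rule ccontr)
    assume "inverse z \<notin> V"
    then have "z \<in> V.M" using diff[OF zv(1)] by (auto simp: V.M_def)
    then have "z - (z - v) \<in> V.M" using diff[OF zv(1)] V.M_diff by blast
    then show False using V.M_k[of v] value0_k[OF zv(1)] zv(2) by simp
  qed
  have sub: "local_ring \<subseteq> V"
    using diff unit by (auto simp: local_ring_def local_value_def divide_inverse)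
  have t: "inverse uniformizer \<notin> V"
    using assms y_nz by (auto simp: uniformizer_def)
  have "z \<in> local_ring" if z: "z \<in> V" for z
  proof (rule ccontr)
    assume nz: "z \<notin> local_ring"
    then have "z \<noteq> 0" using local_ring_closed(4)[of 0] by auto
    then obtain n u where u: "is_unit u" "z = uniformizer powi n * u" using factor z V.V_sub by blast
    have "n < 0"
    proof (rule ccontr)
      assume "\<not> n < 0"
      then have "z = uniformizer ^ nat n * u" unfolding u by (simp add: power_int_def)
      then show False using nz uniformizer_power_local_ring is_unit_local_ring[OF u(1)]
        by (auto intro: local_ring_closed)
    qed
    \<comment> \<open>Multiplying \<open>z\<close> by the power \<open>- n - 1\<close> of the
      uniformizer and by \<open>inverse u\<close> leaves exactly the exponent -1.\<close>
    then have "n = - 1 - int (nat (- n - 1))" by simp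
    then have "inverse uniformizer = z * (uniformizer ^ nat (- n - 1) * inverse u)"
      unfolding u(2) using uniformizer_nz is_unit_nz[OF u(1)]
      by (metis (no_types, lifting) add.commute diff_add_cancel mult.assoc mult.commute
          mult_1 power_int_add power_int_minus1_right power_int_of_nat right_inverse)
    also have "\<dots> \<in> V"
      using z sub uniformizer_power_local_ring is_unit_local_ring[OF is_unit_inverse[OF u(1)]] by blast
    finally show False using t by simp
  qed
  then show ?thesis using sub by auto
qed

lemma local_ring_x: "x \<in> local_ring" "y \<in> local_ring" "inverse (x - \<alpha>) \<notin> local_ring"
  using local_value_value0[OF value0_poly[of "[:0, 1:]"]] local_value_value0[OF value0_y]
    value_0_inverse[OF value_x] x_neq
  by (auto simp: local_ring_def)

lemma place_ord_x: "place_ord local_ring (x - \<alpha>) = (if \<beta> = 0 then 2 else 1)"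
proof -
  interpret place k E local_ring uniformizer by (rule place_local_ring)
  show ?thesis
  proof (cases "\<beta> = 0")
    case True
    obtain u where u: "is_unit u" "x - \<alpha> = y ^ 2 * u" using x_factor_ramified[OF True] .
    then have "u \<in> U" using is_unit_local_ring is_unit_inverse is_unit_nz by (auto simp: U_def)
    moreover have "uniformizer = y" unfolding uniformizer_def using True by simp
    ultimately have "place_ord local_ring (x - \<alpha>) = 2" using u(2) place_ord_eq[of u 2] by simp
    then show ?thesis unfolding if_P[OF True] .
  next
    case False
    then show ?thesis using place_ord_t by (simp add: uniformizer_def)
  qed
qed

end

section \<open>The genus of a hyperelliptic field\<close>

context alg_closed_base_field
begin

lemma transcI:
  assumes "z \<notin> k" shows "transc k z"
  unfolding transc_def
proof (intro ballI impI, rule ccontr)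
  fix p assume p: "p \<in> polys k" "poly p z = 0" "p \<noteq> 0"
  then obtain cs where cs: "set cs \<subseteq> k" "p = Polynomial.smult (Polynomial.lead_coeff p) (\<Prod>c\<leftarrow>cs. [:- c, 1:])"
    using split_linear by blast
  have "poly (\<Prod>c\<leftarrow>cs. [:- c, 1:]) z \<noteq> 0"
    using cs(1) assms by (induction cs) auto
  moreover have "poly p z = Polynomial.lead_coeff p * poly (\<Prod>c\<leftarrow>cs. [:- c, 1:]) z"
    by (subst cs(2)) simp
  ultimately show False using p by simp
qed

lemma sqrt_exists: "c \<in> k \<Longrightarrow> \<exists>d\<in>k. d ^ 2 = c"
  using root_exists[of "[:- c, 0, 1:]"] by (auto simp: power2_eq_square)

end

text \<open>Giving the roots as a set of \<open>2 * g + 1\<close> elements encodes degree and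
  squarefreeness at once.\<close>

locale odd_curve = alg_closed_base_field k for k :: "'a::field_char_0 set" +
  fixes x y c :: 'a and R :: "'a set" and g :: nat
  assumes R: "finite R" "R \<subseteq> k" "card R = 2 * g + 1"
    and c: "c \<in> k" "c \<noteq> 0"
    and transc: "transc k x"
    and eq: "y ^ 2 = c * (\<Prod>e\<in>R. x - e)"
begin

definition f where "f = Polynomial.smult c (\<Prod>e\<in>R. [:- e, 1:])"

lemma f_polys: "f \<in> polys k"
  using c R unfolding f_def by (intro polys_smult polys_prod) auto

lemma poly_f: "poly f z = c * (\<Prod>e\<in>R. z - e)"
  by (simp add: f_def poly_prod)

lemma f_nz: "f \<noteq> 0"
  using c R by (auto simp: f_def)

lemma degree_f: "Polynomial.degree f = 2 * g + 1"
  using c R by (auto simp: f_def degree_prod_eq_sum_degree)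

text \<open>If \<open>y = p(x) / q(x)\<close>, then \<open>p^2 = q^2 f\<close>, where the left side
  has even and the right side odd degree.\<close>

lemma y_notin: "y \<notin> adjoin k {x}"
proof
  assume "y \<in> adjoin k {x}"
  then obtain p q where pq: "p \<in> polys k" "q \<in> polys k" "poly q x \<noteq> 0" "y = poly p x / poly q x"
    by (rule adjoinE)
  then have "poly p x = y * poly q x" by simp
  then have "poly (p ^ 2 - q ^ 2 * f) x = 0"
    using eq by (simp add: poly_f power_mult_distrib)
  moreover have "p ^ 2 - q ^ 2 * f \<in> polys k" using pq f_polys by auto
  ultimately have *: "p ^ 2 = q ^ 2 * f" using transc by (auto simp: transc_def)
  have "q \<noteq> 0" using pq by auto
  then have "q ^ 2 * f \<noteq> 0" using f_nz by simp
  then have "Polynomial.degree (p ^ 2) = Polynomial.degree (q ^ 2) + (2 * g + 1)"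
    unfolding * by (subst degree_mult_eq) (auto simp: degree_f)
  then have "2 * Polynomial.degree p = 2 * Polynomial.degree q + (2 * g + 1)"
    by (cases "p = 0"; cases "q = 0") (auto simp: degree_power_eq simp del: One_nat_def)
  then show False by presburger
qed

sublocale quadratic_field k x y f
  using f_polys eq transc y_notin by unfold_locales (auto simp: poly_f)

lemma curve_pointI:
  assumes "\<alpha> \<in> k" "\<beta> \<in> k" "\<beta> ^ 2 = poly f \<alpha>"
  shows "curve_point k x y f \<alpha> \<beta>"
proof unfold_locales
  show "\<beta> \<noteq> 0 \<or> poly (pderiv f) \<alpha> \<noteq> 0"
  proof (rule disjCI)
    assume "\<not> poly (pderiv f) \<alpha> \<noteq> 0"
    moreover have "poly (pderiv f) \<alpha> \<noteq> 0" if "\<beta> = 0"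
    proof -
      have "\<alpha> \<in> R" using assms(3) that c R(1) by (auto simp: poly_f)
      define h where "h = Polynomial.smult c (\<Prod>e\<in>R - {\<alpha>}. [:- e, 1:])"
      have "f = [:- \<alpha>, 1:] * h"
        unfolding f_def h_def using prod.remove[OF R(1) \<open>\<alpha> \<in> R\<close>, of "\<lambda>e. [:- e, 1:]"]
        by (simp only: mult_smult_right)
      then have "poly (pderiv f) \<alpha> = poly h \<alpha>"
        by (simp only: pderiv_mult) (simp add: pderiv_pCons)
      moreover have "poly h \<alpha> \<noteq> 0" using c R(1) by (auto simp: h_def poly_prod)
      ultimately show ?thesis by simp
    qed
    ultimately show "\<beta> \<noteq> 0" by blast
  qed
qed (use assms in auto)

abbreviation "E \<equiv> adjoin k {x, y}"

lemmas E_closed [simp, intro] = subfieldD[OF subfield_adjoin[of k "{x, y}"]]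

lemma x_nz: "x \<noteq> 0"
  using x_notin_k by auto

text \<open>The point at infinity is the origin of the curve \<open>y'\<^sup>2 = f'(x')\<close>.\<close>

definition x' where "x' = inverse x"
definition y' where "y' = y / x ^ (g + 1)"
definition f' where "f' = Polynomial.smult c ([:0, 1:] * (\<Prod>e\<in>R. [:1, - e:]))"

text \<open>Dividing by \<open>x ^ (2 * g + 2)\<close> turns each of the \<open>2 * g + 1\<close>
  factors \<open>x - e\<close> into \<open>1 - e * x'\<close> and leaves one factor
  \<open>x'\<close> over, which makes the origin a simple root of \<open>f'\<close> and thus a
  nonsingular branch point.\<close>

lemma y'_sq: "y' ^ 2 = poly f' x'"
proof -
  have "(\<Prod>e\<in>R. 1 - x' * e) = (\<Prod>e\<in>R. (x - e) * x')"
    using x_nz by (intro prod.cong) (auto simp: x'_def field_simps)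
  also have "\<dots> = (\<Prod>e\<in>R. x - e) * x' ^ (2 * g + 1)"
    using R by (simp add: prod.distrib)
  finally have "poly f' x' = y ^ 2 * x' ^ (2 * g + 2)"
    by (simp add: f'_def poly_prod eq algebra_simps)
  also have "\<dots> = y' ^ 2"
    by (simp add: y'_def x'_def power_mult_distrib divide_inverse power_inverse flip: power_mult)
       (simp add: power_add power2_eq_square power_mult algebra_simps)
  finally show ?thesis by simp
qed

lemma adjoin_x': "adjoin k {x'} = adjoin k {x}"
proof (rule adjoin_eqI)
  show "{x'} \<subseteq> adjoin k {x}"
    using adjoin_incl(2)[of "{x}" k] subfieldD[OF subfield_adjoin[of k "{x}"]] by (auto simp: x'_def)
  have "inverse x' \<in> adjoin k {x'}"
    using adjoin_incl(2)[of "{x'}" k] subfieldD[OF subfield_adjoin[of k "{x'}"]] by auto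
  then show "{x} \<subseteq> adjoin k {x'}" by (simp add: x'_def)
qed

lemma y_eq: "y = y' * x ^ (g + 1)"
  using x_nz by (simp add: y'_def)

lemma adjoin_x'_y': "adjoin k {x', y'} = E"
proof (rule adjoin_eqI)
  show "{x', y'} \<subseteq> E" using x_in y_in by (auto simp: x'_def y'_def)
  have *: "inverse x' \<in> adjoin k {x', y'}"
    using adjoin_incl(2)[of "{x', y'}" k] subfieldD[OF subfield_adjoin[of k "{x', y'}"]] by auto
  then have "y' * inverse x' ^ (g + 1) \<in> adjoin k {x', y'}"
    using adjoin_incl(2)[of "{x', y'}" k] by (intro subfieldD[OF subfield_adjoin]) auto
  then have "y \<in> adjoin k {x', y'}" using y_eq by (metis x'_def inverse_inverse_eq)
  then show "{x, y} \<subseteq> adjoin k {x', y'}" using * by (simp add: x'_def)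
qed

sublocale inf: curve_point k x' y' f' 0 0
proof unfold_locales
  show "f' \<in> polys k" using c R unfolding f'_def by (intro polys_smult polys_mult polys_prod) auto
  have "x' \<notin> k"
  proof
    assume "x' \<in> k"
    then have "inverse x' \<in> k" by auto
    then show False using x_notin_k by (simp add: x'_def)
  qed
  then show "transc k x'" by (rule transcI)
  show "y' \<notin> adjoin k {x'}"
  proof
    note F = subfieldD[OF subfield_adjoin[of k "{x}"]]
    assume "y' \<in> adjoin k {x'}"
    then have "y' * x ^ (g + 1) \<in> adjoin k {x}"
      unfolding adjoin_x' using adjoin_incl(2)[of "{x}" k] by (intro F) auto
    then show False using y_notin y_eq by simp
  qed
  have "poly (pderiv f') 0 = c"
    unfolding f'_def pderiv_smult pderiv_mult by (simp add: pderiv_pCons poly_prod)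
  then show "0 \<noteq> (0::'a) \<or> poly (pderiv f') 0 \<noteq> 0" using c by simp
qed (auto simp: y'_sq f'_def)

definition Vinf where "Vinf = inf.local_ring"

lemma place_Vinf: "place k E Vinf y'"
  using inf.place_local_ring by (simp add: Vinf_def adjoin_x'_y' inf.uniformizer_def)

interpretation Vinf: place k E Vinf y'
  by (rule place_Vinf)

text \<open>If \<open>x \<notin> V\<close>, then \<open>x'\<close> and, by integrality,
  \<open>y'\<close> reduce to 0, and \<open>local_ring_unique\<close> applies at infinity. If
  \<open>x \<in> V\<close>, then \<open>y \<in> V\<close> by integrality, some
  \<open>x - \<alpha>\<close> is a non-unit, and
  \<open>(y - \<beta>) (y + \<beta>) = f(x) - f(\<alpha>)\<close>, lying in the maximal ideal,
  selects a point above \<alpha>.\<close>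

lemma place_cases:
  assumes V: "valuation_ring k E V"
  shows "(x \<notin> V \<and> V = Vinf) \<or>
    (x \<in> V \<and> (\<exists>\<alpha> \<beta>. \<alpha> \<in> k \<and> \<beta> \<in> k \<and> \<beta> ^ 2 = poly f \<alpha> \<and> inverse (x - \<alpha>) \<notin> V \<and>
      V = curve_point.local_ring k x y \<alpha> \<beta>))"
proof -
  interpret V: valring k E V
    by (rule valring.intro[OF base_field_axioms valring_axioms.intro[OF subfield_adjoin V]])
  show ?thesis
  proof (cases "x \<in> V")
    case False
    then have x': "x' \<in> V" "inverse (x' - 0) \<notin> V" using V.V_cases[OF x_in] by (auto simp: x'_def)
    then have "x' \<in> V.M" by (auto simp: V.M_def)
    then have "poly f' x' \<in> V.M"
      using V.poly_diff_M[OF inf.f x'(1), of 0] by (simp add: f'_def)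
    then have *: "y' ^ 2 \<in> V.M" using y'_sq by simp
    moreover have "y' \<in> E" using adjoin_x'_y' adjoin_incl(2)[of "{x', y'}" k] by auto
    ultimately have "y' \<in> V" by (rule V.integral_V[OF _ V.M_V, rotated])
    moreover from this have "y' \<in> V.M" using * V.M_prime[of y' y'] by (auto simp: power2_eq_square)
    then have "y' = 0 \<or> inverse (y' - 0) \<notin> V" by (auto simp: V.M_def)
    ultimately have "V = Vinf"
      unfolding Vinf_def using V x' by (intro inf.local_ring_unique) (auto simp: adjoin_x'_y')
    then show ?thesis using False by auto
  next
    case True
    have "y ^ 2 \<in> V" unfolding y_sq using f_polys True by auto
    then have y: "y \<in> V" using V.integral_V y_in by auto
    \<comment> \<open>Polynomials over \<open>k\<close> split, so if all \<open>x - \<alpha>\<close>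
      were units, every nonzero polynomial in \<open>x\<close> would be one, and \<open>V\<close>
      would be all of \<open>E\<close>.\<close>
    have "\<exists>\<alpha>\<in>k. inverse (x - \<alpha>) \<notin> V"
    proof (rule ccontr)
      assume "\<not> (\<exists>\<alpha>\<in>k. inverse (x - \<alpha>) \<notin> V)"
      then have units: "inverse (x - \<alpha>) \<in> V" if "\<alpha> \<in> k" for \<alpha> using that by auto
      have inv: "inverse (poly r x) \<in> V" if r: "r \<in> polys k" "r \<noteq> 0" for r
      proof -
        obtain cs where cs: "set cs \<subseteq> k" "r = Polynomial.smult (Polynomial.lead_coeff r) (\<Prod>c\<leftarrow>cs. [:- c, 1:])"
          using split_linear r by blast
        have "inverse (poly (\<Prod>c\<leftarrow>cs. [:- c, 1:]) x) \<in> V"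
          using cs(1) units by (induction cs) (auto simp del: mult_pCons_left)
        moreover have "inverse (Polynomial.lead_coeff r) \<in> V" using r by (intro V.V_closed(7)) auto
        ultimately have "inverse (Polynomial.lead_coeff r) * inverse (poly (\<Prod>c\<leftarrow>cs. [:- c, 1:]) x) \<in> V"
          by auto
        then show ?thesis by (subst cs(2)) simp
      qed
      have "E \<subseteq> V"
      proof
        fix z assume "z \<in> E"
        then obtain p q r where "p \<in> polys k" "q \<in> polys k" "r \<in> polys k" "r \<noteq> 0"
          "z = (poly p x + poly q x * y) / poly r x" by (rule field_elem)
        then show "z \<in> V" using inv True y by (auto simp: divide_inverse)
      qed
      then show False using V.V_sub V.V_neq by auto
    qed
    then obtain \<alpha> where \<alpha>: "\<alpha> \<in> k" "inverse (x - \<alpha>) \<notin> V" by auto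
    obtain \<beta> where \<beta>: "\<beta> \<in> k" "\<beta> ^ 2 = poly f \<alpha>" using sqrt_exists[of "poly f \<alpha>"] \<alpha> f_polys by auto
    have "x - \<alpha> \<in> V.M" using \<alpha> True by (auto simp: V.M_def)
    then have "poly f x - poly f \<alpha> \<in> V.M" using V.poly_diff_M[OF f_polys True \<alpha>(1)] by simp
    moreover have "poly f x - poly f \<alpha> = (y - \<beta>) * (y - (- \<beta>))"
      using y_sq \<beta>(2) by (simp add: algebra_simps power2_eq_square)
    ultimately have "y - \<beta> \<in> V.M \<or> y - (- \<beta>) \<in> V.M"
      using y \<beta> by (intro V.M_prime) auto
    then obtain \<beta>' where \<beta>': "\<beta>' \<in> k" "\<beta>' ^ 2 = poly f \<alpha>" "y - \<beta>' \<in> V.M"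
      using \<beta> by (metis closed(5) power2_minus)
    have "V = curve_point.local_ring k x y \<alpha> \<beta>'"
      using curve_point.local_ring_unique[OF curve_pointI[OF \<alpha>(1) \<beta>'(1,2)] V True y \<alpha>(2)] \<beta>'(3)
      by (auto simp: V.M_def)
    then show ?thesis using True \<alpha> \<beta>' by blast
  qed
qed

sublocale rational_places k E
proof (rule rational_places.intro[OF base_field_axioms rational_places_axioms.intro])
  show "function_field k E" by (rule function_field)
  fix V assume "valuation_ring k E V"
  then show "\<exists>t. place k E V t"
    using place_cases place_Vinf curve_pointI curve_point.place_local_ring by metis
qed

section \<open>Orders at the point at infinity\<close>

lemma x_minus_E: "\<alpha> \<in> k \<Longrightarrow> x - \<alpha> \<in> E"
  using x_in k_in by blast

lemma x_minus_nz: "\<alpha> \<in> k \<Longrightarrow> x - \<alpha> \<noteq> 0"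
  using x_notin_k by auto

lemma x_notin_Vinf: "x \<notin> Vinf"
  using inf.local_ring_x(3) by (simp add: Vinf_def x'_def)

lemma ord_Vinf_unit: "p \<in> polys k \<Longrightarrow> poly p 0 \<noteq> 0 \<Longrightarrow> place_ord Vinf (poly p x') = 0"
  using inf.is_unit_poly[of p] inf.is_unit_local_ring inf.is_unit_inverse inf.is_unit_nz
  by (intro Vinf.place_ord_U Vinf.U_I) (auto simp: Vinf_def)

lemma ord_Vinf_x: "place_ord Vinf x = - 2"
proof -
  have "place_ord Vinf x' = 2" using inf.place_ord_x by (simp add: Vinf_def)
  then show ?thesis using Vinf.place_ord_inverse[OF x_in x_nz] by (simp add: x'_def)
qed

text \<open>\<open>p(x)\<close> is a power of \<open>x\<close> times the reflected polynomial in
  \<open>x'\<close>, whose constant term is the leading coefficient of \<open>p\<close>; this factor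
  is a unit at infinity.\<close>

lemma ord_Vinf_poly:
  assumes "p \<in> polys k" "p \<noteq> 0"
  shows "place_ord Vinf (poly p x) = - 2 * int (Polynomial.degree p)"
proof -
  have r: "reflect_poly p \<in> polys k"
    using assms by (auto simp: polys_def coeff_reflect_poly)
  have r0: "poly (reflect_poly p) 0 \<noteq> 0" using assms by simp
  have eq: "poly p x = x ^ Polynomial.degree p * poly (reflect_poly p) x'"
    using x_nz by (simp add: poly_reflect_poly_nz x'_def power_inverse)
  have "poly (reflect_poly p) x' \<in> E"
    using poly_closed_over[OF subfield_adjoin k_in r, of x'] x_in by (simp add: x'_def)
  moreover have "poly (reflect_poly p) x' \<noteq> 0" using eq assms by (auto simp: poly_x_eq_0_iff)
  ultimately show ?thesis unfolding eq
    using ord_Vinf_unit[OF r r0] Vinf.place_ord_power[OF x_in x_nz] x_in x_nz ord_Vinf_x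
    by (subst Vinf.place_ord_mult) auto
qed

lemma y_nz: "y \<noteq> 0"
  using y_notin subfieldD(1)[OF subfield_adjoin] by auto

lemma ord_Vinf_y: "place_ord Vinf y = - int (2 * g + 1)"
proof -
  have "y' \<in> E" "y' \<noteq> 0" using x_in y_in y_nz x_nz by (auto simp: y'_def)
  then have "place_ord Vinf (y' * x ^ N) = 1 + int N * (- 2)" for N
    using Vinf.place_ord_t Vinf.place_ord_power[OF x_in x_nz] x_in x_nz ord_Vinf_x
    by (subst Vinf.place_ord_mult) auto
  from this[of "g + 1"] have "place_ord Vinf y = 1 + int (g + 1) * (- 2)"
    unfolding y_eq[symmetric] .
  then show ?thesis by simp
qed

text \<open>One order is even and the other odd, so they differ and the smaller one is the order of
  the sum. By parity, \<open>2 * degree q + 2 * g + 1 \<le> 2 * M\<close> becomes the strict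
  \<open>degree q + g < M\<close>.\<close>

lemma ord_Vinf_pair:
  assumes p: "p \<in> polys k" and q: "q \<in> polys k" and nz: "p \<noteq> 0 \<or> q \<noteq> 0"
  shows "place_ord Vinf (poly p x + poly q x * y) \<ge> - int (2 * M) \<longleftrightarrow>
    (p = 0 \<or> Polynomial.degree p \<le> M) \<and> (q = 0 \<or> Polynomial.degree q + g < M)"
proof -
  have pE: "poly p x \<in> E" and qE: "poly q x \<in> E" using pair_in[of p 0] pair_in[of q 0] p q by auto
  then have qyE: "poly q x * y \<in> E" using y_in by auto
  have op: "p \<noteq> 0 \<Longrightarrow> place_ord Vinf (poly p x) = - 2 * int (Polynomial.degree p)"
    using ord_Vinf_poly p by blast
  have oq: "q \<noteq> 0 \<Longrightarrow> place_ord Vinf (poly q x * y) = - 2 * int (Polynomial.degree q) - 2 * int g - 1"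
    using ord_Vinf_poly[OF q] Vinf.place_ord_mult[OF qE _ y_in y_nz] ord_Vinf_y q
    by (auto simp: poly_x_eq_0_iff)
  consider "p = 0" "q \<noteq> 0" | "p \<noteq> 0" "q = 0" | "p \<noteq> 0" "q \<noteq> 0" using nz by blast
  then show ?thesis
  proof cases
    case 3
    then have nz: "poly p x \<noteq> 0" "poly q x * y \<noteq> 0" using y_nz p q by (auto simp: poly_x_eq_0_iff)
    have ne: "place_ord Vinf (poly p x) \<noteq> place_ord Vinf (poly q x * y)"
      using op[OF 3(1)] oq[OF 3(2)] by presburger
    then have "place_ord Vinf (poly p x + poly q x * y) =
      min (place_ord Vinf (poly p x)) (place_ord Vinf (poly q x * y))"
      using Vinf.place_ord_add_less[OF pE nz(1) qyE nz(2)] Vinf.place_ord_add_less[OF qyE nz(2) pE nz(1)]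
      by (cases "place_ord Vinf (poly p x) < place_ord Vinf (poly q x * y)") (auto simp: add.commute)
    then show ?thesis using op[OF 3(1)] oq[OF 3(2)] 3 by auto
  qed (use op oq in auto)
qed

text \<open>The denominator \<open>r\<close> loses one root \<alpha> at a time. Regularity at the
  points over \<alpha> gives \<open>p(\<alpha>) + q(\<alpha>) \<beta> = 0\<close> for either sign of
  \<beta>, hence \<open>p(\<alpha>) = 0\<close>, and \<open>q(\<alpha>) = 0\<close> as well if
  \<open>\<beta> \<noteq> 0\<close>.\<close>

lemma regular_imp_polynomial:
  assumes "z \<in> E"
    and "\<And>\<alpha> \<beta>. \<alpha> \<in> k \<Longrightarrow> \<beta> \<in> k \<Longrightarrow> \<beta> ^ 2 = poly f \<alpha> \<Longrightarrow> z \<in> curve_point.local_ring k x y \<alpha> \<beta>"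
  shows "\<exists>p\<in>polys k. \<exists>q\<in>polys k. z = poly p x + poly q x * y"
proof -
  obtain p q r where "p \<in> polys k" "q \<in> polys k" "r \<in> polys k" "r \<noteq> 0"
    "z = (poly p x + poly q x * y) / poly r x" using field_elem[OF assms(1)] .
  then show ?thesis
  proof (induction "Polynomial.degree r" arbitrary: p q r)
    case 0
    then obtain d where d: "r = [:d:]" using degree_eq_zeroE by metis
    then have "d \<in> k" "d \<noteq> 0" using 0 by auto
    moreover have "z = poly (Polynomial.smult (inverse d) p) x + poly (Polynomial.smult (inverse d) q) x * y"
      using 0 d by (simp add: field_simps)
    ultimately show ?case using 0 by blast
  next
    case (Suc n)
    obtain \<alpha> where \<alpha>: "\<alpha> \<in> k" "poly r \<alpha> = 0" using root_exists[of r] Suc by auto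
    obtain \<beta> where \<beta>: "\<beta> \<in> k" "\<beta> ^ 2 = poly f \<alpha>" using sqrt_exists[of "poly f \<alpha>"] \<alpha> f_polys by auto
    obtain r1 where r1: "r1 \<in> polys k" "r = [:- \<alpha>, 1:] * r1"
      using polys_root_factor[OF Suc.prems(3) \<alpha>] .
    have rz: "poly p x + poly q x * y = poly r x * z"
      using Suc.prems by (simp add: poly_x_eq_0_iff)
    have val: "poly p \<alpha> + poly q \<alpha> * \<gamma> = 0" if \<gamma>: "\<gamma> \<in> k" "\<gamma> ^ 2 = poly f \<alpha>" for \<gamma>
    proof -
      interpret P: curve_point k x y f \<alpha> \<gamma> by (rule curve_pointI[OF \<alpha>(1) \<gamma>])
      obtain w where w: "P.local_value z w" using assms(2)[OF \<alpha>(1) \<gamma>] by (auto simp: P.local_ring_def)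
      have "P.local_value (poly r x * z) (poly r \<alpha> * w)"
        using P.local_value_mult[OF P.local_value_value0[OF P.value0_poly[OF Suc.prems(3)]] w] .
      moreover have "P.local_value (poly r x * z) (poly p \<alpha> + poly q \<alpha> * \<gamma>)"
        using P.local_value_value0[OF P.value0_pair[OF Suc.prems(1,2)]] rz by simp
      ultimately show ?thesis using P.local_value_unique \<alpha>(2) by force
    qed
    have "2 * poly p \<alpha> = 0" using val[of \<beta>] val[of "- \<beta>"] \<beta> by (simp add: algebra_simps)
    then have p0: "poly p \<alpha> = 0" by simp
    obtain p1 where p1: "p1 \<in> polys k" "p = [:- \<alpha>, 1:] * p1"
      using polys_root_factor[OF Suc.prems(1) \<alpha>(1) p0] .
    have q0: "poly q \<alpha> = 0"
    proof (cases "\<beta> = 0")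
      case False
      then show ?thesis using val[OF \<beta>] p0 by simp
    next
      case True
      interpret P: curve_point k x y f \<alpha> \<beta> by (rule curve_pointI[OF \<alpha>(1) \<beta>])
      \<comment> \<open>Only one point lies over \<alpha>. Substituting
        \<open>x - \<alpha> = y ^ 2 * u\<close> shows that \<open>q(x)\<close> is \<open>y\<close>
        times a regular function, so it vanishes at the point.\<close>
      obtain u where u: "P.is_unit u" "x - \<alpha> = y ^ 2 * u" using P.x_factor_ramified[OF True] .
      obtain v where v: "P.local_value u v" using u(1) by (auto simp: P.is_unit_def)
      have "P.local_value z w \<Longrightarrow> \<exists>w'. P.local_value (poly r1 x * z - poly p1 x) w'" for w
        using P.local_value_diff[OF P.local_value_mult] P.local_value_value0[OF P.value0_poly] r1 p1 by blast
      then obtain w where w: "P.local_value (poly r1 x * z - poly p1 x) w"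
        using assms(2)[OF \<alpha>(1) \<beta>] by (auto simp: P.local_ring_def)
      have "poly q x * y = (x - \<alpha>) * (poly r1 x * z - poly p1 x)"
        using rz unfolding r1(2) p1(2) by (simp add: algebra_simps)
      then have "poly q x * y = y * (u * (poly r1 x * z - poly p1 x)) * y"
        unfolding u(2) by (simp add: power2_eq_square mult_ac)
      then have "poly q x = y * (u * (poly r1 x * z - poly p1 x))" using y_nz by simp
      then have "P.local_value (poly q x) (\<beta> * (v * w))"
        using P.local_value_mult[OF P.local_value_value0[OF P.value0_y] P.local_value_mult[OF v w]] by simp
      then have "poly q \<alpha> = \<beta> * (v * w)"
        using P.local_value_unique[OF P.local_value_value0[OF P.value0_poly[OF Suc.prems(2)]]] by blast
      also have "\<dots> = 0" using True by (simp only: mult_zero_left)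
      finally show ?thesis .
    qed
    obtain q1 where q1: "q1 \<in> polys k" "q = [:- \<alpha>, 1:] * q1"
      using polys_root_factor[OF Suc.prems(2) \<alpha>(1) q0] .
    have "r1 \<noteq> 0" using r1 Suc.prems by auto
    then have "Polynomial.degree r = Suc (Polynomial.degree r1)" unfolding r1(2) by (subst degree_mult_eq) auto
    moreover have "poly p x + poly q x * y = (x - \<alpha>) * (poly p1 x + poly q1 x * y)" "poly r x = (x - \<alpha>) * poly r1 x"
      unfolding p1(2) q1(2) r1(2) by (simp_all add: algebra_simps)
    then have "z = (poly p1 x + poly q1 x * y) / poly r1 x"
      using Suc.prems(5) x_minus_nz[OF \<alpha>(1)] by simp
    ultimately show ?case using Suc.hyps p1(1) q1(1) r1(1) \<open>r1 \<noteq> 0\<close> by simp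
  qed
qed

section \<open>Riemann-Roch spaces of even multiples of the point at infinity\<close>

definition D0 :: "nat \<Rightarrow> 'a set \<Rightarrow> int"
  where "D0 M V = (if V = Vinf then 2 * int M else 0)"

text \<open>Regularity at the finite places leaves polynomial pairs, and the pole bound at infinity
  limits the degrees: \<open>degree p \<le> M\<close> leaves \<open>M + 1\<close> coefficients,
  \<open>degree q < M - g\<close> leaves \<open>M - g\<close>.\<close>

lemma L_D0:
  assumes "g \<le> M"
  shows "L (D0 M) = poly_space (M + 1) (M - g)"
proof (intro equalityI subsetI)
  fix z assume z: "z \<in> L (D0 M)"
  have "\<exists>p\<in>polys k. \<exists>q\<in>polys k. z = poly p x + poly q x * y"
  proof (rule regular_imp_polynomial)
    show "z \<in> E" using z by (simp add: L_mem)
    fix \<alpha> \<beta> assume \<alpha>\<beta>: "\<alpha> \<in> k" "\<beta> \<in> k" "\<beta> ^ 2 = poly f \<alpha>"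
    interpret P: curve_point k x y f \<alpha> \<beta> by (rule curve_pointI[OF \<alpha>\<beta>])
    interpret V: place k E P.local_ring P.uniformizer by (rule P.place_local_ring)
    have "P.local_ring \<noteq> Vinf" using P.local_ring_x x_notin_Vinf by auto
    then show "z \<in> P.local_ring"
    proof (cases "z = 0")
      case False
      then have "z \<in> E" "place_ord P.local_ring z \<ge> - D0 M P.local_ring"
        using z V.val by (auto simp: L_mem)
      then show ?thesis
        using V.place_ord_nonneg_iff False \<open>P.local_ring \<noteq> Vinf\<close> by (simp add: D0_def)
    qed simp
  qed
  then obtain p q where pq: "p \<in> polys k" "q \<in> polys k" "z = poly p x + poly q x * y" by blast
  show "z \<in> poly_space (M + 1) (M - g)"
  proof (cases "p = 0 \<and> q = 0")
    case True
    then show ?thesis using pq by (intro poly_spaceI[of p q]) auto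
  next
    case False
    then have "z \<noteq> 0" using pq pair_eq_0_iff by auto
    then have "place_ord Vinf z \<ge> - int (2 * M)" using z Vinf.val by (auto simp: L_mem D0_def)
    then have *: "(p = 0 \<or> Polynomial.degree p \<le> M) \<and> (q = 0 \<or> Polynomial.degree q + g < M)"
      using ord_Vinf_pair[OF pq(1,2)] False pq(3) by auto
    then have "Polynomial.coeff p i = 0" if "i \<ge> M + 1" for i using that by (auto intro!: coeff_eq_0)
    moreover have "Polynomial.coeff q i = 0" if "i \<ge> M - g" for i
      using that * by (cases "q = 0") (auto intro!: coeff_eq_0)
    ultimately show ?thesis using pq by (intro poly_spaceI[of p q]) auto
  qed
next
  fix z assume "z \<in> poly_space (M + 1) (M - g)"
  then obtain p q where pq: "p \<in> polys k" "q \<in> polys k" "z = poly p x + poly q x * y"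
    "\<And>i. i \<ge> M + 1 \<Longrightarrow> Polynomial.coeff p i = 0" "\<And>i. i \<ge> M - g \<Longrightarrow> Polynomial.coeff q i = 0"
    by (auto simp: poly_space_def)
  show "z \<in> L (D0 M)"
  proof (cases "z = 0")
    case False
    have zE: "z \<in> E" using pair_in pq by auto
    have "place_ord V z \<ge> - D0 M V" if V: "valuation_ring k E V" for V
      using place_cases[OF V]
    proof (elim disjE conjE exE)
      assume "V = Vinf"
      moreover have "Polynomial.degree p \<le> M"
        using pq(4)[of "Polynomial.degree p"] by (cases "p = 0") force+
      moreover have "q = 0 \<or> Polynomial.degree q + g < M"
        using pq(5)[of "Polynomial.degree q"] assms by (cases "q = 0") force+
      moreover have "p \<noteq> 0 \<or> q \<noteq> 0" using False pq(3) by auto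
      ultimately show ?thesis
        using ord_Vinf_pair[OF pq(1,2), of M] pq(3) by (simp add: D0_def)
    next
      fix \<alpha> \<beta> assume *: "x \<in> V" "\<alpha> \<in> k" "\<beta> \<in> k" "\<beta> ^ 2 = poly f \<alpha>" "V = curve_point.local_ring k x y \<alpha> \<beta>"
      interpret P: curve_point k x y f \<alpha> \<beta> by (rule curve_pointI[OF *(2-4)])
      interpret V: place k E P.local_ring P.uniformizer by (rule P.place_local_ring)
      have "z \<in> P.local_ring"
        unfolding pq(3) using pq(1,2) P.local_value_value0[OF P.value0_pair] by (auto simp: P.local_ring_def)
      moreover have "P.local_ring \<noteq> Vinf" using P.local_ring_x x_notin_Vinf by auto
      ultimately show ?thesis using V.place_ord_nonneg_iff[OF zE False] by (simp add: D0_def *(5))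
    qed
    then show ?thesis using zE by (simp add: L_mem)
  qed simp
qed

section \<open>Divisors of polynomials in x and the genus\<close>

lemma divisor_D0: "divisor k E (D0 M)" "dvdeg (D0 M) = 2 * int M"
proof -
  show d: "divisor k E (D0 M)"
    unfolding divisor_def D0_def using Vinf.val by (auto intro: finite_subset[of _ "{Vinf}"])
  show "dvdeg (D0 M) = 2 * int M"
    using d by (subst deg_eq[of _ "{Vinf}"]) (auto simp: D0_def split: if_splits)
qed

lemma principal_finite_place:
  assumes "valuation_ring k E V" "x \<in> V" "\<alpha> \<in> k"
  shows "principal (x - \<alpha>) V \<ge> 0" "inverse (x - \<alpha>) \<notin> V \<Longrightarrow> principal (x - \<alpha>) V \<ge> 1"
    "inverse (x - \<alpha>) \<in> V \<Longrightarrow> principal (x - \<alpha>) V = 0"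
proof -
  from places[OF assms(1)] obtain t where "place k E V t" ..
  then interpret V: place k E V t .
  have "x - \<alpha> \<in> V" using assms V.k_sub by auto
  note * = x_minus_E[OF assms(3)] x_minus_nz[OF assms(3)]
  show 0: "principal (x - \<alpha>) V \<ge> 0"
    using V.place_ord_nonneg_iff[OF *] \<open>x - \<alpha> \<in> V\<close> by (simp add: principal_def)
  show "inverse (x - \<alpha>) \<notin> V \<Longrightarrow> principal (x - \<alpha>) V \<ge> 1" "inverse (x - \<alpha>) \<in> V \<Longrightarrow> principal (x - \<alpha>) V = 0"
    using V.place_ord_pos_iff[OF *] 0 assms(1) by (auto simp: principal_def)
qed

lemma principal_Vinf: 
  assumes "\<alpha> \<in> k" shows "principal (x - \<alpha>) Vinf = - 2"
proof -
  have "place_ord Vinf (poly [:- \<alpha>, 1:] x) = - 2 * int (Polynomial.degree [:- \<alpha>, 1:])"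
    by (rule ord_Vinf_poly) (use assms in auto)
  then show ?thesis using Vinf.val by (simp add: principal_def)
qed

text \<open>The function has a double pole at infinity and zeros of total order 2 over \<alpha>. The
  degree is in fact 0, but \<open>\<le> 0\<close> is enough for the upper bound on the genus and
  spares telling the two local rings over \<alpha> apart.\<close>

lemma divisor_principal:
  assumes \<alpha>: "\<alpha> \<in> k"
  shows "divisor k E (principal (x - \<alpha>))" "dvdeg (principal (x - \<alpha>)) \<le> 0"
proof -
  obtain \<beta> where \<beta>: "\<beta> \<in> k" "\<beta> ^ 2 = poly f \<alpha>" using sqrt_exists[of "poly f \<alpha>"] \<alpha> f_polys by auto
  define P where "P = curve_point.local_ring k x y \<alpha>"
  have cp: "curve_point k x y f \<alpha> \<beta>" "curve_point k x y f \<alpha> (- \<beta>)"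
    using curve_pointI[OF \<alpha> \<beta>] curve_pointI[OF \<alpha>, of "- \<beta>"] \<beta> by auto
  have supp: "V \<in> {Vinf, P \<beta>, P (- \<beta>)}" if nz: "principal (x - \<alpha>) V \<noteq> 0" for V
  proof -
    have V: "valuation_ring k E V" using nz by (auto simp: principal_def split: if_splits)
    show ?thesis using place_cases[OF V]
    proof (elim disjE conjE exE)
      fix \<alpha>' \<beta>' assume *: "x \<in> V" "\<alpha>' \<in> k" "\<beta>' \<in> k" "\<beta>' ^ 2 = poly f \<alpha>'" "V = curve_point.local_ring k x y \<alpha>' \<beta>'"
      have "inverse (x - \<alpha>) \<notin> V" using principal_finite_place(3)[OF V *(1) \<alpha>] nz by auto
      interpret P: curve_point k x y f \<alpha>' \<beta>' by (rule curve_pointI[OF *(2-4)])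
      have "\<alpha>' = \<alpha>"
      proof (rule ccontr)
        assume "\<alpha>' \<noteq> \<alpha>"
        then have "P.is_unit (poly [:- \<alpha>, 1:] x)" using \<alpha> by (intro P.is_unit_poly) auto
        then have "inverse (x - \<alpha>) \<in> V"
          using P.is_unit_local_ring[OF P.is_unit_inverse] *(5) by simp
        with \<open>inverse (x - \<alpha>) \<notin> V\<close> show False by simp
      qed
      moreover from this have "\<beta>' = \<beta> \<or> \<beta>' = - \<beta>" using *(4) \<beta>(2) power2_eq_iff[of \<beta>' \<beta>] by simp
      ultimately show ?thesis using *(5) by (auto simp: P_def)
    qed auto
  qed
  show d: "divisor k E (principal (x - \<alpha>))"
    unfolding divisor_def
    by (auto intro: finite_subset[of _ "{Vinf, P \<beta>, P (- \<beta>)}"] dest: supp)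
       (auto simp: principal_def split: if_splits)
  have ne: "Vinf \<noteq> P \<gamma>" if "curve_point k x y f \<alpha> \<gamma>" for \<gamma>
    using curve_point.local_ring_x(1)[OF that] x_notin_Vinf by (auto simp: P_def)
  have ord: "principal (x - \<alpha>) (P \<gamma>) = (if \<gamma> = 0 then 2 else 1)" if "curve_point k x y f \<alpha> \<gamma>" for \<gamma>
    using curve_point.place_ord_x[OF that] curve_point.valuation_ring_local_ring[OF that]
    by (simp add: principal_def P_def)
  have "dvdeg (principal (x - \<alpha>)) = (\<Sum>V\<in>{Vinf, P \<beta>, P (- \<beta>)}. principal (x - \<alpha>) V)"
    using supp by (intro deg_eq[OF d]) auto
  also have "\<dots> \<le> 0"
  proof (cases "P \<beta> = P (- \<beta>)")
    case True
    then show ?thesis using ne[OF cp(1)] ord[OF cp(1)] principal_Vinf[OF \<alpha>] by auto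
  next
    case False
    then have "\<beta> \<noteq> 0" by auto
    then show ?thesis using False ne cp ord[OF cp(1)] ord[OF cp(2)] principal_Vinf[OF \<alpha>] by auto
  qed
  finally show "dvdeg (principal (x - \<alpha>)) \<le> 0" .
qed

text \<open>The divisor \<open>D0 M + div h\<close> with \<open>h\<close> the product of the
  \<open>x - \<alpha>\<close>; a list allows repeated roots.\<close>

definition D1 :: "nat \<Rightarrow> 'a list \<Rightarrow> 'a set \<Rightarrow> int"
  where "D1 M \<alpha>s V = D0 M V + (\<Sum>\<alpha>\<leftarrow>\<alpha>s. principal (x - \<alpha>) V)"

lemma D1_props:
  assumes "g \<le> M" "set \<alpha>s \<subseteq> k"
  shows "divisor k E (D1 M \<alpha>s) \<and> dvdeg (D1 M \<alpha>s) \<le> 2 * int M \<and>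
    Amb.dimension (2 * M + 1 - g) k (L (D1 M \<alpha>s))"
  using assms(2)
proof (induction \<alpha>s)
  case Nil
  have "D1 M [] = D0 M" by (auto simp: D1_def)
  moreover have "M + 1 + (M - g) = 2 * M + 1 - g" using assms(1) by simp
  then have "Amb.dimension (2 * M + 1 - g) k (L (D0 M))"
    using L_D0[OF assms(1)] dimension_poly_space[of "M + 1" "M - g"] by metis
  ultimately show ?case using divisor_D0 by simp
next
  case (Cons \<alpha> \<alpha>s)
  have eq: "D1 M (\<alpha> # \<alpha>s) = (\<lambda>V. D1 M \<alpha>s V + principal (x - \<alpha>) V)" by (auto simp: D1_def)
  have \<alpha>: "\<alpha> \<in> k" using Cons.prems by auto
  show ?case unfolding eq
    using Cons divisor_principal[OF \<alpha>] deg_add[of "D1 M \<alpha>s" "principal (x - \<alpha>)"]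
      dimension_L_principal[OF x_minus_E[OF \<alpha>] x_minus_nz[OF \<alpha>]] by auto
qed

text \<open>At each place of \<open>S\<close> some \<open>x - \<alpha>\<close> has a zero; repeating
  \<alpha> often enough reaches the bound there, and no entry contributes negatively at another
  finite place.\<close>

lemma finite_places_bound:
  assumes "finite S" "\<And>V. V \<in> S \<Longrightarrow> valuation_ring k E V \<and> x \<in> V"
  shows "\<exists>\<alpha>s. set \<alpha>s \<subseteq> k \<and> (\<forall>V\<in>S. (\<Sum>\<alpha>\<leftarrow>\<alpha>s. principal (x - \<alpha>) V) \<ge> D V)"
  using assms
proof (induction S rule: finite_induct)
  case empty
  then show ?case by (intro exI[of _ "[]"]) auto
next
  case (insert V S)
  then obtain \<alpha>s where \<alpha>s: "set \<alpha>s \<subseteq> k" "\<And>V. V \<in> S \<Longrightarrow> (\<Sum>\<alpha>\<leftarrow>\<alpha>s. principal (x - \<alpha>) V) \<ge> D V" by auto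
  have V: "valuation_ring k E V" "x \<in> V" using insert.prems by auto
  obtain \<alpha> where \<alpha>: "\<alpha> \<in> k" "inverse (x - \<alpha>) \<notin> V" using place_cases[OF V(1)] V(2) by blast
  \<comment> \<open>\<open>nat\<close> makes a negative \<open>D V\<close> ask for no
    copies.\<close>
  define \<alpha>s' where "\<alpha>s' = replicate (nat (D V)) \<alpha> @ \<alpha>s"
  have sum: "(\<Sum>\<alpha>\<leftarrow>\<alpha>s'. principal (x - \<alpha>) W) =
    int (nat (D V)) * principal (x - \<alpha>) W + (\<Sum>\<alpha>\<leftarrow>\<alpha>s. principal (x - \<alpha>) W)" for W
    by (simp add: \<alpha>s'_def sum_list_replicate)
  have nonneg: "(\<Sum>\<alpha>\<leftarrow>\<alpha>s. principal (x - \<alpha>) W) \<ge> 0" if "W \<in> insert V S" for W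
    using insert.prems[OF that] \<alpha>s(1) principal_finite_place(1) by (intro sum_list_nonneg) auto
  have "(\<Sum>\<alpha>\<leftarrow>\<alpha>s'. principal (x - \<alpha>) W) \<ge> D W" if W: "W \<in> insert V S" for W
  proof (cases "W = V")
    case True
    have "principal (x - \<alpha>) V \<ge> 1" using principal_finite_place(2)[OF V \<alpha>] .
    then have "int (nat (D V)) * 1 \<le> int (nat (D V)) * principal (x - \<alpha>) V"
      by (intro mult_left_mono) auto
    then show ?thesis unfolding sum using nonneg[of V] True by auto
  next
    case False
    have "principal (x - \<alpha>) W \<ge> 0" using insert.prems[OF W] principal_finite_place(1) \<alpha> by auto
    then show ?thesis unfolding sum using \<alpha>s(2)[of W] False W
      by (auto intro!: add_increasing mult_nonneg_nonneg)
  qed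
  moreover have "set \<alpha>s' \<subseteq> k" using \<alpha> \<alpha>s by (auto simp: \<alpha>s'_def)
  ultimately show ?case by blast
qed

theorem genus: "has_genus k E g"
proof (rule has_genusI)
  fix D assume D: "divisor k E D"
  define S where "S = {V. D V \<noteq> 0 \<and> V \<noteq> Vinf}"
  have S: "valuation_ring k E V \<and> x \<in> V" if "V \<in> S" for V
    using D that place_cases[of V] by (auto simp: divisor_def S_def)
  have "finite S" using D by (auto simp: divisor_def S_def intro: finite_subset[of _ "{V. D V \<noteq> 0}"])
  then obtain \<alpha>s where \<alpha>s: "set \<alpha>s \<subseteq> k" "\<And>V. V \<in> S \<Longrightarrow> (\<Sum>\<alpha>\<leftarrow>\<alpha>s. principal (x - \<alpha>) V) \<ge> D V"
    using finite_places_bound[of S D] S by blast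
  \<comment> \<open>At infinity the functions \<open>x - \<alpha>\<close> contribute
    \<open>- 2 * length \<alpha>s\<close>, which the summand \<open>length \<alpha>s\<close> of
    \<open>M\<close> cancels; what remains of \<open>2 * M\<close> is at least
    \<open>D Vinf\<close>. The summand \<open>g\<close> provides \<open>g \<le> M\<close>.\<close>
  define M where "M = g + length \<alpha>s + nat (D Vinf)"
  have inf: "(\<Sum>\<alpha>\<leftarrow>\<alpha>s. principal (x - \<alpha>) Vinf) = - 2 * int (length \<alpha>s)"
    using \<alpha>s(1) by (induction \<alpha>s) (auto simp: principal_Vinf)
  have "D V \<le> D1 M \<alpha>s V" for V
  proof (cases "valuation_ring k E V")
    case False
    then have "D V = 0" "V \<noteq> Vinf" "principal (x - \<alpha>) V = 0" for \<alpha>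
      using D Vinf.val by (auto simp: divisor_def principal_def)
    then show ?thesis by (simp add: D1_def D0_def)
  next
    case True
    consider "V = Vinf" | "V \<in> S" | "V \<noteq> Vinf" "D V = 0" by (auto simp: S_def)
    then show ?thesis
    proof cases
      case 1
      then show ?thesis by (simp add: D1_def D0_def inf M_def)
    next
      case 2
      then show ?thesis using \<alpha>s(2) by (auto simp: D1_def D0_def S_def)
    next
      case 3
      then have "x \<in> V" using place_cases[OF True] by auto
      then have "(\<Sum>\<alpha>\<leftarrow>\<alpha>s. principal (x - \<alpha>) V) \<ge> 0"
        using True \<alpha>s(1) principal_finite_place(1) by (intro sum_list_nonneg) auto
      then show ?thesis using 3 by (simp add: D1_def D0_def)
    qed
  qed
  moreover have "g \<le> M" by (simp add: M_def)
  moreover have "2 * int M - int (2 * M + 1 - g) + 1 \<le> int g" by (simp add: M_def)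
  ultimately show "\<exists>D' n. divisor k E D' \<and> (\<forall>V. D V \<le> D' V) \<and>
      Amb.dimension n k (L D') \<and> dvdeg D' - int n + 1 \<le> int g"
    using D1_props[OF _ \<alpha>s(1), of M] by (intro exI[of _ "D1 M \<alpha>s"] exI[of _ "2 * M + 1 - g"]) auto
next
  show "divisor k E (D0 g)" by (rule divisor_D0)
  show "Amb.dimension (g + 1) k (L (D0 g))" using L_D0[of g] dimension_poly_space[of "g + 1" 0] by simp
  show "dvdeg (D0 g) - int (g + 1) + 1 = int g" by (simp add: divisor_D0)
qed

end

section \<open>Elliptic subfields of degree 3\<close>

locale alg_closed_char_0 = alg_closed_base_field k for k :: "'a::field_char_0 set"
begin

lemma even_curve_genus:
  assumes S: "finite S" "S \<subseteq> k" "card S = 2 * g + 2"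
    and c: "c \<in> k" "c \<noteq> 0" and x: "transc k x"
    and y: "y ^ 2 = c * (\<Prod>e\<in>S. x - e)"
  shows "y \<notin> adjoin k {x}" "has_genus k (adjoin k {x, y}) g"
proof -
  have "S \<noteq> {}" using S by auto
  then obtain s where s: "s \<in> S" by auto
  then have sk: "s \<in> k" using S by auto
  have "x \<notin> k"
  proof
    assume "x \<in> k"
    then show False using x[unfolded transc_def, rule_format, of "[:- x, 1:]"] by auto
  qed
  then have xs: "x - s \<noteq> 0" using sk by auto
  define x' where "x' = inverse (x - s)"
  define y' where "y' = y * x' ^ (g + 1)"
  define R where "R = (\<lambda>e. inverse (e - s)) ` (S - {s})"
  define c' where "c' = c * (\<Prod>e\<in>S - {s}. s - e)"
  have inj: "inj_on (\<lambda>e. inverse (e - s)) (S - {s})" by (auto simp: inj_on_def)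
  \<comment> \<open>\<open>(x - e) x' = 1 + (s - e) x'\<close> is linear in \<open>x'\<close> with
    root \<open>1 / (e - s)\<close>: each other branch point \<open>e\<close> moves there while
    \<open>s\<close> goes to infinity. The leading coefficients \<open>s - e\<close> are collected
    in \<open>c'\<close>.\<close>
  have "(\<Prod>e\<in>S - {s}. (x - e) * x') = (\<Prod>e\<in>S - {s}. (s - e) * (x' - inverse (e - s)))"
  proof (rule prod.cong)
    fix e assume "e \<in> S - {s}"
    then have "e - s \<noteq> 0" by auto
    then have "(s - e) * (x' - inverse (e - s)) = (s - e) * x' + 1" by (simp add: field_simps)
    also have "\<dots> = (x - e) * x'" using xs by (simp add: x'_def field_simps)
    finally show "(x - e) * x' = (s - e) * (x' - inverse (e - s))" by simp
  qed simp
  also have "\<dots> = (\<Prod>e\<in>S - {s}. s - e) * (\<Prod>e\<in>R. x' - e)"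
    unfolding R_def by (simp add: prod.distrib prod.reindex[OF inj])
  finally have prod: "(\<Prod>e\<in>S - {s}. (x - e) * x') = (\<Prod>e\<in>S - {s}. s - e) * (\<Prod>e\<in>R. x' - e)" .
  have "(\<Prod>e\<in>S. x - e) * x' ^ (2 * g + 2) = (\<Prod>e\<in>S. (x - e) * x')"
    using S by (simp add: prod.distrib)
  also have "\<dots> = (x - s) * x' * (\<Prod>e\<in>S - {s}. (x - e) * x')"
    using prod.remove[OF S(1) s, of "\<lambda>e. (x - e) * x'"] by simp
  also have "\<dots> = (\<Prod>e\<in>S - {s}. s - e) * (\<Prod>e\<in>R. x' - e)"
    unfolding prod using xs by (simp add: x'_def)
  finally have "(\<Prod>e\<in>S. x - e) * x' ^ (2 * g + 2) = (\<Prod>e\<in>S - {s}. s - e) * (\<Prod>e\<in>R. x' - e)" .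
  moreover have "y' ^ 2 = y ^ 2 * x' ^ (2 * g + 2)"
    by (simp add: y'_def power_mult_distrib flip: power_mult) (simp add: mult.commute power2_eq_square)
  ultimately have y'_sq: "y' ^ 2 = c' * (\<Prod>e\<in>R. x' - e)"
    by (simp add: y c'_def mult.assoc)
  have "x' \<notin> k"
  proof
    assume "x' \<in> k"
    then have "inverse x' + s \<in> k" using sk by auto
    then show False using \<open>x \<notin> k\<close> by (simp add: x'_def)
  qed
  interpret C: odd_curve k x' y' c' R g
  proof unfold_locales
    show "finite R" "R \<subseteq> k" using S sk by (auto simp: R_def subset_iff)
    show "card R = 2 * g + 1" unfolding R_def card_image[OF inj] using S s by simp
    show "c' \<in> k" using c sk S by (auto simp: c'_def intro!: closed(4) prod_closed closed(6))
    show "c' \<noteq> 0" using c S by (auto simp: c'_def)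
    show "transc k x'" using \<open>x' \<notin> k\<close> by (rule transcI)
    show "y' ^ 2 = c' * (\<Prod>e\<in>R. x' - e)" by (rule y'_sq)
  qed
  have x'_nz: "x' \<noteq> 0" using xs by (simp add: x'_def)
  have x_eq: "x = inverse x' + s" by (simp add: x'_def)
  have y_eq: "y = y' * inverse x' ^ (g + 1)"
  proof -
    have "x' ^ N * inverse x' ^ N = 1" for N using x'_nz by (simp add: power_inverse)
    then have "y * (x' ^ (g + 1) * inverse x' ^ (g + 1)) = y" by (simp only: mult_1_right)
    then show ?thesis by (simp only: y'_def mult.assoc)
  qed
  have adj: "adjoin k {x'} = adjoin k {x}"
  proof (rule adjoin_eqI)
    show "{x'} \<subseteq> adjoin k {x}" unfolding x'_def
      using adjoin_incl(2)[of "{x}" k] adjoin_incl(1)[of k "{x}"] sk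
      by (auto intro!: subfieldD[OF subfield_adjoin[of k "{x}"]])
    have "inverse x' + s \<in> adjoin k {x'}"
      using adjoin_incl(2)[of "{x'}" k] adjoin_incl(1)[of k "{x'}"] sk
      by (auto intro!: subfieldD[OF subfield_adjoin[of k "{x'}"]])
    then show "{x} \<subseteq> adjoin k {x'}" using x_eq by simp
  qed
  show "y \<notin> adjoin k {x}"
  proof
    note F = subfieldD[OF subfield_adjoin[of k "{x'}"]]
    assume "y \<in> adjoin k {x}"
    then have "y * x' ^ (g + 1) \<in> adjoin k {x'}"
      unfolding adj[symmetric] using adjoin_incl(2)[of "{x'}" k] by (intro F) auto
    then show False using C.y_notin by (simp add: y'_def)
  qed
  have "adjoin k {x', y'} = adjoin k {x, y}"
  proof (rule adjoin_eqI)
    have x': "x' \<in> adjoin k {x, y}" unfolding x'_def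
      using adjoin_incl(2)[of "{x, y}" k] adjoin_incl(1)[of k "{x, y}"] sk
      by (auto intro!: subfieldD[OF subfield_adjoin[of k "{x, y}"]])
    moreover have "y' \<in> adjoin k {x, y}" unfolding y'_def
      using adjoin_incl(2)[of "{x, y}" k] x' by (intro subfieldD[OF subfield_adjoin]) auto
    ultimately show "{x', y'} \<subseteq> adjoin k {x, y}" by simp
    have "inverse x' + s \<in> adjoin k {x', y'}" "y' * inverse x' ^ (g + 1) \<in> adjoin k {x', y'}"
      using adjoin_incl(2)[of "{x', y'}" k] adjoin_incl(1)[of k "{x', y'}"] sk
      by (auto intro!: subfieldD[OF subfield_adjoin[of k "{x', y'}"]])
    then show "{x, y} \<subseteq> adjoin k {x', y'}"
      unfolding x_eq[symmetric] y_eq[symmetric] by simp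
  qed
  then show "has_genus k (adjoin k {x, y}) g" using C.genus by simp
qed

text \<open>The expression in \<open>disc\<close> is the discriminant, \<open>c3^4\<close> times the
  squared product of the root differences.\<close>

lemma cubic_split:
  assumes c: "c0 \<in> k" "c1 \<in> k" "c2 \<in> k" "c3 \<in> k" "c3 \<noteq> 0"
    and disc: "18*c0*c1*c2*c3 - 4*c2^3*c0 + c2^2*c1^2 - 4*c3*c1^3 - 27*c3^2*c0^2 \<noteq> 0"
  obtains R where "finite R" "R \<subseteq> k" "card R = 3"
    "\<And>z. c0 + c1 * z + c2 * z^2 + c3 * z^3 = c3 * (\<Prod>e\<in>R. z - e)"
proof -
  define p where "p = [:c0, c1, c2, c3:]"
  have p: "p \<in> polys k" "p \<noteq> 0" "Polynomial.degree p = 3" "Polynomial.lead_coeff p = c3"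
    using c by (simp_all add: p_def numeral_3_eq_3)
  have "Polynomial.coeff p 3 = c3" using p(3,4) by simp
  with split_linear[OF p(1,2), unfolded p(3)] obtain cs where
    cs: "set cs \<subseteq> k \<and> length cs = 3 \<and> p = Polynomial.smult c3 (\<Prod>c\<leftarrow>cs. [:- c, 1:])" by auto
  then obtain u v w where uvw: "cs = [u, v, w]" by (auto simp: numeral_3_eq_3 length_Suc_conv)
  have p_eq: "p = Polynomial.smult c3 ([:- u, 1:] * ([:- v, 1:] * [:- w, 1:]))" using cs uvw by simp
  then have *: "c0 = - c3 * (u * v * w)" "c1 = c3 * (u * v + u * w + v * w)" "c2 = - c3 * (u + v + w)"
    by (simp_all add: p_def algebra_simps)
  have "18*c0*c1*c2*c3 - 4*c2^3*c0 + c2^2*c1^2 - 4*c3*c1^3 - 27*c3^2*c0^2 =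
    c3^4 * ((u - v) * (u - w) * (v - w))^2" unfolding * by Groebner_Basis.algebra
  then have ne: "u \<noteq> v" "u \<noteq> w" "v \<noteq> w" using disc by auto
  show ?thesis
  proof (rule that[of "{u, v, w}"])
    show "c0 + c1 * z + c2 * z^2 + c3 * z^3 = c3 * (\<Prod>e\<in>{u, v, w}. z - e)" for z
    proof -
      have "c0 + c1 * z + c2 * z^2 + c3 * z^3 = c3 * ((z - u) * ((z - v) * (z - w)))"
        unfolding * by Groebner_Basis.algebra
      then show ?thesis using ne by (simp add: mult_ac)
    qed
  qed (use ne cs uvw in auto)
qed

text \<open>Euclid's lemma, with coprimality expressed as absence of common roots in
  \<open>k\<close>: a root of \<open>N\<close> is a root of \<open>d ^ m * Q\<close> but not of
  \<open>d\<close>, so it is one of \<open>Q\<close>, and the linear factor cancels.\<close>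

lemma no_common_root_dvd:
  assumes "N \<in> polys k" "N \<noteq> 0" "d \<in> polys k" "h \<in> polys k" "Q \<in> polys k"
    and "\<And>\<alpha>. \<alpha> \<in> k \<Longrightarrow> poly N \<alpha> = 0 \<Longrightarrow> poly d \<alpha> \<noteq> 0" "N * h = d ^ m * Q"
  shows "N dvd Q"
  using assms
proof (induction "Polynomial.degree N" arbitrary: N Q)
  case 0
  then obtain u where u: "N = [:u:]" using degree_eq_zeroE by metis
  then have "u \<noteq> 0" using 0 by auto
  then have "Q = N * Polynomial.smult (inverse u) Q" using u by simp
  then show ?case by (rule dvdI)
next
  case (Suc n)
  obtain \<alpha> where \<alpha>: "\<alpha> \<in> k" "poly N \<alpha> = 0" using root_exists[of N] Suc by auto
  obtain N1 where N1: "N1 \<in> polys k" "N = [:- \<alpha>, 1:] * N1" using polys_root_factor[OF Suc.prems(1) \<alpha>] .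
  have "poly (d ^ m * Q) \<alpha> = 0" using Suc.prems(7) \<alpha>(2) by (simp flip: Suc.prems(7))
  then have "poly Q \<alpha> = 0" using Suc.prems(6)[OF \<alpha>] by simp
  then obtain Q1 where Q1: "Q1 \<in> polys k" "Q = [:- \<alpha>, 1:] * Q1" using polys_root_factor[OF Suc.prems(5) \<alpha>(1)] by blast
  have "N1 \<noteq> 0" using N1 Suc.prems by auto
  then have "Polynomial.degree N = Suc (Polynomial.degree N1)" unfolding N1(2) by (subst degree_mult_eq) auto
  moreover have "poly d \<beta> \<noteq> 0" if "\<beta> \<in> k" "poly N1 \<beta> = 0" for \<beta>
    using Suc.prems(6)[OF that(1)] that N1(2) by simp
  moreover have "[:- \<alpha>, 1:] * (N1 * h) = [:- \<alpha>, 1:] * (d ^ m * Q1)"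
    using Suc.prems(7) unfolding N1(2) Q1(2) by (simp only: mult_ac)
  then have "N1 * h = d ^ m * Q1" by (simp only: mult_cancel_left) auto
  ultimately have "N1 dvd Q1"
    using Suc.hyps(1)[of N1 Q1] Suc.hyps(2) N1(1) Q1(1) Suc.prems(3,4) \<open>N1 \<noteq> 0\<close> by auto
  then show ?case unfolding N1(2) Q1(2) by (rule mult_dvd_mono[OF dvd_refl])
qed

lemma fraction_clear_denominators:
  assumes "p \<in> polys k" "Polynomial.degree p \<le> m" "N \<in> polys k" "d \<in> polys k" "poly d x \<noteq> 0"
  shows "\<exists>r\<in>polys k. poly d x ^ m * poly p (poly N x / poly d x) = poly r x"
  using assms(1,2)
proof (induction p arbitrary: m)
  case 0
  then show ?case by (intro bexI[of _ 0]) auto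
next
  case (pCons a q)
  show ?case
  proof (cases "q = 0")
    case True
    then show ?thesis using pCons assms by (intro bexI[of _ "Polynomial.smult a (d ^ m)"]) auto
  next
    case False
    then obtain m' where m: "m = Suc m'" "Polynomial.degree q \<le> m'" using pCons.prems by (cases m) auto
    obtain r where r: "r \<in> polys k" "poly d x ^ m' * poly q (poly N x / poly d x) = poly r x"
      using pCons.IH[of m'] pCons.prems m by auto
    have "poly d x ^ m * poly (pCons a q) (poly N x / poly d x) =
      a * poly d x ^ m + poly N x * (poly d x ^ m' * poly q (poly N x / poly d x))"
      using assms(5) by (simp add: m(1) algebra_simps)
    also have "\<dots> = poly (Polynomial.smult a (d ^ m) + N * r) x" by (simp add: r(2))
    finally show ?thesis
      using pCons.prems assms r(1) by (intro bexI[of _ "Polynomial.smult a (d ^ m) + N * r"]) auto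
  qed
qed

text \<open>Write \<open>p_i = a_i + T q_i\<close>. Multiplying the relation by a power of
  \<open>d(x)\<close> gives \<open>N h = d^(m+1) Q\<close> with
  \<open>Q = a0 + a1 X + a2 X^2\<close>. As \<open>N\<close> is coprime to \<open>d\<close>, it
  divides \<open>Q\<close>, whose degree is below 3. So \<open>Q = 0\<close>, a factor
  \<open>U\<close> can be cancelled, and the \<open>q_i\<close> satisfy the same relation in smaller
  degree.\<close>

lemma cubic_fraction_independent_polys:
  assumes x: "transc k x" and N: "N \<in> polys k" "Polynomial.degree N = 3" and d: "d \<in> polys k" "d \<noteq> 0"
    and cop: "\<And>\<alpha>. \<alpha> \<in> k \<Longrightarrow> poly N \<alpha> = 0 \<Longrightarrow> poly d \<alpha> \<noteq> 0"
    and U: "U = poly N x / poly d x"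
    and p: "p0 \<in> polys k" "p1 \<in> polys k" "p2 \<in> polys k"
    and rel: "poly p0 U + poly p1 U * x + poly p2 U * x ^ 2 = 0"
  shows "p0 = 0 \<and> p1 = 0 \<and> p2 = 0"
  using p rel
proof (induction "Polynomial.degree p0 + Polynomial.degree p1 + Polynomial.degree p2"
    arbitrary: p0 p1 p2 rule: less_induct)
  case less
  have nz: "poly r x \<noteq> 0" if "r \<in> polys k" "r \<noteq> 0" for r using x that by (auto simp: transc_def)
  have N0: "N \<noteq> 0" using N by auto
  have U0: "U \<noteq> 0" using nz[OF N(1) N0] nz[OF d] by (simp add: U)
  have dx: "poly d x \<noteq> 0" by (rule nz[OF d])
  obtain a0 q0 where q0: "p0 = pCons a0 q0" by (cases p0)
  obtain a1 q1 where q1: "p1 = pCons a1 q1" by (cases p1)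
  obtain a2 q2 where q2: "p2 = pCons a2 q2" by (cases p2)
  have qk: "a0 \<in> k" "q0 \<in> polys k" "a1 \<in> k" "q1 \<in> polys k" "a2 \<in> k" "q2 \<in> polys k"
    using less.prems q0 q1 q2 by auto
  \<comment> \<open>A common bound on the three degrees, so that one power of \<open>d\<close>
    clears all denominators.\<close>
  define m where "m = Polynomial.degree q0 + Polynomial.degree q1 + Polynomial.degree q2"
  have clear: "\<exists>r\<in>polys k. poly d x ^ m * poly q U = poly r x"
    if "q \<in> polys k" "Polynomial.degree q \<le> m" for q
    unfolding U using fraction_clear_denominators[OF that N(1) d(1) dx] .
  obtain r0 where r0: "r0 \<in> polys k" "poly d x ^ m * poly q0 U = poly r0 x" using clear[of q0] qk by (auto simp: m_def)
  obtain r1 where r1: "r1 \<in> polys k" "poly d x ^ m * poly q1 U = poly r1 x" using clear[of q1] qk by (auto simp: m_def)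
  obtain r2 where r2: "r2 \<in> polys k" "poly d x ^ m * poly q2 U = poly r2 x" using clear[of q2] qk by (auto simp: m_def)
  have dU: "poly d x * U = poly N x" using dx by (simp add: U)
  define Q where "Q = [:a0, a1, a2:]"
  define h where "h = - (r0 + r1 * [:0, 1:] + r2 * [:0, 1:] ^ 2)"
  have "0 = poly d x ^ Suc m * (poly p0 U + poly p1 U * x + poly p2 U * x ^ 2)" using less.prems by simp
  also have "\<dots> = poly d x ^ Suc m * poly Q x + poly d x * U *
      (poly d x ^ m * poly q0 U + poly d x ^ m * poly q1 U * x + poly d x ^ m * poly q2 U * x ^ 2)"
    by (simp add: q0 q1 q2 Q_def algebra_simps power2_eq_square)
  also have "\<dots> = poly (d ^ Suc m * Q - N * h) x"
    unfolding r0(2) r1(2) r2(2) dU by (simp add: h_def algebra_simps power2_eq_square)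
  finally have "poly (d ^ Suc m * Q - N * h) x = 0" by simp
  moreover have h: "h \<in> polys k" and Q: "Q \<in> polys k"
    unfolding h_def Q_def using r0(1) r1(1) r2(1) qk
    by (intro polys_uminus polys_add polys_mult polys_power; simp)+ (simp add: qk)
  moreover have "d ^ Suc m * Q - N * h \<in> polys k"
    using h Q N d by (intro polys_diff polys_mult polys_power)
  ultimately have "N * h = d ^ Suc m * Q"
    using nz[of "d ^ Suc m * Q - N * h"] by (metis eq_iff_diff_eq_0)
  then have "N dvd Q" using no_common_root_dvd[OF N(1) N0 d(1) h Q cop] by blast
  moreover have "Polynomial.degree Q < 3" by (simp add: Q_def)
  ultimately have "Q = 0" using N(2) dvd_imp_degree_le by force
  then have a: "a0 = 0" "a1 = 0" "a2 = 0" by (simp_all add: Q_def)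
  have "U * (poly q0 U + poly q1 U * x + poly q2 U * x ^ 2) = 0"
    using less.prems(4) by (simp add: q0 q1 q2 a algebra_simps)
  then have rel': "poly q0 U + poly q1 U * x + poly q2 U * x ^ 2 = 0" using U0 by simp
  have deg: "Polynomial.degree (pCons 0 q) = (if q = 0 then 0 else Suc (Polynomial.degree q))" for q :: "'a poly"
    by simp
  show ?case
  proof (rule ccontr)
    assume "\<not> ?case"
    then have "q0 \<noteq> 0 \<or> q1 \<noteq> 0 \<or> q2 \<noteq> 0" by (auto simp: q0 q1 q2 a)
    then have "Polynomial.degree q0 + Polynomial.degree q1 + Polynomial.degree q2 <
      Polynomial.degree p0 + Polynomial.degree p1 + Polynomial.degree p2"
      unfolding q0 q1 q2 a deg by auto
    then have "q0 = 0 \<and> q1 = 0 \<and> q2 = 0" using less.hyps qk rel' by blast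
    with \<open>q0 \<noteq> 0 \<or> q1 \<noteq> 0 \<or> q2 \<noteq> 0\<close> show False by simp
  qed
qed

lemma cubic_fraction_independent:
  assumes x: "transc k x" and n: "n \<in> polys k" "Polynomial.degree n \<le> 3"
    and d: "d \<in> polys k" "Polynomial.degree d \<le> 3" "d \<noteq> 0"
    and deg: "Polynomial.degree n = 3 \<or> Polynomial.degree d = 3"
    and cop: "\<And>\<alpha>. \<alpha> \<in> k \<Longrightarrow> poly n \<alpha> = 0 \<Longrightarrow> poly d \<alpha> \<noteq> 0"
    and U: "U = poly n x / poly d x"
    and a: "a0 \<in> adjoin k {U}" "a1 \<in> adjoin k {U}" "a2 \<in> adjoin k {U}"
    and rel: "a0 + a1 * x + a2 * x ^ 2 = 0"
  shows "a0 = 0 \<and> a1 = 0 \<and> a2 = 0"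
proof -
  have dx: "poly d x \<noteq> 0" using x d by (auto simp: transc_def)
  \<comment> \<open>replacing \<open>U\<close> by \<open>U + 1\<close> if necessary gives the numerator degree 3\<close>
  define e :: 'a where "e = (if Polynomial.degree n = 3 then 0 else 1)"
  have e: "e \<in> k" by (simp add: e_def)
  define N where "N = n + Polynomial.smult e d"
  have N: "N \<in> polys k" "Polynomial.degree N = 3"
  proof -
    show "N \<in> polys k" using n d e by (auto simp: N_def)
    show "Polynomial.degree N = 3"
      using deg n(2) by (auto simp: N_def e_def degree_add_eq_right)
  qed
  have copN: "poly d \<alpha> \<noteq> 0" if "\<alpha> \<in> k" "poly N \<alpha> = 0" for \<alpha>
    using cop[OF that(1)] that(2) by (auto simp: N_def)
  define U' where "U' = poly N x / poly d x"
  have U': "U' = U + e" using dx by (simp add: U'_def U N_def add_divide_distrib)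
  have "adjoin k {U} = adjoin k {U'}"
  proof (rule adjoin_eqI)
    have "U' - e \<in> adjoin k {U'}"
      using adjoin_incl(2)[of "{U'}" k] adjoin_incl(1)[of k "{U'}"] e
      by (intro subfieldD(6)[OF subfield_adjoin]) auto
    then show "{U} \<subseteq> adjoin k {U'}" by (simp add: U')
    show "{U'} \<subseteq> adjoin k {U}" unfolding U'
      using adjoin_incl(2)[of "{U}" k] adjoin_incl(1)[of k "{U}"] e
      by (auto intro!: subfieldD(3)[OF subfield_adjoin[of k "{U}"]])
  qed
  with a have a': "a0 \<in> adjoin k {U'}" "a1 \<in> adjoin k {U'}" "a2 \<in> adjoin k {U'}" by auto
  obtain p0 q0 where 0: "p0 \<in> polys k" "q0 \<in> polys k" "poly q0 U' \<noteq> 0" "a0 = poly p0 U' / poly q0 U'"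
    using a'(1) by (rule adjoinE)
  obtain p1 q1 where 1: "p1 \<in> polys k" "q1 \<in> polys k" "poly q1 U' \<noteq> 0" "a1 = poly p1 U' / poly q1 U'"
    using a'(2) by (rule adjoinE)
  obtain p2 q2 where 2: "p2 \<in> polys k" "q2 \<in> polys k" "poly q2 U' \<noteq> 0" "a2 = poly p2 U' / poly q2 U'"
    using a'(3) by (rule adjoinE)
  have "poly (p0 * q1 * q2) U' + poly (p1 * q0 * q2) U' * x + poly (p2 * q0 * q1) U' * x ^ 2 =
    poly q0 U' * poly q1 U' * poly q2 U' * (a0 + a1 * x + a2 * x ^ 2)"
    unfolding 0(4) 1(4) 2(4) using 0(3) 1(3) 2(3) by (simp add: field_simps)
  also have "\<dots> = 0" using rel by simp
  finally have "p0 * q1 * q2 = 0 \<and> p1 * q0 * q2 = 0 \<and> p2 * q0 * q1 = 0"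
    using 0 1 2 by (intro cubic_fraction_independent_polys[OF x N d(1,3) copN U'_def]) auto
  moreover have "q0 \<noteq> 0" "q1 \<noteq> 0" "q2 \<noteq> 0" using 0 1 2 by auto
  ultimately show ?thesis using 0 1 2 by simp
qed

text \<open>Since \<open>x^3\<close> reduces, the span \<open>M\<close> of \<open>1, x, x^2\<close>
  is closed under multiplication by \<open>x\<close> and equals the ring \<open>E[x]\<close>. It has
  finite dimension, so \<open>x\<close> is algebraic and \<open>E[x]\<close> is a field; by
  \<open>gen\<close> it contains \<open>K\<close>.\<close>

lemma cubic_extension_dimension:
  assumes E: "subfield E Amb" and K: "subfield K Amb" "E \<subseteq> K" "x \<in> K"
    and indep: "\<And>e0 e1 e2. e0 \<in> E \<Longrightarrow> e1 \<in> E \<Longrightarrow> e2 \<in> E \<Longrightarrow> e0 + e1 * x + e2 * x ^ 2 = 0 \<Longrightarrow>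
      e0 = 0 \<and> e1 = 0 \<and> e2 = 0"
    and cube: "d0 \<in> E" "d1 \<in> E" "d2 \<in> E" "x ^ 3 = d0 + d1 * x + d2 * x ^ 2"
    and gen: "\<And>F. subfield F Amb \<Longrightarrow> E \<subseteq> F \<Longrightarrow> x \<in> F \<Longrightarrow> K \<subseteq> F"
  shows "Amb.dimension 3 E K"
proof -
  interpret E: base_field E by (rule base_field.intro[OF E])
  define M where "M = {e0 + e1 * x + e2 * x ^ 2 | e0 e1 e2. e0 \<in> E \<and> e1 \<in> E \<and> e2 \<in> E}"
  have MI: "e0 + e1 * x + e2 * x ^ 2 \<in> M" if "e0 \<in> E" "e1 \<in> E" "e2 \<in> E" for e0 e1 e2
    using that unfolding M_def by blast
  have "Amb.dimension (Suc 1) E {c * x + s | c s. c \<in> E \<and> s \<in> E}"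
  proof (rule E.dimension_Suc[OF Amb.dimension_one[OF E]])
    show "x \<notin> E" using indep[of "- x" 1 0] by auto
  qed
  moreover have "x ^ 2 \<notin> {c * x + s | c s. c \<in> E \<and> s \<in> E}"
  proof
    assume "x ^ 2 \<in> {c * x + s | c s. c \<in> E \<and> s \<in> E}"
    then obtain c s where "c \<in> E" "s \<in> E" "x ^ 2 = c * x + s" by blast
    then show False using indep[of "- s" "- c" 1] by auto
  qed
  ultimately have "Amb.dimension (Suc (Suc 1)) E {e * x ^ 2 + s | e s. e \<in> E \<and> s \<in> {c * x + s | c s. c \<in> E \<and> s \<in> E}}"
    by (rule E.dimension_Suc)
  also have "{e * x ^ 2 + s | e s. e \<in> E \<and> s \<in> {c * x + s | c s. c \<in> E \<and> s \<in> E}} = M"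
  proof (intro equalityI subsetI)
    fix z assume "z \<in> {e * x ^ 2 + s | e s. e \<in> E \<and> s \<in> {c * x + s | c s. c \<in> E \<and> s \<in> E}}"
    then obtain e c s where "z = e * x ^ 2 + (c * x + s)" "e \<in> E" "c \<in> E" "s \<in> E" by blast
    then show "z \<in> M" using MI[of s c e] by (simp add: algebra_simps)
  next
    fix z assume "z \<in> M"
    then obtain e0 e1 e2 where "z = e2 * x ^ 2 + (e1 * x + e0)" "e0 \<in> E" "e1 \<in> E" "e2 \<in> E"
      unfolding M_def by (auto simp: algebra_simps)
    then show "z \<in> {e * x ^ 2 + s | e s. e \<in> E \<and> s \<in> {c * x + s | c s. c \<in> E \<and> s \<in> E}}" by blast
  qed
  finally have dim: "Amb.dimension 3 E M" by (simp add: numeral_3_eq_3)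
  have lin: "z * x + e \<in> M" if "z \<in> M" "e \<in> E" for z e
  proof -
    obtain e0 e1 e2 where *: "z = e0 + e1 * x + e2 * x ^ 2" "e0 \<in> E" "e1 \<in> E" "e2 \<in> E"
      using \<open>z \<in> M\<close> unfolding M_def by blast
    have "z * x + e = e + e0 * x + e1 * x ^ 2 + e2 * x ^ 3"
      by (simp add: *(1) algebra_simps power2_eq_square power3_eq_cube)
    also have "\<dots> = (e + e2 * d0) + (e0 + e2 * d1) * x + (e1 + e2 * d2) * x ^ 2"
      unfolding cube(4) by (simp add: algebra_simps)
    also have "\<dots> \<in> M" using * cube \<open>e \<in> E\<close> by (intro MI) auto
    finally show ?thesis .
  qed
  have sub: "Amb.simple_extension E x \<subseteq> M"
  proof
    fix z assume "z \<in> Amb.simple_extension E x"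
    then show "z \<in> M"
    proof induction
      case zero
      then show ?case using MI[of 0 0 0] by simp
    next
      case (lin k1 k2)
      then show ?case using \<open>\<And>z e. z \<in> M \<Longrightarrow> e \<in> E \<Longrightarrow> z * x + e \<in> M\<close> by simp
    qed
  qed
  have sr: "subring (Amb.simple_extension E x) Amb"
    by (rule Amb.simple_extension_is_subring) (use subfieldE(1)[OF E] in auto)
  have xS: "x \<in> Amb.simple_extension E x"
    by (rule Amb.simple_extension_mem) (use subfieldE(1)[OF E] in auto)
  have ES: "E \<subseteq> Amb.simple_extension E x"
    by (rule Amb.simple_extension_incl) auto
  have add: "u + v \<in> Amb.simple_extension E x" and mult: "u * v \<in> Amb.simple_extension E x"
    if "u \<in> Amb.simple_extension E x" "v \<in> Amb.simple_extension E x" for u v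
    using subringE(6,7)[OF sr that] by simp_all
  have "M \<subseteq> Amb.simple_extension E x"
    using ES xS add mult by (auto simp: M_def power2_eq_square subset_iff)
  with sub have S: "Amb.simple_extension E x = M" by auto
  have "Amb.algebraic E x"
    using Amb.finite_dimension_imp_algebraic[OF E sr _ xS] Amb.finite_dimensionI[OF dim]
    unfolding S by (simp add: over_def)
  then have "subfield M Amb"
    using Amb.simple_extension_is_subfield[OF E, of x] unfolding S by (simp add: over_def)
  then have "K \<subseteq> M" using ES xS unfolding S by (intro gen)
  moreover have "M \<subseteq> K"
    using K subfieldD[OF K(1)] by (auto simp: M_def subset_iff)
  ultimately show ?thesis using dim by simp
qed

text \<open>Genus 1 is \<open>odd_curve\<close> for \<open>U\<close>, \<open>V\<close> with
  \<open>g = 1\<close>. \<open>deg\<close> admits a numerator of degree below 3, which occurs when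
  \<open>U\<close> has a zero at infinity.\<close>

theorem elliptic_subfield_of_degree_3:
  assumes x: "transc k x" and y: "y \<notin> adjoin k {x}"
    and n: "n \<in> polys k" "Polynomial.degree n \<le> 3"
    and d: "d \<in> polys k" "Polynomial.degree d \<le> 3" "d \<noteq> 0"
    and deg: "Polynomial.degree n = 3 \<or> Polynomial.degree d = 3"
    and cop: "\<And>\<alpha>. \<alpha> \<in> k \<Longrightarrow> poly n \<alpha> = 0 \<Longrightarrow> poly d \<alpha> \<noteq> 0"
    and U: "U = poly n x / poly d x"
    and w: "w \<in> adjoin k {x}" "w \<noteq> 0" and V: "V = y * w"
    and c: "c0 \<in> k" "c1 \<in> k" "c2 \<in> k" "c3 \<in> k" "c3 \<noteq> 0"
    and disc: "18*c0*c1*c2*c3 - 4*c2^3*c0 + c2^2*c1^2 - 4*c3*c1^3 - 27*c3^2*c0^2 \<noteq> 0"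
    and eq: "V ^ 2 = c0 + c1 * U + c2 * U^2 + c3 * U^3"
  shows "elliptic_subfield k (adjoin k {x, y}) 3 (adjoin k {U, V})"
proof -
  define K where "K = adjoin k {x, y}"
  define E where "E = adjoin k {U, V}"
  have dx: "poly d x \<noteq> 0" using x d by (auto simp: transc_def)
  \<comment> \<open>A constant \<open>U\<close> would make \<open>n\<close> a multiple of
    \<open>d\<close>; then \<open>d\<close> has degree 3 and a root, which is common to
    both.\<close>
  have "U \<notin> k"
  proof
    assume Uk: "U \<in> k"
    have "poly (n - Polynomial.smult U d) x = 0" using dx by (simp add: U)
    moreover have "n - Polynomial.smult U d \<in> polys k" using n d Uk by auto
    ultimately have nd: "n = Polynomial.smult U d" using x by (auto simp: transc_def)
    then have "Polynomial.degree d = 3" using deg by (auto split: if_splits)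
    then obtain \<alpha> where "\<alpha> \<in> k" "poly d \<alpha> = 0" using root_exists[of d] d by auto
    then show False using cop[of \<alpha>] nd by simp
  qed
  obtain R where R: "finite R" "R \<subseteq> k" "card R = 3"
    "\<And>z. c0 + c1 * z + c2 * z^2 + c3 * z^3 = c3 * (\<Prod>e\<in>R. z - e)"
    using cubic_split[OF c disc] by blast
  interpret C: odd_curve k U V c3 R 1
    using R c eq transcI[OF \<open>U \<notin> k\<close>] by unfold_locales auto
  have subK: "subfield K Amb" and subE: "subfield E Amb"
    unfolding K_def E_def by (rule subfield_adjoin)+
  have kK: "k \<subseteq> K" and xK: "x \<in> K" and yK: "y \<in> K"
    using adjoin_incl(1)[of k "{x, y}"] adjoin_incl(2)[of "{x, y}" k] by (auto simp: K_def)
  have kE: "k \<subseteq> E" and UE: "U \<in> E" and VE: "V \<in> E"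
    using adjoin_incl(1)[of k "{U, V}"] adjoin_incl(2)[of "{U, V}" k] by (auto simp: E_def)
  have kxK: "adjoin k {x} \<subseteq> K" using kK xK by (intro adjoin_least subK) auto
  have Ux: "U \<in> adjoin k {x}"
    unfolding U using n d by (intro subfieldD(8)[OF subfield_adjoin]) auto
  have kUx: "adjoin k {U} \<subseteq> adjoin k {x}"
    using Ux adjoin_incl(1)[of k "{x}"] by (intro adjoin_least subfield_adjoin) auto
  have "E \<subseteq> K"
    unfolding E_def using kK Ux kxK yK w subfieldD(4)[OF subK] by (intro adjoin_least subK) (auto simp: V)
  have dim: "Amb.dimension 3 E K"
  proof -
    \<comment> \<open>Coefficients of \<open>n - U d\<close>, a cubic polynomial over
      \<open>E\<close> that vanishes at \<open>x\<close>; its leading coefficient is nonzero since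
      \<open>U \<notin> k\<close>.\<close>
    define N0 where "N0 i = Polynomial.coeff n i - U * Polynomial.coeff d i" for i
    have N0E: "N0 i \<in> E" for i
      using kE UE n d by (auto simp: N0_def intro!: subfieldD(4,6)[OF subE])
    have poly3: "poly p x = Polynomial.coeff p 0 + Polynomial.coeff p 1 * x + Polynomial.coeff p 2 * x ^ 2 +
      Polynomial.coeff p 3 * x ^ 3" if "Polynomial.degree p \<le> 3" for p
    proof -
      have "poly p x = (\<Sum>i\<le>3. Polynomial.coeff p i * x ^ i)"
        unfolding poly_altdef using that by (intro sum.mono_neutral_left) (auto simp: coeff_eq_0)
      then show ?thesis by (simp add: numeral_3_eq_3 numeral_2_eq_2)
    qed
    have "poly n x - U * poly d x = 0" using dx by (simp add: U)
    then have rel: "N0 0 + N0 1 * x + N0 2 * x ^ 2 + N0 3 * x ^ 3 = 0"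
      unfolding poly3[OF n(2)] poly3[OF d(2)] by (simp add: N0_def algebra_simps)
    have "N0 3 \<noteq> 0"
    proof
      assume 0: "N0 3 = 0"
      show False
      proof (cases "Polynomial.coeff d 3 = 0")
        case True
        then have "Polynomial.coeff n 3 = 0" using 0 by (simp add: N0_def)
        then show False using True deg n d by (metis leading_coeff_0_iff degree_0 zero_neq_numeral)
      next
        case False
        then have "U = Polynomial.coeff n 3 / Polynomial.coeff d 3" using 0 by (simp add: N0_def field_simps)
        then show False using \<open>U \<notin> k\<close> n d by auto
      qed
    qed
    then have cube: "x ^ 3 = - N0 0 / N0 3 + (- N0 1 / N0 3) * x + (- N0 2 / N0 3) * x ^ 2"
    proof -
      have "N0 3 * x ^ 3 = - N0 0 + - N0 1 * x + - N0 2 * x ^ 2"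
        using rel by (simp add: algebra_simps eq_neg_iff_add_eq_0)
      then have "x ^ 3 = (- N0 0 + - N0 1 * x + - N0 2 * x ^ 2) / N0 3"
        using \<open>N0 3 \<noteq> 0\<close> by (simp add: field_simps)
      then show ?thesis by (simp add: add_divide_distrib diff_divide_distrib)
    qed
    show ?thesis
    proof (rule cubic_extension_dimension[OF subE subK \<open>E \<subseteq> K\<close> xK _ _ _ _ cube])
      show "- N0 0 / N0 3 \<in> E" "- N0 1 / N0 3 \<in> E" "- N0 2 / N0 3 \<in> E"
        using N0E by (auto intro!: subfieldD(5,8)[OF subE])
      fix F assume F: "subfield F Amb" "E \<subseteq> F" "x \<in> F"
      then have "adjoin k {x} \<subseteq> F" using kE by (intro adjoin_least) auto
      then have "V / w \<in> F" using F VE w by (intro subfieldD(8)[OF F(1)]) auto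
      then have "y \<in> F" using w by (simp add: V)
      then show "K \<subseteq> F" unfolding K_def using F kE by (intro adjoin_least) auto
    next
      fix e0 e1 e2 assume e: "e0 \<in> E" "e1 \<in> E" "e2 \<in> E" "e0 + e1 * x + e2 * x ^ 2 = 0"
      obtain a0 b0 where 0: "a0 \<in> adjoin k {U}" "b0 \<in> adjoin k {U}" "e0 = a0 + b0 * V"
        using e(1) unfolding E_def C.field_eq by blast
      obtain a1 b1 where 1: "a1 \<in> adjoin k {U}" "b1 \<in> adjoin k {U}" "e1 = a1 + b1 * V"
        using e(2) unfolding E_def C.field_eq by blast
      obtain a2 b2 where 2: "a2 \<in> adjoin k {U}" "b2 \<in> adjoin k {U}" "e2 = a2 + b2 * V"
        using e(3) unfolding E_def C.field_eq by blast
      \<comment> \<open>With \<open>e_i = a_i + b_i V\<close> the relation becomes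
        \<open>A + B w y = 0\<close>. As \<open>y\<close> is not in \<open>k(x)\<close>, both
        \<open>A\<close> and \<open>B\<close> vanish, and these are relations over
        \<open>k(U)\<close>.\<close>
      define A where "A = a0 + a1 * x + a2 * x ^ 2"
      define B where "B = b0 + b1 * x + b2 * x ^ 2"
      note F = subfieldD[OF subfield_adjoin[of k "{x}"]]
      have "x \<in> adjoin k {x}" using adjoin_incl(2)[of "{x}" k] by auto
      then have AB: "A \<in> adjoin k {x}" "B \<in> adjoin k {x}"
        using 0 1 2 kUx unfolding A_def B_def by (auto intro!: F(3,4,9))
      have "A + (B * w) * y = 0"
        using e(4) unfolding 0(3) 1(3) 2(3) V A_def B_def by (simp add: algebra_simps)
      then have "A = 0 \<and> B * w = 0"
        using AB w by (intro quadratic_extension_unique[OF subfield_adjoin y]) (auto intro: F)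
      then have "A = 0" "B = 0" using w by auto
      then have "a0 = 0 \<and> a1 = 0 \<and> a2 = 0" "b0 = 0 \<and> b1 = 0 \<and> b2 = 0"
        using cubic_fraction_independent[OF x n d deg cop U] 0 1 2 unfolding A_def B_def by blast+
      then show "e0 = 0 \<and> e1 = 0 \<and> e2 = 0" using 0 1 2 by simp
    qed
  qed
  show ?thesis
    unfolding elliptic_subfield_def
    using subE kE \<open>E \<subseteq> K\<close> C.genus dim by (simp add: K_def E_def)
qed

end

section \<open>The genus 2 curve\<close>

text \<open>The list is \<open>T^2 - y^2\<close>, leading coefficient first. Proper factors would be
  linear and give a root in \<open>L\<close>, but the roots are \<open>y\<close> and
  \<open>- y\<close>.\<close>

lemma quadratic_irreducible:
  assumes L: "subfield L Amb" and y: "y ^ 2 \<in> L" "y \<notin> (L :: 'a::field set)"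
  shows "ring_irreducible\<^bsub>(univ_poly Amb L)\<^esub> [1, 0, - (y ^ 2)]"
proof (rule Amb.pirreducibleI[OF subfieldE(1)[OF L]])
  note L' = subfieldD[OF L]
  let ?p = "[1, 0, - (y ^ 2)]"
  show "?p \<in> carrier (univ_poly Amb L)"
    using y L' by (auto simp: carrier_univ_poly_Amb)
  show "?p \<noteq> []" by simp
  show "?p \<notin> Units (univ_poly Amb L)"
    using Amb.univ_poly_units'[OF L] by auto
  fix q r assume q: "q \<in> carrier (univ_poly Amb L)" and r: "r \<in> carrier (univ_poly Amb L)"
    and p: "?p = q \<otimes>\<^bsub>univ_poly Amb L\<^esub> r"
  have p_mult: "?p = Amb.poly_mult q r" using p by (simp add: univ_poly_mult)
  have nonempty: "q \<noteq> []" "r \<noteq> []"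
    using p_mult Amb.poly_mult_zero[of q] Amb.poly_mult_zero[of r] by auto
  show "q \<in> Units (univ_poly Amb L) \<or> r \<in> Units (univ_poly Amb L)"
  proof (rule ccontr)
    assume *: "\<not> ?thesis"
    then have "length q - 1 \<noteq> 0" "length r - 1 \<noteq> 0"
      using Amb.univ_poly_units'[OF L] q r nonempty by auto
    moreover have "length ?p - 1 = (length q - 1) + (length r - 1)"
      unfolding p_mult using nonempty q r Amb.poly_mult_degree_eq[OF subfieldE(1)[OF L], of q r]
      by (simp add: univ_poly_carrier)
    ultimately have "length q = 2" by simp
    then obtain u v where uv: "q = [u, v]" by (auto simp: numeral_2_eq_2 length_Suc_conv)
    then have "u \<in> L" "v \<in> L" "u \<noteq> 0" using q by (auto simp: carrier_univ_poly_Amb)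
    define z where "z = - v / u"
    have z: "z \<in> L" using L' \<open>u \<in> L\<close> \<open>v \<in> L\<close> by (simp add: z_def)
    have "Amb.eval q z = 0" using \<open>u \<noteq> 0\<close> by (simp add: uv eval_Amb z_def)
    then have "Amb.eval ?p z = 0"
      unfolding p_mult using Amb.eval_poly_mult[of q r z] by simp
    then have "z ^ 2 = y ^ 2" by (simp add: eval_Amb power2_eq_square)
    then have "y = z \<or> y = - z" by (auto simp: power2_eq_iff)
    then show False using y z L' by auto
  qed
qed

text \<open>For \<open>V = y H / d^2\<close> and \<open>y^2 = e d\<close> one power of
  \<open>d\<close> cancels, \<open>V^2 = e H^2 / d^3\<close>. So a cubic equation between
  \<open>V^2\<close> and \<open>n / d\<close> amounts to an identity homogeneous of degree 3 in
  \<open>n\<close> and \<open>d\<close>.\<close>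

lemma cubic_relation:
  assumes "d \<noteq> (0 :: 'a::field)" "y ^ 2 = e * d"
    and "e * H ^ 2 = c0 * d ^ 3 + c1 * n * d ^ 2 + c2 * n ^ 2 * d + c3 * n ^ 3"
  shows "(y * (H / d ^ 2)) ^ 2 = c0 + c1 * (n / d) + c2 * (n / d) ^ 2 + c3 * (n / d) ^ 3"
proof -
  have "(y * (H / d ^ 2)) ^ 2 = (y ^ 2 * H ^ 2) / d ^ 4"
    by (simp add: power_mult_distrib power_divide)
  also have "\<dots> = (e * H ^ 2) / d ^ 3"
    using assms(1) unfolding assms(2) by (simp add: eval_nat_numeral)
  also have "\<dots> = c0 + c1 * (n / d) + c2 * (n / d) ^ 2 + c3 * (n / d) ^ 3"
    unfolding assms(3) using assms(1) by (simp add: add_divide_distrib power_divide eval_nat_numeral)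
  finally show ?thesis .
qed

text \<open>The discriminant is homogeneous of degree 4 in the coefficients and isobaric of weight
  6; here \<open>l\<close> rescales the variable and \<open>m\<close> the whole polynomial.\<close>

lemma disc_scale:
  fixes C0 C1 C2 C3 l m :: "'a::field_char_0"
  shows "18*(C0*m)*(C1*l*m)*(C2*l^2*m)*(C3*l^3*m) - 4*(C2*l^2*m)^3*(C0*m) + (C2*l^2*m)^2*(C1*l*m)^2
      - 4*(C3*l^3*m)*(C1*l*m)^3 - 27*(C3*l^3*m)^2*(C0*m)^2 =
    l^6*m^4*(18*C0*C1*C2*C3 - 4*C2^3*C0 + C2^2*C1^2 - 4*C3*C1^3 - 27*C3^2*C0^2)"
  by Groebner_Basis.algebra

text \<open>
  The coefficients of the cubic polynomials \<open>V\<^sub>i\<^sup>2\<close> in \<open>U\<^sub>i\<close> come from comparing coefficients of powers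
  of \<open>x\<close>; in \<open>second_cubic\<close> the numerator of \<open>U\<^sub>2\<close> is multiplied by \<open>b\<^sup>2(b\<^sup>3 - 4ab + 9)\<close>, in \<open>third_cubic\<close>
  \<open>4ab = b\<^sup>3 + 9\<close> has been used to eliminate \<open>a\<close>.
\<close>

lemma first_disc:
  fixes a b :: "'a::field_char_0"
  defines "D \<equiv> 4*a^3 + 27 - 18*a*b - a^2*b^2 + 4*b^3"
  shows "18*4*(b^2-12*a)*(12*a^2-18*b-2*a*b^2)*(- D) - 4*(12*a^2-18*b-2*a*b^2)^3*4
      + (12*a^2-18*b-2*a*b^2)^2*(b^2-12*a)^2 - 4*(- D)*(b^2-12*a)^3 - 27*(- D)^2*4^2 = 16*(b^3-27)^3"
  unfolding D_def by Groebner_Basis.algebra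

lemma first_cubic:
  fixes a b x :: "'a::field_char_0"
  shows "(4*x^3 + b^2*x^2 + 2*b*x + 1) * (x^3 - b*x - 2)^2 =
    4 * (x^3+a*x^2+b*x+1)^3 + (b^2-12*a) * x^2 * (x^3+a*x^2+b*x+1)^2
    + (12*a^2-18*b-2*a*b^2) * (x^2)^2 * (x^3+a*x^2+b*x+1)
    + - (4*a^3 + 27 - 18*a*b - a^2*b^2 + 4*b^3) * (x^2)^3"
  by Groebner_Basis.algebra

lemma second_cubic:
  fixes x a b :: "'a::field_char_0"
  shows "(27-b^3)^3 * (x^3+a*x^2+b*x+1) * ((4*a*b - 8 - b^3)*x^3 - (b^2 - 4*a)*x^2 + b*x + 1)^2 =
    (2*b^3-9*a*b+27)^3 * (4*x^3+b^2*x^2+2*b*x+1)^3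
    + (972*a*b^2-729*b-189*b^4-b^7+18*a*b^5-729*a^2-54*a^2*b^3)
      * ((b*x+3)^2*((b^3-4*a*b+9)*x-(3*a-b^2))) * (4*x^3+b^2*x^2+2*b*x+1)^2
    + (27*b^2-54*a-a*b^3) * ((b*x+3)^2*((b^3-4*a*b+9)*x-(3*a-b^2)))^2 * (4*x^3+b^2*x^2+2*b*x+1)
    + - 1 * ((b*x+3)^2*((b^3-4*a*b+9)*x-(3*a-b^2)))^3"
  by Groebner_Basis.algebra

text \<open>The coefficients are those of \<open>second_cubic\<close>. The discriminant has no
  factors beyond those in the hypothesis of the theorem, so the roots are distinct throughout the
  generic case.\<close>

lemma second_disc:
  fixes a b :: "'a::field_char_0"
  defines "C0 \<equiv> (2*b^3-9*a*b+27)^3"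
    and "C1 \<equiv> 972*a*b^2-729*b-189*b^4-b^7+18*a*b^5-729*a^2-54*a^2*b^3"
    and "C2 \<equiv> 27*b^2-54*a-a*b^3"
  shows "18*C0*C1*C2*(- 1) - 4*C2^3*C0 + C2^2*C1^2 - 4*(- 1)*C1^3 - 27*(- 1)^2*C0^2 =
   - (4*a^3+27-18*a*b-a^2*b^2+4*b^3) * (b^3-27)^6"
  unfolding C0_def C1_def C2_def by Groebner_Basis.algebra

lemma second_cubic_b0:
  fixes x a m :: "'a::field_char_0"
  assumes "3 * m = a"
  shows "(x^3+a*x^2+1) * (8*x^3-4*a*x^2-1)^2 =
    1 * (4*x^3+1)^3 + - 3*a^2 * (x-m) * (4*x^3+1)^2 + - 18*a * (x-m)^2 * (4*x^3+1) + - 27 * (x-m)^3"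
  unfolding assms[symmetric] by Groebner_Basis.algebra

lemma third_cubic:
  fixes x b :: "'a::field_char_0"
  shows "16 * (4*b*x^3+(b^3+9)*x^2+4*b^2*x+4*b) * (b*x^3+9*x^2+b^2*x+b)^2 =
    b^3 * (4*x^3+b^2*x^2+2*b*x+1)^3 + (81-2*b^3) * (b*x+3)^2 * (4*x^3+b^2*x^2+2*b*x+1)^2
    + (b^3-18) * ((b*x+3)^2)^2 * (4*x^3+b^2*x^2+2*b*x+1) + ((b*x+3)^2)^3"
  by Groebner_Basis.algebra

text \<open>For \<open>4ab = b^3 + 9\<close> the first factor of the hypothesis equals
  \<open>(b^3 - 27)^2 / (16 b^3)\<close>; this is why only \<open>b\<close> and
  \<open>b^3 - 27\<close> occur.\<close>

lemma third_disc:
  fixes b :: "'a::field_char_0"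
  shows "18*b*(81-2*b^3)*(b^2*(b^3-18))*b^4 - 4*(b^2*(b^3-18))^3*b + (b^2*(b^3-18))^2*(81-2*b^3)^2
    - 4*b^4*(81-2*b^3)^3 - 27*(b^4)^2*b^2 = - 256*b^7*(b^3-27)^2"
  by Groebner_Basis.algebra

text \<open>A Bezout certificate with cofactors of degree 2 in \<open>z\<close>: at a common root of
  \<open>F\<close> and \<open>G\<close> the left side would vanish.\<close>

lemma F_G_resultant:
  fixes a b z :: "'a::field_char_0"
  shows "4*a^3+27-18*a*b-a^2*b^2+4*b^3 =
    ((36+12*b^3+b^6-40*a*b-7*a*b^4+12*a^2*b^2)
      + (3*b^4-24*b+b^7+8*a*b^2-6*a*b^5-16*a^2+8*a^2*b^3)*z
      + (28*b^2+4*b^5-48*a-24*a*b^3+32*a^2*b)*z^2) * (z^3+a*z^2+b*z+1)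
    + ((4*a^3-9-8*b^3-b^6+22*a*b+7*a*b^4-13*a^2*b^2)
      + (6*b+b^4-12*a*b^2-a*b^5+16*a^2+6*a^2*b^3-8*a^3*b)*z
      + (12*a-7*b^2-b^5+6*a*b^3-8*a^2*b)*z^2) * (4*z^3+b^2*z^2+2*b*z+1)"
  by Groebner_Basis.algebra

text \<open>The left side is \<open>e^3 G(u / e)\<close>, so \<open>G(t) \<noteq> 0\<close>: the
  zero \<open>t\<close> of the numerator of \<open>U_2\<close> is not one of the
  denominator.\<close>

lemma G_at_t:
  fixes a b :: "'a::field_char_0"
  defines "u \<equiv> 3*a-b^2" and "e \<equiv> b^3-4*a*b+9"
  shows "4*u^3+b^2*u^2*e+2*b*u*e^2+e^3 = - (4*a^3+27-18*a*b-a^2*b^2+4*b^3)*(b^3-27)"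
  unfolding u_def e_def by Groebner_Basis.algebra

section \<open>The curve of the theorem and its elliptic subfields\<close>

locale split_genus_2_curve = alg_closed_char_0 k for k :: "'a::field_char_0 set" +
  fixes a b x y F G :: 'a
  assumes a: "a \<in> k" and b: "b \<in> k"
    and D_nz: "4*a^3 + 27 - 18*a*b - a^2*b^2 + 4*b^3 \<noteq> 0" and B_nz: "b^3 - 27 \<noteq> 0"
    and x: "transc k x"
    and F: "F = x^3 + a*x^2 + b*x + 1" and G: "G = 4*x^3 + b^2*x^2 + 2*b*x + 1"
    and y_sq: "y^2 = G * F"
begin

definition Fp where "Fp = [:1, b, a, 1:]"
definition Gp where "Gp = [:1, 2*b, b^2, 4:]"

lemma Fp: "Fp \<in> polys k" "Polynomial.degree Fp = 3" "poly Fp x = F"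
  and Gp: "Gp \<in> polys k" "Polynomial.degree Gp = 3" "poly Gp x = G"
  using a b by (simp_all add: Fp_def Gp_def F G algebra_simps eval_nat_numeral)

lemma nz: "p \<in> polys k \<Longrightarrow> p \<noteq> 0 \<Longrightarrow> poly p x \<noteq> 0"
  using x by (auto simp: transc_def)

lemma FG_nz: "F \<noteq> 0" "G \<noteq> 0" "Fp \<noteq> 0" "Gp \<noteq> 0"
  using nz[OF Fp(1)] nz[OF Gp(1)] Fp Gp by (auto simp: Fp_def Gp_def)

lemma F_G_no_common_root:
  "z^3 + a*z^2 + b*z + 1 = 0 \<Longrightarrow> 4*z^3 + b^2*z^2 + 2*b*z + 1 \<noteq> 0"
  using F_G_resultant[of a b z] D_nz by auto

text \<open>\<open>F\<close> has minus the first factor of the hypothesis as discriminant,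
  \<open>G\<close> has \<open>16 (b^3 - 27)\<close>, and they share no root. This gives six distinct
  branch points, and \<open>2 * g + 2 = 6\<close>.\<close>

lemma genus_2: "y \<notin> adjoin k {x}" "has_genus k (adjoin k {x, y}) 2"
proof -
  have *: "18*1*b*a*1 - 4*a^3*1 + a^2*b^2 - 4*1*b^3 - 27*1^2*1^2 = - (4*a^3 + 27 - 18*a*b - a^2*b^2 + 4*b^3)"
    by (simp add: algebra_simps)
  obtain R1 where R1: "finite R1" "R1 \<subseteq> k" "card R1 = 3"
    "\<And>z. 1 + b * z + a * z^2 + 1 * z^3 = 1 * (\<Prod>e\<in>R1. z - e)"
  proof -
    have *: "18*1*b*a*1 - 4*a^3*1 + a^2*b^2 - 4*1*b^3 - 27*1^2*1^2 \<noteq> 0"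
      unfolding * using D_nz by (simp only: neg_equal_0_iff_equal not_False_eq_True simp_thms)
    from cubic_split[OF _ b a _ _ this] show ?thesis using that by auto
  qed
  have "18*1*(2*b)*b^2*4 - 4*(b^2)^3*1 + (b^2)^2*(2*b)^2 - 4*4*(2*b)^3 - 27*4^2*1^2 = 16 * (b^3 - 27)"
    by (simp add: algebra_simps eval_nat_numeral)
  then have "18*1*(2*b)*b^2*4 - 4*(b^2)^3*1 + (b^2)^2*(2*b)^2 - 4*4*(2*b)^3 - 27*4^2*1^2 \<noteq> 0"
    using B_nz by (simp only: mult_eq_0_iff) simp
  then obtain R2 where R2: "finite R2" "R2 \<subseteq> k" "card R2 = 3"
    "\<And>z. 1 + 2 * b * z + b^2 * z^2 + 4 * z^3 = 4 * (\<Prod>e\<in>R2. z - e)"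
    using cubic_split[of 1 "2 * b" "b^2" 4] b by (auto intro!: closed)
  have disj: "R1 \<inter> R2 = {}"
  proof (rule ccontr)
    assume "R1 \<inter> R2 \<noteq> {}"
    then obtain e where e: "e \<in> R1" "e \<in> R2" by auto
    have "1 + b * e + a * e^2 + 1 * e^3 = 0"
      unfolding R1(4) using R1(1) e by auto
    moreover have "1 + 2 * b * e + b^2 * e^2 + 4 * e^3 = 0"
      unfolding R2(4) using R2(1) e by auto
    ultimately show False using F_G_no_common_root[of e] by (simp add: algebra_simps)
  qed
  have "y ^ 2 = 4 * (\<Prod>e\<in>R1 \<union> R2. x - e)"
  proof -
    have "F = (\<Prod>e\<in>R1. x - e)" using R1(4)[of x] by (simp add: F algebra_simps)
    moreover have "G = 4 * (\<Prod>e\<in>R2. x - e)" using R2(4)[of x] by (simp add: G algebra_simps)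
    ultimately show ?thesis
      using prod.union_disjoint[OF R1(1) R2(1) disj, of "\<lambda>e. x - e"] by (simp add: y_sq mult_ac)
  qed
  moreover have "card (R1 \<union> R2) = 2 * 2 + 2" using card_Un_disjoint[OF R1(1) R2(1) disj] R1 R2 by simp
  ultimately show "y \<notin> adjoin k {x}" "has_genus k (adjoin k {x, y}) 2"
    using even_curve_genus[of "R1 \<union> R2" 2 4 x y] R1 R2 x by auto
qed

lemma y_notin: "y \<notin> adjoin k {x}"
  by (rule genus_2)

lemma irreducible: "ring_irreducible\<^bsub>(univ_poly Amb (adjoin k {x}))\<^esub> [1, 0, - (G * F)]"
proof -
  have "G * F \<in> adjoin k {x}"
    using poly_in_adjoin[OF Fp(1), of x] poly_in_adjoin[OF Gp(1), of x] unfolding Fp(3) Gp(3)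
    by (rule subfieldD(4)[OF subfield_adjoin, rotated])
  then show ?thesis using quadratic_irreducible[OF subfield_adjoin _ y_notin] by (simp add: y_sq)
qed

lemma w_in:
  assumes "p \<in> polys k" "q \<in> polys k" "p \<noteq> 0" "q \<noteq> 0" "c \<in> k" "c \<noteq> 0"
  shows "c * poly p x / poly q x ^ 2 \<in> adjoin k {x}" "c * poly p x / poly q x ^ 2 \<noteq> 0"
proof -
  note L = subfieldD[OF subfield_adjoin[of k "{x}"]]
  show "c * poly p x / poly q x ^ 2 \<in> adjoin k {x}"
    using assms adjoin_incl(1)[of k "{x}"] by (intro L poly_in_adjoin) auto
  show "c * poly p x / poly q x ^ 2 \<noteq> 0" using assms nz by auto
qed

text \<open>In \<open>cubic_relation\<close> the denominator \<open>d\<close> is \<open>F\<close>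
  and \<open>e\<close> is \<open>G\<close>. The two factors of the hypothesis enter separately: one
  as the leading coefficient \<open>- D\<close>, the other in the discriminant
  \<open>16 (b^3 - 27)^3\<close>.\<close>

lemma first_subfield:
  "elliptic_subfield k (adjoin k {x, y}) 3 (adjoin k {x^2 / F, y * ((x^3 - b*x - 2) / F^2)})"
proof -
  define D where "D = 4*a^3 + 27 - 18*a*b - a^2*b^2 + 4*b^3"
  have D: "D \<in> k" "D \<noteq> 0" using a b D_nz by (auto simp: D_def)
  define H where "H = [:- 2, - b, 0, 1:]"
  have H: "H \<in> polys k" "H \<noteq> 0" "poly H x = x^3 - b*x - 2"
    using b by (simp_all add: H_def algebra_simps eval_nat_numeral)
  show ?thesis
  proof (rule elliptic_subfield_of_degree_3[OF x y_notin, where n = "[:0, 0, 1:]" and d = Fp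
        and ?c0.0 = 4 and ?c1.0 = "b^2-12*a" and ?c2.0 = "12*a^2-18*b-2*a*b^2" and ?c3.0 = "- D"])
    show "x^2 / F = poly [:0, 0, 1:] x / poly Fp x" by (simp add: Fp power2_eq_square)
    show "poly Fp \<alpha> \<noteq> 0" if "poly [:0, 0, 1:] \<alpha> = 0" for \<alpha> using that by (simp add: Fp_def)
    show "(x^3 - b*x - 2) / F^2 \<in> adjoin k {x}" "(x^3 - b*x - 2) / F^2 \<noteq> 0"
      using w_in[of H Fp 1] H Fp FG_nz by simp_all
    show "18*4*(b^2-12*a)*(12*a^2-18*b-2*a*b^2)*(- D) - 4*(12*a^2-18*b-2*a*b^2)^3*4
      + (12*a^2-18*b-2*a*b^2)^2*(b^2-12*a)^2 - 4*(- D)*(b^2-12*a)^3 - 27*(- D)^2*4^2 \<noteq> 0"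
      using first_disc[of b a] B_nz by (simp add: D_def)
    show "(y * ((x^3 - b*x - 2) / F^2))^2 = 4 + (b^2-12*a) * (x^2 / F)
        + (12*a^2-18*b-2*a*b^2) * (x^2 / F)^2 + (- D) * (x^2 / F)^3"
      using first_cubic[of x b a] y_sq FG_nz(1)
      by (intro cubic_relation[of F y G]) (simp_all add: F G D_def)
  qed (use a b D Fp FG_nz in auto)
qed

lemma second_subfield:
  assumes b0: "b \<noteq> 0" and e0: "b^3 - 4*a*b + 9 \<noteq> 0" and r: "r \<in> k" "r^2 = 27 - b^3"
    and s: "s = - 3 / b" and t: "t = (3*a - b^2) / (b^3 - 4*a*b + 9)"
  shows "elliptic_subfield k (adjoin k {x, y}) 3 (adjoin k
    {(x - s)^2 * (x - t) / G,
     r * y / G^2 * ((4*a*b - 8 - b^3)*x^3 - (b^2 - 4*a)*x^2 + b*x + 1)})"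
proof -
  define e where "e = b^3 - 4*a*b + 9"
  \<comment> \<open>\<open>l\<close> clears the denominators of \<open>s\<close> and
    \<open>t\<close> in the numerator of \<open>U_2\<close>, as in \<open>second_cubic\<close>.
    \<open>m\<close> divides out \<open>(27 - b^3)^2\<close>: the identity there carries the factor
    \<open>(27 - b^3)^3\<close>, while \<open>r ^ 2\<close> supplies only
    \<open>27 - b^3\<close>.\<close>
  define l where "l = b^2 * e"
  define m where "m = inverse ((b^3 - 27)^2)"
  define C0 where "C0 = (2*b^3-9*a*b+27)^3"
  define C1 where "C1 = 972*a*b^2-729*b-189*b^4-b^7+18*a*b^5-729*a^2-54*a^2*b^3"
  define C2 where "C2 = 27*b^2-54*a-a*b^3"
  have k: "e \<in> k" "l \<in> k" "m \<in> k" "C0 \<in> k" "C1 \<in> k" "C2 \<in> k" "s \<in> k" "t \<in> k"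
    using a b by (auto simp: e_def l_def m_def C0_def C1_def C2_def s t)
  have e: "e \<noteq> 0" and l: "l \<noteq> 0" and m: "m \<noteq> 0" and r0: "r \<noteq> 0"
    using b0 e0 B_nz r(2) by (auto simp: e_def l_def m_def)
  have bs: "b * s = - 3" and et: "e * t = 3*a - b^2" using b0 e0 by (simp_all add: s t e_def)
  define W where "W = [:1, b, 4*a - b^2, 4*a*b - 8 - b^3:]"
  have W: "W \<in> polys k" "W \<noteq> 0" "poly W x = (4*a*b - 8 - b^3)*x^3 - (b^2 - 4*a)*x^2 + b*x + 1"
    using a b by (simp_all add: W_def algebra_simps eval_nat_numeral)
  define n where "n = [:- s, 1:] * ([:- s, 1:] * [:- t, 1:])"
  have n: "n \<in> polys k" "Polynomial.degree n = 3" "poly n z = (z - s)^2 * (z - t)" for z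
  proof -
    show "n \<in> polys k" unfolding n_def using k by (intro polys_mult) auto
    show "Polynomial.degree n = 3" unfolding n_def by (subst degree_mult_eq; simp add: degree_mult_eq del: mult_pCons_left mult_pCons_right)+
    show "poly n z = (z - s)^2 * (z - t)" by (simp add: n_def power2_eq_square algebra_simps)
  qed
  have ln: "l * ((x - s)^2 * (x - t)) = (b*x+3)^2 * (e*x-(3*a-b^2))"
  proof -
    have "l * ((x - s)^2 * (x - t)) = (b*x - b*s)^2 * (e*x - e*t)"
      by (simp add: l_def power2_eq_square algebra_simps)
    then show ?thesis by (simp add: bs et)
  qed
  have cop: "poly Gp \<alpha> \<noteq> 0" if "poly n \<alpha> = 0" for \<alpha>
  proof -
    have G\<alpha>: "poly Gp \<alpha> = 4*\<alpha>^3 + b^2*\<alpha>^2 + 2*b*\<alpha> + 1" for \<alpha>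
      by (simp add: Gp_def algebra_simps eval_nat_numeral)
    \<comment> \<open>Multiplied by \<open>b^3\<close>, the value \<open>G(s)\<close> becomes an
      expression in \<open>b * s = - 3\<close> and \<open>b^3\<close>.\<close>
    have "b^3 * poly Gp s = 4*(b*s)^3 + b^3*((b*s)^2 + 2*(b*s) + 1)"
      by (simp add: G\<alpha> algebra_simps eval_nat_numeral)
    also have "\<dots> = 4 * (b^3 - 27)" unfolding bs by (simp add: algebra_simps)
    finally have s0: "poly Gp s \<noteq> 0" using B_nz by auto
    have "e^3 * poly Gp t = 4*(e*t)^3 + b^2*(e*t)^2*e + 2*b*(e*t)*e^2 + e^3"
      by (simp add: G\<alpha> algebra_simps eval_nat_numeral)
    then have eq: "e^3 * poly Gp t = - (4*a^3+27-18*a*b-a^2*b^2+4*b^3)*(b^3-27)"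
      unfolding et using G_at_t[of a b] by (simp add: e_def)
    have "- (4*a^3+27-18*a*b-a^2*b^2+4*b^3)*(b^3-27) \<noteq> 0" using D_nz B_nz
      by (simp only: mult_eq_0_iff neg_equal_0_iff_equal simp_thms)
    then have "poly Gp t \<noteq> 0" using eq by (metis mult_zero_right)
    then show ?thesis using s0 that by (auto simp: n(3))
  qed
  have V: "r * y / G^2 * ((4*a*b - 8 - b^3)*x^3 - (b^2 - 4*a)*x^2 + b*x + 1) =
    y * (r * poly W x / G^2)" by (simp add: W(3))
  define N where "N = (x - s)^2 * (x - t)"
  show ?thesis unfolding V
  proof (rule elliptic_subfield_of_degree_3[OF x y_notin, where n = n and d = Gp and ?c0.0 = "C0*m"
        and ?c1.0 = "C1*l*m" and ?c2.0 = "C2*l^2*m" and ?c3.0 = "(- 1)*l^3*m"])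
    show "(x - s)^2 * (x - t) / G = poly n x / poly Gp x" by (simp add: n Gp)
    show "r * poly W x / G^2 \<in> adjoin k {x}" "r * poly W x / G^2 \<noteq> 0"
      using w_in[of W Gp r] W Gp FG_nz r r0 by simp_all
    show "18*(C0*m)*(C1*l*m)*(C2*l^2*m)*((- 1)*l^3*m) - 4*(C2*l^2*m)^3*(C0*m) + (C2*l^2*m)^2*(C1*l*m)^2
      - 4*((- 1)*l^3*m)*(C1*l*m)^3 - 27*((- 1)*l^3*m)^2*(C0*m)^2 \<noteq> 0"
    proof -
      have "- (4*a^3+27-18*a*b-a^2*b^2+4*b^3)*(b^3-27)^6 \<noteq> 0" using D_nz B_nz
        by (simp only: mult_eq_0_iff neg_equal_0_iff_equal power_eq_0_iff simp_thms)
      then show ?thesis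
        unfolding disc_scale C0_def C1_def C2_def second_disc using l m
        by (simp only: mult_eq_0_iff power_eq_0_iff simp_thms)
    qed
    have N_eq: "(27-b^3)^3 * F * poly W x ^ 2 =
      C0 * G^3 + C1 * (l * N) * G^2 + C2 * (l * N)^2 * G + (- 1) * (l * N)^3"
      unfolding N_def ln using second_cubic[of b x a]
      by (simp only: F G W(3) C0_def C1_def C2_def e_def)
    have "m * (27-b^3)^3 = 27 - b^3"
    proof -
      have "m * (b^3-27)^2 = 1" using B_nz by (simp add: m_def)
      moreover have "m * (27-b^3)^3 = m * (b^3-27)^2 * (27 - b^3)" by (simp add: eval_nat_numeral algebra_simps)
      ultimately show ?thesis by simp
    qed
    then have "F * (r * poly W x)^2 = m * ((27-b^3)^3 * F * poly W x ^ 2)"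
      using r(2) by (simp add: power_mult_distrib mult_ac)
    also have "\<dots> =
      (C0*m) * G^3 + (C1*l*m) * N * G^2 + (C2*l^2*m) * N^2 * G + ((- 1)*l^3*m) * N^3"
      unfolding N_eq by (simp add: power_mult_distrib algebra_simps)
    finally show "(y * (r * poly W x / G^2))^2 = (C0*m) + (C1*l*m) * ((x - s)^2 * (x - t) / G)
        + (C2*l^2*m) * ((x - s)^2 * (x - t) / G)^2 + ((- 1)*l^3*m) * ((x - s)^2 * (x - t) / G)^3"
      unfolding N_def[symmetric] using y_sq FG_nz(2) by (intro cubic_relation[of G y F]) (simp_all add: mult_ac)
  qed (use n Gp FG_nz cop k l m in \<open>auto intro!: closed\<close>)
qed

text \<open>The double zero \<open>s\<close> has moved to infinity and \<open>t = a / 3\<close>; the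
  numerator has degree 1, and degree 3 is attained by the denominator.\<close>

lemma second_subfield_b0:
  assumes b0: "b = 0"
  shows "elliptic_subfield k (adjoin k {x, y}) 3 (adjoin k
    {(3*x - a) / (3 * (4*x^3 + 1)), y * ((8*x^3 - 4*a*x^2 - 1) / (4*x^3 + 1)^2)})"
proof -
  have G0: "4*x^3 + 1 = G" using b0 by (simp add: G)
  define W where "W = [:- 1, 0, - 4*a, 8:]"
  have W: "W \<in> polys k" "W \<noteq> 0" "poly W x = 8*x^3 - 4*a*x^2 - 1"
    using a by (simp_all add: W_def algebra_simps eval_nat_numeral)
  define n where "n = [:- (a / 3), 1:]"
  have n: "n \<in> polys k" "Polynomial.degree n \<le> 3" "poly n x = x - a / 3"
    using a by (simp_all add: n_def)
  have U: "(3*x - a) / (3 * (4*x^3 + 1)) = (x - a / 3) / G"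
    unfolding G0 using FG_nz(2) by (simp add: field_simps)
  have cop: "poly Gp \<alpha> \<noteq> 0" if "poly n \<alpha> = 0" for \<alpha>
  proof -
    have "a = 3 * \<alpha>" using that by (auto simp: n_def field_simps)
    have "poly Gp \<alpha> = 4*\<alpha>^3 + 1" unfolding Gp_def using b0 by (simp add: eval_nat_numeral)
    \<comment> \<open>For \<open>b = 0\<close> this is the first factor of the hypothesis.\<close>
    then have "27 * poly Gp \<alpha> = 4*a^3 + 27" unfolding \<open>a = 3 * \<alpha>\<close> by (simp add: eval_nat_numeral)
    then show ?thesis using D_nz b0 by auto
  qed
  show ?thesis unfolding U unfolding G0
  proof (rule elliptic_subfield_of_degree_3[OF x y_notin, where n = n and d = Gp
        and ?c0.0 = 1 and ?c1.0 = "- 3*a^2" and ?c2.0 = "- 18*a" and ?c3.0 = "- 27"])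
    show "(x - a / 3) / G = poly n x / poly Gp x" by (simp add: n Gp)
    show "(8*x^3 - 4*a*x^2 - 1) / G^2 \<in> adjoin k {x}" "(8*x^3 - 4*a*x^2 - 1) / G^2 \<noteq> 0"
      using w_in[of W Gp 1] W Gp FG_nz by simp_all
    have *: "18*1*(- 3*a^2)*(- 18*a)*(- 27) - 4*(- 18*a)^3*1 + (- 18*a)^2*(- 3*a^2)^2
      - 4*(- 27)*(- 3*a^2)^3 - 27*(- 27)^2*1^2 = - 729 * (4*a^3 + 27)"
      by (simp add: eval_nat_numeral)
    show "18*1*(- 3*a^2)*(- 18*a)*(- 27) - 4*(- 18*a)^3*1 + (- 18*a)^2*(- 3*a^2)^2
      - 4*(- 27)*(- 3*a^2)^3 - 27*(- 27)^2*1^2 \<noteq> 0"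
      unfolding * using D_nz b0 by (simp only: mult_eq_0_iff) simp
    have "F = x^3 + a*x^2 + 1" using b0 by (simp add: F)
    then have "F * (8*x^3 - 4*a*x^2 - 1)^2 = 1 * G^3 + - 3*a^2 * (x - a / 3) * G^2
      + - 18*a * (x - a / 3)^2 * G + - 27 * (x - a / 3)^3"
      using second_cubic_b0[of "a / 3" a x] unfolding G0 by simp
    then show "(y * ((8*x^3 - 4*a*x^2 - 1) / G^2))^2 = 1 + (- 3*a^2) * ((x - a / 3) / G)
        + (- 18*a) * ((x - a / 3) / G)^2 + (- 27) * ((x - a / 3) / G)^3"
      using y_sq FG_nz(2) by (intro cubic_relation[of G y F]) (simp_all add: mult_ac)
  qed (use a n Gp FG_nz cop in \<open>auto intro!: closed\<close>)
qed

text \<open>Here \<open>t\<close> has moved to infinity and the numerator is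
  \<open>(x - s)^2\<close> with \<open>s = - 3 / b\<close>.\<close>

lemma second_subfield_double_root:
  assumes e0: "b^3 - 4*a*b + 9 = 0" and r: "r \<in> k" "r^2 = b"
  shows "elliptic_subfield k (adjoin k {x, y}) 3 (adjoin k
    {(b*x + 3)^2 / (b^2 * G), 8 / b * r * (y / G^2) * (b*x^3 + 9*x^2 + b^2*x + b)})"
proof -
  \<comment> \<open>\<open>b = 0\<close> would turn \<open>e0\<close> into
    \<open>9 = 0\<close>.\<close>
  have b0: "b \<noteq> 0" using e0 by auto
  then have r0: "r \<noteq> 0" using r by auto
  have ab: "4*a*b = b^3 + 9" using e0 by (simp add: algebra_simps)
  define W where "W = [:b, b^2, 9, b:]"
  have W: "W \<in> polys k" "W \<noteq> 0" "poly W x = b*x^3 + 9*x^2 + b^2*x + b"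
    using b b0 by (simp_all add: W_def algebra_simps eval_nat_numeral)
  define n where "n = [:9 / b^2, 6 / b, 1:]"
  have n: "n \<in> polys k" "Polynomial.degree n \<le> 3" and bn: "b^2 * poly n z = (b*z + 3)^2" for z
    using b b0 by (simp_all add: n_def field_simps eval_nat_numeral)
  define h where "h = 8 / b * r"
  have h: "h \<in> k" "h \<noteq> 0" using b b0 r r0 by (auto simp: h_def)
  have U: "(b*x + 3)^2 / (b^2 * G) = poly n x / G" using b0 by (simp flip: bn)
  have V: "8 / b * r * (y / G^2) * (b*x^3 + 9*x^2 + b^2*x + b) = y * (h * poly W x / G^2)"
    by (simp add: W(3) h_def)
  have cop: "poly Gp \<alpha> \<noteq> 0" if "poly n \<alpha> = 0" for \<alpha>
  proof -
    have "b * \<alpha> = - 3" using bn[of \<alpha>] that by (simp add: eq_neg_iff_add_eq_0)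
    have "b^3 * poly Gp \<alpha> = 4*(b*\<alpha>)^3 + b^3*((b*\<alpha>)^2 + 2*(b*\<alpha>) + 1)"
      by (simp add: Gp_def algebra_simps eval_nat_numeral)
    also have "\<dots> = 4 * (b^3 - 27)" unfolding \<open>b * \<alpha> = - 3\<close> by (simp add: algebra_simps)
    finally show ?thesis using B_nz by auto
  qed
  show ?thesis unfolding U V
  proof (rule elliptic_subfield_of_degree_3[OF x y_notin, where n = n and d = Gp
        and ?c0.0 = b and ?c1.0 = "81-2*b^3" and ?c2.0 = "b^2*(b^3-18)" and ?c3.0 = "b^4"])
    show "poly n x / G = poly n x / poly Gp x" by (simp add: Gp)
    show "h * poly W x / G^2 \<in> adjoin k {x}" "h * poly W x / G^2 \<noteq> 0"
      using w_in[of W Gp h] W Gp FG_nz h by simp_all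
    show "18*b*(81-2*b^3)*(b^2*(b^3-18))*b^4 - 4*(b^2*(b^3-18))^3*b + (b^2*(b^3-18))^2*(81-2*b^3)^2
        - 4*b^4*(81-2*b^3)^3 - 27*(b^4)^2*b^2 \<noteq> 0"
      unfolding third_disc using b0 B_nz by simp
    \<comment> \<open>The factor \<open>b^2\<close> is shared out: one \<open>b\<close> combines
      with \<open>h^2\<close> to 64, the other with \<open>F\<close>, where \<open>4 * a * b\<close>
      is then replaced by \<open>b^3 + 9\<close> to reach \<open>third_cubic\<close>.\<close>
    have "b^2 * (F * (h * poly W x)^2) = 16 * (4*b*x^3+(b^3+9)*x^2+4*b^2*x+4*b) * poly W x ^ 2"
    proof -
      have "b * h^2 = 64" using b0 r(2) by (simp add: h_def power_mult_distrib power_divide power2_eq_square)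
      then have "b^2 * (F * (h * poly W x)^2) = 64 * (b * F) * poly W x ^ 2"
        by (simp add: power_mult_distrib power2_eq_square[of b] mult_ac)
      also have "64 * (b * F) = 16 * (4*b*x^3+(4*a*b)*x^2+4*b^2*x+4*b)"
        by (simp add: F algebra_simps power2_eq_square)
      finally show ?thesis by (simp only: ab)
    qed
    also have "\<dots> = b^3 * G^3 + (81-2*b^3) * (b^2 * poly n x) * G^2
      + (b^3-18) * (b^2 * poly n x)^2 * G + (b^2 * poly n x)^3"
      unfolding bn W(3) third_cubic G ..
    also have "\<dots> = b^2 * (b * G^3 + (81-2*b^3) * poly n x * G^2
      + (b^2*(b^3-18)) * poly n x ^ 2 * G + b^4 * poly n x ^ 3)"
      by (simp add: power_mult_distrib algebra_simps eval_nat_numeral)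
    finally have "F * (h * poly W x)^2 = b * G^3 + (81-2*b^3) * poly n x * G^2
      + (b^2*(b^3-18)) * poly n x ^ 2 * G + b^4 * poly n x ^ 3"
      using b0 by simp
    then show "(y * (h * poly W x / G^2))^2 = b + (81-2*b^3) * (poly n x / G)
        + (b^2*(b^3-18)) * (poly n x / G)^2 + b^4 * (poly n x / G)^3"
      using y_sq FG_nz(2) by (intro cubic_relation[of G y F]) (simp_all add: mult_ac)
  qed (use b b0 n Gp FG_nz cop in \<open>auto intro!: closed\<close>)
qed

end

text \<open>Irreducibility of \<open>T^2 - G F\<close> over \<open>k(x)\<close> expresses that the
  equation defines a field; \<open>x\<close>, \<open>y\<close> are any solution in the ambient field
  with \<open>x\<close> transcendental. Quantifying over \<open>r\<close> covers both choices of
  each square root.\<close>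

theorem lemma7:
  fixes k K :: "'a::field_char_0 set" and a b x y F G :: 'a
  assumes "subfield k Amb" and "algebraically_closed (sub_ring k)"
    and "a \<in> k" and "b \<in> k"
    and "(4*a^3 + 27 - 18*a*b - a^2*b^2 + 4*b^3) * (b^3 - 27) \<noteq> 0"
    and "ring.transcendental Amb k x"
    and "F = x^3 + a*x^2 + b*x + 1"
    and "G = 4*x^3 + b^2*x^2 + 2*b*x + 1"
    and "y^2 = G * F"
    and "K = adjoin k {x, y}"
  shows "ring_irreducible\<^bsub>(univ_poly Amb (adjoin k {x}))\<^esub> [1, 0, - (G * F)]
    \<and> has_genus k K 2
    \<and> elliptic_subfield k K 3 (adjoin k {x^2 / F, y * ((x^3 - b*x - 2) / F^2)})
    \<and> (b * (b^3 - 4*a*b + 9) \<noteq> 0 \<longrightarrow>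
        (\<forall>r\<in>k. r^2 = 27 - b^3 \<longrightarrow>
          (let s = - 3 / b; t = (3*a - b^2) / (b^3 - 4*a*b + 9) in
            elliptic_subfield k K 3 (adjoin k
              {(x - s)^2 * (x - t) / G,
               r * y / G^2 * ((4*a*b - 8 - b^3)*x^3 - (b^2 - 4*a)*x^2 + b*x + 1)}))))
    \<and> (b = 0 \<longrightarrow>
        elliptic_subfield k K 3 (adjoin k
          {(3*x - a) / (3 * (4*x^3 + 1)),
           y * ((8*x^3 - 4*a*x^2 - 1) / (4*x^3 + 1)^2)}))
    \<and> (b^3 - 4*a*b + 9 = 0 \<longrightarrow>
        (\<forall>r\<in>k. r^2 = b \<longrightarrow>
          elliptic_subfield k K 3 (adjoin k
            {(b*x + 3)^2 / (b^2 * G),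
             8 / b * r * (y / G^2) * (b*x^3 + 9*x^2 + b^2*x + b)})))"
proof -
  interpret base_field k by (rule base_field.intro[OF assms(1)])
  have x: "transc k x" using assms(6) by (simp add: transcendental_iff)
  interpret split_genus_2_curve k a b x y F G
    using assms x
    by (intro split_genus_2_curve.intro alg_closed_char_0.intro alg_closed_base_field.intro
        alg_closed_base_field_axioms.intro split_genus_2_curve_axioms.intro base_field_axioms) auto
  show ?thesis
    unfolding assms(10) Let_def
    using irreducible genus_2(2) first_subfield second_subfield second_subfield_b0
      second_subfield_double_root by simp
qed

end
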